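(* Let $X$ be a complex manifold. The following are equivalent. (1) $X$ is intermediately cofibrant. (2) $X$ is projectively cofibrant. (3) $X$ is Stein.
   Context: Complex manifolds are second countable but not necessarily connected. The simplicial category of Stein manifolds. For complex manifolds $S$, $Z$, let $\mathcal O(S,Z)$ be the space of holomorphic maps $S\to Z$ with the compact-open topology and let $s\mathcal O(S,Z)$ be its singular simplicial set: its $n$-simplices are the continuous maps from the standard topological $n$-simplex to $\mathcal O(S,Z)$. Let $\mathcal S$ be the category of Stein manifolds and holomorphic maps (replaced by an equivalent small category), enriched over simplicial sets with mapping spaces $s\mathcal O(S,T)$. Prestacks. $\mathfrak S$ is the category of prestacks on $\mathcal S$, that is, of contravariant simplicial (i.e. simplicially enriched) functors from $\mathcal S$ to the category of simplicial sets, with simplicial natural transformations as morphisms. Colimits in $\mathfrak S$ are taken pointwise and levelwise. For a prestack $A$ and a simplicial set $K$, $A\times K$ is the prestack $T\mapsto A(T)\times K$. Every complex manifold $X$ (Stein or not) is regarded as an object of $\mathfrak S$, namely the prestack $s\mathcal O(\cdot,X)$. Write $\varnothing$ for the initial prestack. Cofibrations. A Stein inclusion is the inclusion $T\hookrightarrow S$ of a closed complex submanifold $T$ in a Stein manifold $S$. The generating projective cofibrations are the maps $S\times\partial\Delta^n\to S\times\Delta^n$, where $S$ is a Stein manifold and $n\geq 0$. The generating intermediate cofibrations are the maps $$S\times\partial\Delta^n\cup_{T\times\partial\Delta^n}T\times\Delta^n\to S\times\Delta^n,$$ where $T\hookrightarrow S$ is a Stein inclusion and $n\geq 0$; the case where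 $T$ is empty, with $T$ taken to be the initial prestack $\varnothing$, is included, so that every generating projective cofibration is a generating intermediate cofibration. The projective (respectively intermediate) cofibrations in $\mathfrak S$ are the retracts of transfinite compositions of pushouts of generating projective (respectively intermediate) cofibrations; these are the cofibrations of the projective (respectively intermediate) model structures on $\mathfrak S$. Cofibrancy. A prestack $A$ is projectively (respectively intermediately) cofibrant if the map $\varnothing\to A$ is a projective (respectively intermediate) cofibration. Equivalently, $A$ is a retract of a cell complex, i.e. of the target of a transfinite composition, with source $\varnothing$, of pushouts of generating projective (respectively intermediate) cofibrations. A complex manifold $X$ is projectively or intermediately cofibrant if the prestack $s\mathcal O(\cdot,X)$ is. *)

theory Defs
  imports "HOL-Analysis.Analysis" "HOL-Homology.Homology"
begin

section \<open>Complex manifolds\<close>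

text \<open>\<open>\<complex>\<^sup>n\<close> consists of the sequences that vanish from index \<open>n\<close> on, just as in the library's
  \<^const>\<open>Euclidean_space\<close>; in particular \<open>\<complex>\<^sup>k \<subseteq> \<complex>\<^sup>n\<close> for \<open>k \<le> n\<close>.\<close>

definition complex_space :: "nat \<Rightarrow> (nat \<Rightarrow> complex) topology" where
  "complex_space n =
     subtopology (product_topology (\<lambda>_. euclidean) UNIV) {z. \<forall>i\<ge>n. z i = 0}"

text \<open>Complex (Frechet) differentiability at every point of the open set \<open>W \<subseteq> \<complex>\<^sup>n\<close>; \<open>a\<close> is the
  vector of partial derivatives.\<close>

definition holomorphic_in :: "nat \<Rightarrow> (nat \<Rightarrow> complex) set \<Rightarrow> ((nat \<Rightarrow> complex) \<Rightarrow> complex) \<Rightarrow> bool" where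
  "holomorphic_in n W f \<longleftrightarrow>
     (\<forall>z\<in>W. \<exists>a :: nat \<Rightarrow> complex. \<forall>e>0. \<exists>d>0. \<forall>w\<in>W. (\<forall>i<n. cmod (w i - z i) < d) \<longrightarrow>
        cmod (f w - f z - (\<Sum>i<n. a i * (w i - z i))) \<le> e * (\<Sum>i<n. cmod (w i - z i)))"

record 'a chart =
  chart_dim :: nat
  chart_dom :: "'a set"
  chart_map :: "'a \<Rightarrow> nat \<Rightarrow> complex"

definition chart_inv :: "'a chart \<Rightarrow> (nat \<Rightarrow> complex) \<Rightarrow> 'a" where
  "chart_inv c = inv_into (chart_dom c) (chart_map c)"

definition chart_on :: "'a topology \<Rightarrow> 'a chart \<Rightarrow> bool" where
  "chart_on X c \<longleftrightarrow>
     openin X (chart_dom c) \<and>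
     openin (complex_space (chart_dim c)) (chart_map c ` chart_dom c) \<and>
     homeomorphic_map (subtopology X (chart_dom c))
       (subtopology (complex_space (chart_dim c)) (chart_map c ` chart_dom c)) (chart_map c)"

definition holomorphic_in_charts :: "'a chart \<Rightarrow> 'b chart \<Rightarrow> ('a \<Rightarrow> 'b) \<Rightarrow> bool" where
  "holomorphic_in_charts c d f \<longleftrightarrow>
     (\<forall>i<chart_dim d.
        holomorphic_in (chart_dim c) (chart_map c ` {x \<in> chart_dom c. f x \<in> chart_dom d})
          (\<lambda>z. chart_map d (f (chart_inv c z)) i))"

definition compatible_charts :: "'a chart \<Rightarrow> 'a chart \<Rightarrow> bool" where
  "compatible_charts c d \<longleftrightarrow>
     holomorphic_in_charts c d (\<lambda>x. x) \<and> holomorphic_in_charts d c (\<lambda>x. x)"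

record 'a cmanifold =
  mtop :: "'a topology"
  atlas :: "'a chart set"

abbreviation points :: "'a cmanifold \<Rightarrow> 'a set" where
  "points M \<equiv> topspace (mtop M)"

text \<open>The dimension belongs to the chart, so different connected components may have different
  dimensions. The empty manifold is allowed.\<close>

definition complex_manifold :: "'a cmanifold \<Rightarrow> bool" where
  "complex_manifold M \<longleftrightarrow>
     Hausdorff_space (mtop M) \<and> second_countable (mtop M) \<and>
     (\<forall>c\<in>atlas M. chart_on (mtop M) c) \<and>
     (\<Union>c\<in>atlas M. chart_dom c) = points M \<and>
     (\<forall>c\<in>atlas M. \<forall>d\<in>atlas M. compatible_charts c d)"

definition holomorphic_chart :: "'a cmanifold \<Rightarrow> 'a chart \<Rightarrow> bool" where
  "holomorphic_chart M c \<longleftrightarrow> chart_on (mtop M) c \<and> (\<forall>d\<in>atlas M. compatible_charts c d)"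

text \<open>Maps out of \<open>M\<close> are extensional on the points of \<open>M\<close>, so that they are determined by their
  values there.\<close>

definition holomorphic_maps :: "'a cmanifold \<Rightarrow> 'b cmanifold \<Rightarrow> ('a \<Rightarrow> 'b) set" where
  "holomorphic_maps M N =
     {f \<in> points M \<rightarrow>\<^sub>E points N. continuous_map (mtop M) (mtop N) f \<and>
        (\<forall>c\<in>atlas M. \<forall>d\<in>atlas N. holomorphic_in_charts c d f)}"

definition holomorphic_functions :: "'a cmanifold \<Rightarrow> ('a \<Rightarrow> complex) set" where
  "holomorphic_functions M =
     {f. \<forall>c\<in>atlas M. holomorphic_in (chart_dim c) (chart_map c ` chart_dom c) (\<lambda>z. f (chart_inv c z))}"

definition holomorphic_hull :: "'a cmanifold \<Rightarrow> 'a set \<Rightarrow> 'a set" where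
  "holomorphic_hull M K =
     {p \<in> points M. \<forall>f\<in>holomorphic_functions M. cmod (f p) \<le> (SUP q\<in>K. cmod (f q))}"

definition holomorphically_convex :: "'a cmanifold \<Rightarrow> bool" where
  "holomorphically_convex M \<longleftrightarrow>
     (\<forall>K. compactin (mtop M) K \<and> K \<noteq> {} \<longrightarrow> compactin (mtop M) (holomorphic_hull M K))"

definition holomorphically_separable :: "'a cmanifold \<Rightarrow> bool" where
  "holomorphically_separable M \<longleftrightarrow>
     (\<forall>p\<in>points M. \<forall>q\<in>points M. p \<noteq> q \<longrightarrow> (\<exists>f\<in>holomorphic_functions M. f p \<noteq> f q))"

definition stein :: "'a cmanifold \<Rightarrow> bool" where
  "stein M \<longleftrightarrow> complex_manifold M \<and> holomorphically_convex M \<and> holomorphically_separable M"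

text \<open>\<open>T\<close> carries the subspace topology, and around each of its points some holomorphic chart of \<open>S\<close>
  maps \<open>T\<close> onto a slice with \<open>\<complex>\<^sup>k\<close> and restricts to a holomorphic chart of \<open>T\<close>.\<close>

definition closed_submanifold :: "'a cmanifold \<Rightarrow> 'a cmanifold \<Rightarrow> bool" where
  "closed_submanifold T S \<longleftrightarrow>
     complex_manifold T \<and> complex_manifold S \<and>
     closedin (mtop S) (points T) \<and> mtop T = subtopology (mtop S) (points T) \<and>
     (\<forall>p\<in>points T. \<exists>c k. p \<in> chart_dom c \<and> holomorphic_chart S c \<and> k \<le> chart_dim c \<and>
        chart_map c ` (chart_dom c \<inter> points T)
          = chart_map c ` chart_dom c \<inter> topspace (complex_space k) \<and>
        holomorphic_chart T
          \<lparr>chart_dim = k, chart_dom = chart_dom c \<inter> points T, chart_map = chart_map c\<rparr>)"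

definition stein_inclusion :: "'a cmanifold \<Rightarrow> 'a cmanifold \<Rightarrow> bool" where
  "stein_inclusion T S \<longleftrightarrow> stein S \<and> closed_submanifold T S"

text \<open>The compact-open topology on the space of holomorphic maps; \<open>K = {}\<close> shows that its underlying
  set is all of \<^term>\<open>holomorphic_maps M N\<close>.\<close>

definition mapping_space :: "'a cmanifold \<Rightarrow> 'b cmanifold \<Rightarrow> ('a \<Rightarrow> 'b) topology" where
  "mapping_space M N =
     topology_generated_by
       {{f \<in> holomorphic_maps M N. f ` K \<subseteq> U} | K U. compactin (mtop M) K \<and> openin (mtop N) U}"


section \<open>Simplicial sets\<close>

definition Delta_maps :: "nat \<Rightarrow> nat \<Rightarrow> (nat \<Rightarrow> nat) set" where
  "Delta_maps m n = {\<theta> \<in> {..m} \<rightarrow>\<^sub>E {..n}. mono_on {..m} \<theta>}"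

text \<open>For \<open>\<theta>: [m] \<rightarrow> [n]\<close>, \<open>sop K m n \<theta>\<close> is the induced operator from \<open>n\<close>-simplices to \<open>m\<close>-simplices.\<close>

record 'b sset =
  cells :: "nat \<Rightarrow> 'b set"
  sop :: "nat \<Rightarrow> nat \<Rightarrow> (nat \<Rightarrow> nat) \<Rightarrow> 'b \<Rightarrow> 'b"

definition simplicial_set :: "'b sset \<Rightarrow> bool" where
  "simplicial_set K \<longleftrightarrow>
     (\<forall>m n. \<forall>\<theta>\<in>Delta_maps m n. \<forall>x\<in>cells K n. sop K m n \<theta> x \<in> cells K m) \<and>
     (\<forall>n. \<forall>x\<in>cells K n. sop K n n (\<lambda>i\<in>{..n}. i) x = x) \<and>
     (\<forall>l m n. \<forall>\<eta>\<in>Delta_maps l m. \<forall>\<theta>\<in>Delta_maps m n. \<forall>x\<in>cells K n.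
        sop K l m \<eta> (sop K m n \<theta> x) = sop K l n (compose {..l} \<theta> \<eta>) x)"

definition simplex_sset :: "nat \<Rightarrow> (nat \<Rightarrow> nat) sset" where
  "simplex_sset n =
     \<lparr>cells = (\<lambda>m. Delta_maps m n), sop = (\<lambda>l m \<eta> x. compose {..l} x \<eta>)\<rparr>"

definition boundary_sset :: "nat \<Rightarrow> (nat \<Rightarrow> nat) sset" where
  "boundary_sset n =
     \<lparr>cells = (\<lambda>m. {x \<in> Delta_maps m n. x ` {..m} \<noteq> {..n}}), sop = (\<lambda>l m \<eta> x. compose {..l} x \<eta>)\<rparr>"

text \<open>The affine map of standard simplices that sends the vertex \<open>i\<close> to the vertex \<open>\<theta> i\<close>.\<close>

definition affine_map :: "nat \<Rightarrow> (nat \<Rightarrow> nat) \<Rightarrow> (nat \<Rightarrow> real) \<Rightarrow> nat \<Rightarrow> real" where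
  "affine_map m \<theta> t = (\<lambda>j. \<Sum>i | i \<le> m \<and> \<theta> i = j. t i)"

definition singular_sset :: "'a topology \<Rightarrow> ((nat \<Rightarrow> real) \<Rightarrow> 'a) sset" where
  "singular_sset X =
     \<lparr>cells = (\<lambda>n. {\<sigma>. singular_simplex n X \<sigma>}),
      sop = (\<lambda>m n \<theta> \<sigma>. \<lambda>t\<in>standard_simplex m. \<sigma> (affine_map m \<theta> t))\<rparr>"


section \<open>The simplicial category of Stein manifolds\<close>

text \<open>A second countable Hausdorff manifold has at most continuum many points, hence is isomorphic to
  one whose points are real numbers. The latter, with all manifold structures (unrelated to the
  topology of the real line), form a small category equivalent to that of all Stein manifolds.\<close>

definition Steins :: "real cmanifold set" where
  "Steins = {S. stein S}"

type_synonym 'z map_simplex = "(nat \<Rightarrow> real) \<Rightarrow> real \<Rightarrow> 'z"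

abbreviation sO :: "real cmanifold \<Rightarrow> 'z cmanifold \<Rightarrow> 'z map_simplex sset" where
  "sO S Z \<equiv> singular_sset (mapping_space S Z)"

definition sO_id :: "real cmanifold \<Rightarrow> nat \<Rightarrow> real map_simplex" where
  "sO_id S n = (\<lambda>t\<in>standard_simplex n. \<lambda>x\<in>points S. x)"

text \<open>\<open>sO_comp T n \<tau> \<sigma>\<close> is the composition \<open>\<tau> \<circ> \<sigma>\<close> of \<open>n\<close>-simplices, where \<open>\<sigma>\<close> is a simplex of maps out
  of \<open>T\<close>.\<close>

definition sO_comp :: "real cmanifold \<Rightarrow> nat \<Rightarrow> 'z map_simplex \<Rightarrow> real map_simplex \<Rightarrow> 'z map_simplex" where
  "sO_comp T n \<tau> \<sigma> = (\<lambda>t\<in>standard_simplex n. compose (points T) (\<tau> t) (\<sigma> t))"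


section \<open>Prestacks\<close>

text \<open>The action of a contravariant simplicial functor \<open>A\<close> on mapping spaces is given by the simplicial
  maps \<open>sO(T,S) \<times> A(S) \<rightarrow> A(T)\<close> adjoint to \<open>sO(T,S) \<rightarrow> Map(A(S),A(T))\<close>; \<open>pull A T S n\<close> is the
  component in degree \<open>n\<close>.\<close>

record 'b prestack =
  val :: "real cmanifold \<Rightarrow> 'b sset"
  pull :: "real cmanifold \<Rightarrow> real cmanifold \<Rightarrow> nat \<Rightarrow> real map_simplex \<Rightarrow> 'b \<Rightarrow> 'b"

definition is_prestack :: "'b prestack \<Rightarrow> bool" where
  "is_prestack A \<longleftrightarrow>
     (\<forall>S\<in>Steins. simplicial_set (val A S)) \<and>
     (\<forall>T\<in>Steins. \<forall>S\<in>Steins. \<forall>n. \<forall>\<sigma>\<in>cells (sO T S) n. \<forall>x\<in>cells (val A S) n.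
        pull A T S n \<sigma> x \<in> cells (val A T) n \<and>
        (\<forall>m. \<forall>\<theta>\<in>Delta_maps m n.
           sop (val A T) m n \<theta> (pull A T S n \<sigma> x)
             = pull A T S m (sop (sO T S) m n \<theta> \<sigma>) (sop (val A S) m n \<theta> x))) \<and>
     (\<forall>S\<in>Steins. \<forall>n. \<forall>x\<in>cells (val A S) n. pull A S S n (sO_id S n) x = x) \<and>
     (\<forall>R\<in>Steins. \<forall>S\<in>Steins. \<forall>T\<in>Steins. \<forall>n.
        \<forall>\<sigma>\<in>cells (sO R S) n. \<forall>\<tau>\<in>cells (sO S T) n. \<forall>x\<in>cells (val A T) n.
        pull A R S n \<sigma> (pull A S T n \<tau> x) = pull A R T n (sO_comp R n \<tau> \<sigma>) x)"

type_synonym ('b, 'c) prestack_map = "real cmanifold \<Rightarrow> nat \<Rightarrow> 'b \<Rightarrow> 'c"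

definition prestack_hom :: "'b prestack \<Rightarrow> 'c prestack \<Rightarrow> ('b, 'c) prestack_map \<Rightarrow> bool" where
  "prestack_hom A B f \<longleftrightarrow>
     is_prestack A \<and> is_prestack B \<and>
     (\<forall>S\<in>Steins. \<forall>n. \<forall>x\<in>cells (val A S) n.
        f S n x \<in> cells (val B S) n \<and>
        (\<forall>m. \<forall>\<theta>\<in>Delta_maps m n.
           f S m (sop (val A S) m n \<theta> x) = sop (val B S) m n \<theta> (f S n x)) \<and>
        (\<forall>T\<in>Steins. \<forall>\<sigma>\<in>cells (sO T S) n.
           f T n (pull A T S n \<sigma> x) = pull B T S n \<sigma> (f S n x)))"

abbreviation inclusion :: "('b, 'b) prestack_map" where
  "inclusion \<equiv> (\<lambda>S n x. x)"

definition comp_map :: "('c, 'd) prestack_map \<Rightarrow> ('b, 'c) prestack_map \<Rightarrow> ('b, 'd) prestack_map" where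
  "comp_map g f = (\<lambda>S n x. g S n (f S n x))"

definition agree_on :: "'b prestack \<Rightarrow> ('b, 'c) prestack_map \<Rightarrow> ('b, 'c) prestack_map \<Rightarrow> bool" where
  "agree_on A f g \<longleftrightarrow> (\<forall>S\<in>Steins. \<forall>n. \<forall>x\<in>cells (val A S) n. f S n x = g S n x)"

definition initial_prestack :: "'b prestack" where
  "initial_prestack =
     \<lparr>val = (\<lambda>S. \<lparr>cells = (\<lambda>n. {}), sop = (\<lambda>m n \<theta> x. x)\<rparr>), pull = (\<lambda>T S n \<sigma> x. x)\<rparr>"

definition prestack_of :: "'z cmanifold \<Rightarrow> 'z map_simplex prestack" where
  "prestack_of X = \<lparr>val = (\<lambda>S. sO S X), pull = (\<lambda>T S n \<sigma> x. sO_comp T n x \<sigma>)\<rparr>"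

definition times_sset :: "'b prestack \<Rightarrow> 'k sset \<Rightarrow> ('b \<times> 'k) prestack" where
  "times_sset A K =
     \<lparr>val = (\<lambda>S. \<lparr>cells = (\<lambda>n. cells (val A S) n \<times> cells K n),
                  sop = (\<lambda>m n \<theta>. map_prod (sop (val A S) m n \<theta>) (sop K m n \<theta>))\<rparr>),
      pull = (\<lambda>T S n \<sigma>. map_prod (pull A T S n \<sigma>) id)\<rparr>"


section \<open>Pointwise and levelwise colimits\<close>

text \<open>The pushout of \<open>B \<leftarrow> A \<rightarrow> C\<close> along \<open>f\<close> and \<open>g\<close>: in each degree, the quotient of the disjoint union
  of \<open>B\<close> and \<open>C\<close> by the equivalence relation generated by \<open>f a \<sim> g a\<close>.\<close>

definition glue ::
  "'a prestack \<Rightarrow> ('a, 'b) prestack_map \<Rightarrow> ('a, 'c) prestack_map \<Rightarrow> real cmanifold \<Rightarrow> nat \<Rightarrow> ('b + 'c) rel" where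
  "glue A f g S n =
     (let r = {(Inl (f S n a), Inr (g S n a)) | a. a \<in> cells (val A S) n} in (r \<union> r\<inverse>)\<^sup>*)"

definition pushout ::
  "'a prestack \<Rightarrow> 'b prestack \<Rightarrow> 'c prestack \<Rightarrow> ('a, 'b) prestack_map \<Rightarrow> ('a, 'c) prestack_map
     \<Rightarrow> ('b + 'c) set prestack" where
  "pushout A B C f g =
     \<lparr>val = (\<lambda>S.
        \<lparr>cells = (\<lambda>n. (cells (val B S) n <+> cells (val C S) n) // glue A f g S n),
         sop = (\<lambda>m n \<theta> c. glue A f g S m ``
                  (map_sum (sop (val B S) m n \<theta>) (sop (val C S) m n \<theta>) ` c))\<rparr>),
      pull = (\<lambda>T S n \<sigma> c. glue A f g T n `` (map_sum (pull B T S n \<sigma>) (pull C T S n \<sigma>) ` c))\<rparr>"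

text \<open>The map out of a pushout induced by maps \<open>h\<close> out of \<open>B\<close> and \<open>k\<close> out of \<open>C\<close>.\<close>

definition copair :: "('b, 'd) prestack_map \<Rightarrow> ('c, 'd) prestack_map \<Rightarrow> (('b + 'c) set, 'd) prestack_map" where
  "copair h k = (\<lambda>S n c. the_elem (case_sum (h S n) (k S n) ` c))"

definition pushout_square ::
  "'a prestack \<Rightarrow> 'b prestack \<Rightarrow> 'c prestack \<Rightarrow> 'd prestack
     \<Rightarrow> ('a, 'b) prestack_map \<Rightarrow> ('a, 'c) prestack_map
     \<Rightarrow> ('b, 'd) prestack_map \<Rightarrow> ('c, 'd) prestack_map \<Rightarrow> bool" where
  "pushout_square A B C D f g h k \<longleftrightarrow>
     prestack_hom A B f \<and> prestack_hom A C g \<and> prestack_hom B D h \<and> prestack_hom C D k \<and>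
     agree_on A (comp_map h f) (comp_map k g) \<and>
     (\<forall>S\<in>Steins. \<forall>n.
        bij_betw (copair h k S n) (cells (val (pushout A B C f g) S) n) (cells (val D S) n))"

text \<open>\<open>B\<close>, with the cocone \<open>k\<close>, is the colimit of the diagram \<open>A, m\<close> indexed by the nonempty subset
  \<open>I\<close> of the well-order \<open>r\<close>: in each degree, the usual description of a directed colimit of sets.\<close>

definition chain_colimit ::
  "'i set \<Rightarrow> 'i rel \<Rightarrow> ('i \<Rightarrow> 'b prestack) \<Rightarrow> ('i \<Rightarrow> 'i \<Rightarrow> ('b, 'b) prestack_map)
     \<Rightarrow> 'c prestack \<Rightarrow> ('i \<Rightarrow> ('b, 'c) prestack_map) \<Rightarrow> bool" where
  "chain_colimit I r A m B k \<longleftrightarrow>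
     (\<forall>i\<in>I. prestack_hom (A i) B (k i)) \<and>
     (\<forall>i\<in>I. \<forall>j\<in>I. (i, j) \<in> r \<longrightarrow> agree_on (A i) (k i) (comp_map (k j) (m i j))) \<and>
     (\<forall>S\<in>Steins. \<forall>n.
        (\<forall>y\<in>cells (val B S) n. \<exists>i\<in>I. \<exists>x\<in>cells (val (A i) S) n. y = k i S n x) \<and>
        (\<forall>i\<in>I. \<forall>j\<in>I. \<forall>x\<in>cells (val (A i) S) n. \<forall>y\<in>cells (val (A j) S) n.
           k i S n x = k j S n y \<longrightarrow>
           (\<exists>l\<in>I. (i, l) \<in> r \<and> (j, l) \<in> r \<and> m i l S n x = m j l S n y)))"


section \<open>Cofibrations\<close>

text \<open>A class of maps of prestacks is a predicate on source, target and map.\<close>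

type_synonym ('b, 'c) map_class = "'b prestack \<Rightarrow> 'c prestack \<Rightarrow> ('b, 'c) prestack_map \<Rightarrow> bool"

definition is_pushout_of :: "('p, 'q) map_class \<Rightarrow> ('b, 'c) map_class" where
  "is_pushout_of J B D h \<longleftrightarrow>
     (\<exists>P Q j a k. J P Q j \<and> pushout_square P B Q D a j h k)"

text \<open>The transfinite composition of an ordinal-indexed sequence, the ordinal being given as a nonempty
  well-order \<open>r\<close>. The index \<open>j\<close> is the successor of \<open>i\<close> if \<open>underS r j = under r i\<close>.\<close>

definition transfinite_composition_of :: "('u, 'u) map_class \<Rightarrow> ('u, 'u) map_class" where
  "transfinite_composition_of W C D f \<longleftrightarrow>
     (\<exists>(r :: 'u rel) A m k b.
        Well_order r \<and>
        (\<forall>i j. (i, j) \<in> r \<longrightarrow> prestack_hom (A i) (A j) (m i j)) \<and>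
        (\<forall>i\<in>Field r. agree_on (A i) (m i i) inclusion) \<and>
        (\<forall>i j l. (i, j) \<in> r \<and> (j, l) \<in> r \<longrightarrow> agree_on (A i) (m i l) (comp_map (m j l) (m i j))) \<and>
        (\<forall>i\<in>Field r. \<forall>j\<in>Field r. underS r j = under r i \<longrightarrow> W (A i) (A j) (m i j)) \<and>
        (\<forall>j\<in>Field r. underS r j \<noteq> {} \<and> (\<nexists>i. i \<in> Field r \<and> underS r j = under r i) \<longrightarrow>
           chain_colimit (underS r j) r A m (A j) (\<lambda>i. m i j)) \<and>
        chain_colimit (Field r) r A m D k \<and>
        b \<in> Field r \<and> underS r b = {} \<and> C = A b \<and> agree_on C f (k b))"

definition retract_of_map ::
  "'a prestack \<Rightarrow> 'b prestack \<Rightarrow> ('a, 'b) prestack_map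
     \<Rightarrow> 'c prestack \<Rightarrow> 'd prestack \<Rightarrow> ('c, 'd) prestack_map \<Rightarrow> bool" where
  "retract_of_map A B f C D g \<longleftrightarrow>
     (\<exists>i p i' p'.
        prestack_hom A C i \<and> prestack_hom C A p \<and> agree_on A (comp_map p i) inclusion \<and>
        prestack_hom B D i' \<and> prestack_hom D B p' \<and> agree_on B (comp_map p' i') inclusion \<and>
        agree_on A (comp_map i' f) (comp_map g i) \<and> agree_on C (comp_map p' g) (comp_map f p))"

text \<open>HOL cannot quantify over types inside a formula, so the transfinite compositions are formed
  relative to a universe of simplices and indices. The type variable \<open>'u\<close> makes the universe as large
  as desired; the second summand ensures that it is never too small to contain a copy of the prestack
  \<open>sO(\<cdot>,S)\<close> of a Stein manifold \<open>S\<close>.\<close>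

type_synonym 'u large = "'u + real map_simplex"

definition cofibration ::
  "'u itself \<Rightarrow> ('p, 'q) map_class \<Rightarrow> ('a, 'b) map_class" where
  "cofibration _ J A B f \<longleftrightarrow>
     prestack_hom A B f \<and>
     (\<exists>(C :: 'u large prestack) (D :: 'u large prestack) g.
        transfinite_composition_of (is_pushout_of J) C D g \<and> retract_of_map A B f C D g)"

definition generating_projective ::
  "(real map_simplex \<times> (nat \<Rightarrow> nat), real map_simplex \<times> (nat \<Rightarrow> nat)) map_class" where
  "generating_projective P Q j \<longleftrightarrow>
     (\<exists>S\<in>Steins. \<exists>n.
        P = times_sset (prestack_of S) (boundary_sset n) \<and>
        Q = times_sset (prestack_of S) (simplex_sset n) \<and> j = inclusion)"

text \<open>The prestack \<open>sO(\<cdot>,{})\<close> of the empty manifold is not initial, since it has a point over the empty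
  manifold; as the subobject of a Stein inclusion the empty manifold stands for the initial prestack.\<close>

definition prestack_of_sub :: "real cmanifold \<Rightarrow> real map_simplex prestack" where
  "prestack_of_sub T = (if points T = {} then initial_prestack else prestack_of T)"

text \<open>For \<open>T \<subseteq> S\<close> a map into \<open>T\<close> is literally a map into \<open>S\<close>, so that \<open>T \<times> K \<rightarrow> S \<times> L\<close> is an
  inclusion for \<open>K \<subseteq> L\<close>.\<close>

definition generating_intermediate ::
  "((real map_simplex \<times> (nat \<Rightarrow> nat) + real map_simplex \<times> (nat \<Rightarrow> nat)) set,
    real map_simplex \<times> (nat \<Rightarrow> nat)) map_class" where
  "generating_intermediate P Q j \<longleftrightarrow>
     (\<exists>T S n. stein_inclusion T S \<and>
        P = pushout (times_sset (prestack_of_sub T) (boundary_sset n))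
              (times_sset (prestack_of S) (boundary_sset n))
              (times_sset (prestack_of_sub T) (simplex_sset n)) inclusion inclusion \<and>
        Q = times_sset (prestack_of S) (simplex_sset n) \<and>
        j = copair inclusion inclusion)"

definition cofibrant :: "'u itself \<Rightarrow> ('p, 'q) map_class \<Rightarrow> 'b prestack \<Rightarrow> bool" where
  "cofibrant U J A \<longleftrightarrow> cofibration U J (initial_prestack :: 'b prestack) A inclusion"

definition projectively_cofibrant :: "'u itself \<Rightarrow> 'z cmanifold \<Rightarrow> bool" where
  "projectively_cofibrant U X \<longleftrightarrow> cofibrant U generating_projective (prestack_of X)"

definition intermediately_cofibrant :: "'u itself \<Rightarrow> 'z cmanifold \<Rightarrow> bool" where
  "intermediately_cofibrant U X \<longleftrightarrow> cofibrant U generating_intermediate (prestack_of X)"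

end

theory Submission
  imports Defs "HOL-Complex_Analysis.Conformal_Mappings"
begin

text \<open>A Stein manifold \<open>S\<close> is cofibrant because \<open>\<emptyset> \<rightarrow> S\<close> is itself a generating cofibration with \<open>n = 0\<close>.
  Conversely, let \<open>X\<close> be a retract of a cell complex \<open>D\<close>. In degree \<open>0\<close> only the cells with \<open>n = 0\<close>
  matter, and since \<open>O(\<cdot>,T) \<rightarrow> O(\<cdot>,S)\<close> is injective, \<open>D(R)\<close> is in degree \<open>0\<close> the disjoint union, over
  the cells \<open>(S\<^sub>i, T\<^sub>i)\<close>, of \<open>O(R,S\<^sub>i)\<close> minus \<open>O(R,T\<^sub>i)\<close>. The inclusion of a coordinate polydisc \<open>B\<close> in
  \<open>X\<close> is sent to a map \<open>B \<rightarrow> S\<^sub>i\<close> that does not factor through \<open>T\<^sub>i\<close>; by the identity theorem neither do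
  its restrictions to smaller polydiscs. So \<open>i\<close> is locally constant on \<open>X\<close> and these maps glue to
  \<open>X\<^sub>i \<rightarrow> S\<^sub>i\<close> on an open and closed part \<open>X\<^sub>i\<close> of \<open>X\<close>, with left inverse \<open>S\<^sub>i \<rightarrow> D \<rightarrow> X\<close>. Hence \<open>X\<close> is
  holomorphically convex and separable.\<close>

section \<open>Holomorphy in charts\<close>

text \<open>Prestacks are evaluated on Stein manifolds only, so before \<open>X\<close> is known to
  be Stein the retraction cannot be tested on the identity of \<open>X\<close>. It is tested on the
  inclusions of polydiscs, which are Stein and form a basis, and uniqueness of the pair (cell, map)
  is what lets the results be glued. The identity theorem deals with the submanifolds: a map outside
  \<open>T i\<close> might fall into \<open>T i\<close> on a smaller set, and its restriction would
  then be a vertex of an earlier stage. The left inverse comes from the Yoneda lemma: the identity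
  of \<open>S i\<close> gives a vertex of \<open>D\<close> over \<open>S i\<close>, its image in
  \<open>X\<close> is a holomorphic map \<open>r i\<close>, and by naturality \<open>r i\<close>
  after \<open>s\<close> is the original map whenever \<open>(i, s)\<close> is its normal form. A
  continuous left inverse suffices for convexity: the hull of a compact set in \<open>X\<close> is
  caught in finitely many images under the \<open>r i\<close> of hulls in the \<open>S i\<close>.
  The points of \<open>X\<close> may have any type while those of the test manifolds are real, so
  both directions pass through a copy of \<open>X\<close> with real points.\<close>

definition diff_bound ::
  "'a chart \<Rightarrow> 'b chart \<Rightarrow> ('a \<Rightarrow> 'b) \<Rightarrow> 'a \<Rightarrow> nat \<Rightarrow> (nat \<Rightarrow> complex) \<Rightarrow> real \<Rightarrow> real \<Rightarrow> bool" where
  "diff_bound c d f x i a e \<delta> \<longleftrightarrow>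
     (\<forall>y\<in>chart_dom c. f y \<in> chart_dom d \<longrightarrow>
        (\<forall>j<chart_dim c. cmod (chart_map c y j - chart_map c x j) < \<delta>) \<longrightarrow>
        cmod (chart_map d (f y) i - chart_map d (f x) i
                - (\<Sum>j<chart_dim c. a j * (chart_map c y j - chart_map c x j)))
          \<le> e * (\<Sum>j<chart_dim c. cmod (chart_map c y j - chart_map c x j)))"

text \<open>The pointwise form of \<^const>\<open>holomorphic_in_charts\<close>, free of \<^const>\<open>chart_inv\<close>, so that it passes
  directly to restricted and transported charts.\<close>

definition hol_at :: "'a chart \<Rightarrow> 'b chart \<Rightarrow> ('a \<Rightarrow> 'b) \<Rightarrow> 'a \<Rightarrow> bool" where
  "hol_at c d f x \<longleftrightarrow> (\<forall>i<chart_dim d. \<exists>a. \<forall>e>0. \<exists>\<delta>>0. diff_bound c d f x i a e \<delta>)"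

lemma holomorphic_in_charts_iff:
  assumes "inj_on (chart_map c) (chart_dom c)"
  shows "holomorphic_in_charts c d f \<longleftrightarrow>
           (\<forall>x\<in>chart_dom c. f x \<in> chart_dom d \<longrightarrow> hol_at c d f x)"
proof -
  have inv: "chart_inv c (chart_map c y) = y" if "y \<in> chart_dom c" for y
    using that assms by (simp add: chart_inv_def)
  define A where "A = {x \<in> chart_dom c. f x \<in> chart_dom d}"
  define G where "G i x \<longleftrightarrow> (\<exists>a. \<forall>e>0. \<exists>\<delta>>0. diff_bound c d f x i a e \<delta>)" for i x
  have db: "diff_bound c d f x i a e \<delta> \<longleftrightarrow>
     (\<forall>y\<in>A. (\<forall>j<chart_dim c. cmod (chart_map c y j - chart_map c x j) < \<delta>) \<longrightarrow>
        cmod (chart_map d (f y) i - chart_map d (f x) i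
                - (\<Sum>j<chart_dim c. a j * (chart_map c y j - chart_map c x j)))
          \<le> e * (\<Sum>j<chart_dim c. cmod (chart_map c y j - chart_map c x j)))" for x i a e \<delta>
    unfolding diff_bound_def A_def by blast
  have invA: "chart_inv c (chart_map c y) = y" if "y \<in> A" for y
    using that inv by (simp add: A_def)
  have 1: "holomorphic_in (chart_dim c) (chart_map c ` A) (\<lambda>z. chart_map d (f (chart_inv c z)) i)
      \<longleftrightarrow> (\<forall>x\<in>A. G i x)" for i
    unfolding holomorphic_in_def G_def db by (simp add: invA cong: ball_cong)
  have 2: "hol_at c d f x \<longleftrightarrow> (\<forall>i<chart_dim d. G i x)" for x
    unfolding hol_at_def G_def by simp
  show ?thesis
    unfolding holomorphic_in_charts_def A_def[symmetric] 1 2 by (auto simp: A_def)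
qed

section \<open>The topology of coordinate space and of charts\<close>

lemma openin_complex_space:
  "openin (complex_space n) U \<longleftrightarrow>
     U \<subseteq> {z. \<forall>i\<ge>n. z i = 0} \<and>
     (\<forall>z\<in>U. \<exists>d>0. \<forall>w. (\<forall>i\<ge>n. w i = 0) \<longrightarrow> (\<forall>i<n. cmod (w i - z i) < d) \<longrightarrow> w \<in> U)"
  (is "?L \<longleftrightarrow> ?R")
proof
  assume ?L
  then obtain V where V: "openin (product_topology (\<lambda>_. euclidean) UNIV) V"
    and U: "U = V \<inter> {z. \<forall>i\<ge>n. z i = 0}"
    unfolding complex_space_def openin_subtopology by auto
  have "\<exists>d>0. \<forall>w. (\<forall>i\<ge>n. w i = 0) \<longrightarrow> (\<forall>i<n. cmod (w i - z i) < d) \<longrightarrow> w \<in> U"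
    if z: "z \<in> U" for z
  proof -
    from z U have "z \<in> V" by auto
    with V obtain W where W: "\<And>i. open (W i)" "\<And>i. z i \<in> W i" "Pi\<^sub>E UNIV W \<subseteq> V"
      unfolding openin_product_topology_alt by (fastforce simp: PiE_iff)
    have "\<forall>i. \<exists>d>0. ball (z i) d \<subseteq> W i"
      using W(1,2) open_contains_ball by blast
    then obtain d where d: "\<And>i. d i > 0" "\<And>i. ball (z i) (d i) \<subseteq> W i" by metis
    \<comment> \<open>The inserted 1 keeps \<open>Min\<close> meaningful when \<open>n = 0\<close>.
      Only the first \<open>n\<close> discs matter, since the later coordinates of both points are
      0.\<close>
    define D where "D = Min (insert 1 (d ` {..<n}))"
    have D: "D > 0" "\<And>i. i < n \<Longrightarrow> D \<le> d i" unfolding D_def using d(1) by (auto intro: Min_le)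
    have "w \<in> U" if w: "\<forall>i\<ge>n. w i = 0" "\<forall>i<n. cmod (w i - z i) < D" for w
    proof -
      have "w i \<in> W i" for i
      proof (cases "i < n")
        case True
        then have "w i \<in> ball (z i) (d i)" using w(2) D(2)[of i]
          by (force simp: dist_norm norm_minus_commute)
        then show ?thesis using d(2) by blast
      next
        case False
        then show ?thesis using w(1) z U W(2)[of i] by auto
      qed
      then show ?thesis using W(3) w(1) U by auto
    qed
    then show ?thesis using D(1) by blast
  qed
  then show ?R using U by auto
next
  assume R: ?R
  then have "\<forall>z\<in>U. \<exists>d>0. \<forall>w. (\<forall>i\<ge>n. w i = 0) \<longrightarrow> (\<forall>i<n. cmod (w i - z i) < d) \<longrightarrow> w \<in> U"
    by simp
  from bchoice[OF this] obtain d where "\<forall>z\<in>U. d z > 0 \<and>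
     (\<forall>w. (\<forall>i\<ge>n. w i = 0) \<longrightarrow> (\<forall>i<n. cmod (w i - z i) < d z) \<longrightarrow> w \<in> U)" ..
  then have d: "\<And>z. z \<in> U \<Longrightarrow> d z > 0"
    "\<And>z w. z \<in> U \<Longrightarrow> (\<forall>i\<ge>n. w i = 0) \<Longrightarrow> (\<forall>i<n. cmod (w i - z i) < d z) \<Longrightarrow> w \<in> U"
    by simp_all
  define B where "B z = Pi\<^sub>E UNIV (\<lambda>i. if i < n then ball (z i) (d z) else UNIV)" for z :: "nat \<Rightarrow> complex"
  have "openin (product_topology (\<lambda>_. euclidean) UNIV) (B z)" for z
    unfolding B_def
    by (rule product_topology_basis) (auto intro: finite_subset[of _ "{..<n}"])
  then have "openin (product_topology (\<lambda>_. euclidean) UNIV) (\<Union>z\<in>U. B z)" by auto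
  moreover have "U = (\<Union>z\<in>U. B z) \<inter> {z. \<forall>i\<ge>n. z i = 0}"
  proof -
    have "z \<in> B z" if "z \<in> U" for z using d(1)[OF that] by (auto simp: B_def)
    moreover have "w \<in> U" if "z \<in> U" "w \<in> B z" "\<forall>i\<ge>n. w i = 0" for z w
    proof (rule d(2)[OF that(1,3)], intro allI impI)
      fix i assume "i < n"
      then have "w i \<in> ball (z i) (d z)" using that(2) by (auto simp: B_def PiE_iff split: if_splits)
      then show "cmod (w i - z i) < d z" by (simp add: dist_norm norm_minus_commute)
    qed
    ultimately show ?thesis using R by blast
  qed
  ultimately show ?L unfolding complex_space_def openin_subtopology by auto
qed

lemma topspace_complex_space: "topspace (complex_space n) = {z. \<forall>i\<ge>n. z i = 0}"
  by (simp add: complex_space_def)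

lemma chart_inj_on: "chart_on X c \<Longrightarrow> inj_on (chart_map c) (chart_dom c)"
  unfolding chart_on_def
  by (metis homeomorphic_eq_everything_map openin_subset topspace_subtopology_subset)

lemma chart_dom_subset: "chart_on X c \<Longrightarrow> chart_dom c \<subseteq> topspace X"
  unfolding chart_on_def using openin_subset by blast

lemma chart_map_zero: "chart_on X c \<Longrightarrow> x \<in> chart_dom c \<Longrightarrow> i \<ge> chart_dim c \<Longrightarrow> chart_map c x i = 0"
  unfolding chart_on_def openin_complex_space by auto

lemma chart_continuous:
  "chart_on X c \<Longrightarrow> continuous_map (subtopology X (chart_dom c)) (complex_space (chart_dim c)) (chart_map c)"
  unfolding chart_on_def
  using continuous_map_into_fulltopology homeomorphic_imp_continuous_map by blast

lemma chart_open_image: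
  assumes "chart_on X c" "openin X V"
  shows "openin (complex_space (chart_dim c)) (chart_map c ` (chart_dom c \<inter> V))"
proof -
  have "open_map (subtopology X (chart_dom c))
       (subtopology (complex_space (chart_dim c)) (chart_map c ` chart_dom c)) (chart_map c)"
    using assms(1) homeomorphic_imp_open_map unfolding chart_on_def by blast
  moreover have "openin (subtopology X (chart_dom c)) (chart_dom c \<inter> V)"
    using assms(2) by (metis inf_commute openin_subtopology)
  ultimately show ?thesis
    using assms(1) unfolding chart_on_def open_map_def by (metis openin_trans_full)
qed

text \<open>The chart is open, so the image of \<open>V\<close> contains a polydisc, and by
  injectivity of the chart all chart points over that polydisc lie in \<open>V\<close>. The last
  conclusion records that the polydisc is completely filled by such points.\<close>

lemma chart_nbhd:
  assumes "chart_on X c" "openin X V" "x \<in> chart_dom c" "x \<in> V"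
  obtains \<delta> where "\<delta> > 0"
    "\<And>y. y \<in> chart_dom c \<Longrightarrow> (\<forall>j<chart_dim c. cmod (chart_map c y j - chart_map c x j) < \<delta>) \<Longrightarrow> y \<in> V"
    "\<And>w. (\<forall>i\<ge>chart_dim c. w i = 0) \<Longrightarrow> (\<forall>j<chart_dim c. cmod (w j - chart_map c x j) < \<delta>) \<Longrightarrow>
        \<exists>y\<in>chart_dom c \<inter> V. chart_map c y = w"
proof -
  have "chart_map c x \<in> chart_map c ` (chart_dom c \<inter> V)" using assms by auto
  then obtain \<delta> where \<delta>: "\<delta> > 0" "\<And>w. (\<forall>i\<ge>chart_dim c. w i = 0) \<Longrightarrow>
     (\<forall>i<chart_dim c. cmod (w i - chart_map c x i) < \<delta>) \<Longrightarrow> w \<in> chart_map c ` (chart_dom c \<inter> V)"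
    using chart_open_image[OF assms(1,2)] unfolding openin_complex_space by blast
  show thesis
  proof (rule that[OF \<delta>(1)])
    show "y \<in> V" if "y \<in> chart_dom c" "\<forall>j<chart_dim c. cmod (chart_map c y j - chart_map c x j) < \<delta>" for y
    proof -
      have "chart_map c y \<in> chart_map c ` (chart_dom c \<inter> V)"
        using that chart_map_zero[OF assms(1)] by (intro \<delta>(2)) auto
      then show ?thesis using that(1) chart_inj_on[OF assms(1)] by (auto dest: inj_onD)
    qed
  qed (use \<delta>(2) in blast)
qed

text \<open>Membership in \<open>chart_dom c\<close> may truncate the polydisc at the edge of the
  chart; that nothing is cut off is expressed separately by \<open>full_polydisc\<close>.\<close>

definition chart_polydisc :: "'a chart \<Rightarrow> 'a \<Rightarrow> real \<Rightarrow> 'a set" where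
  "chart_polydisc c x \<delta> =
     {y \<in> chart_dom c. \<forall>j<chart_dim c. cmod (chart_map c y j - chart_map c x j) < \<delta>}"

lemma openin_chart_polydisc:
  assumes "chart_on X c"
  shows "openin X (chart_polydisc c x \<delta>)"
proof -
  have "openin (complex_space n) {w. (\<forall>i\<ge>n. w i = 0) \<and> (\<forall>j<n. cmod (w j - z j) < \<delta>)}" for n z
    unfolding openin_complex_space
  proof (intro conjI ballI)
    fix u assume u: "u \<in> {w. (\<forall>i\<ge>n. w i = 0) \<and> (\<forall>j<n. cmod (w j - z j) < \<delta>)}"
    define D where "D = Min (insert 1 ((\<lambda>j. \<delta> - cmod (u j - z j)) ` {..<n}))"
    have D: "D > 0" "\<And>i. i < n \<Longrightarrow> D \<le> \<delta> - cmod (u i - z i)"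
      unfolding D_def using u by (auto intro: Min_le)
    have "cmod (w j - z j) < \<delta>" if "cmod (w j - u j) < D" "j < n" for w j
      using that D(2)[of j] norm_triangle_ineq[of "w j - u j" "u j - z j"] by simp
    then show "\<exists>d>0. \<forall>w. (\<forall>i\<ge>n. w i = 0) \<longrightarrow> (\<forall>i<n. cmod (w i - u i) < d) \<longrightarrow>
        w \<in> {w. (\<forall>i\<ge>n. w i = 0) \<and> (\<forall>j<n. cmod (w j - z j) < \<delta>)}"
      using D(1) by blast
  qed auto
  from openin_continuous_map_preimage[OF chart_continuous[OF assms] this]
  have "openin (subtopology X (chart_dom c)) {y \<in> topspace (subtopology X (chart_dom c)).
     chart_map c y \<in> {w. (\<forall>i\<ge>chart_dim c. w i = 0) \<and> (\<forall>j<chart_dim c. cmod (w j - chart_map c x j) < \<delta>)}}" .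
  also have "{y \<in> topspace (subtopology X (chart_dom c)).
     chart_map c y \<in> {w. (\<forall>i\<ge>chart_dim c. w i = 0) \<and> (\<forall>j<chart_dim c. cmod (w j - chart_map c x j) < \<delta>)}}
    = chart_polydisc c x \<delta>"
    using chart_dom_subset[OF assms] chart_map_zero[OF assms] by (auto simp: chart_polydisc_def)
  finally show ?thesis
    using assms openin_trans_full unfolding chart_on_def by blast
qed

section \<open>Differentiability in charts: locality and the chain rule\<close>

lemma uniform_delta:
  fixes Q :: "nat \<Rightarrow> real \<Rightarrow> bool"
  assumes "\<And>i. i < n \<Longrightarrow> \<exists>d>0. Q i d" "\<And>i d d'. Q i d \<Longrightarrow> 0 < d' \<Longrightarrow> d' \<le> d \<Longrightarrow> Q i d'"
  shows "\<exists>d>0. \<forall>i<n. Q i d"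
  using assms(1)
proof (induction n)
  case 0
  show ?case by (auto intro: zero_less_one)
next
  case (Suc n)
  then obtain d d' where "d > 0" "\<forall>i<n. Q i d" "d' > 0" "Q n d'"
    by (metis less_Suc_eq)
  then have "min d d' > 0 \<and> (\<forall>i<Suc n. Q i (min d d'))"
    by (auto simp: less_Suc_eq intro: assms(2))
  then show ?case by blast
qed

text \<open>Differentiability sees only the coordinates of the points near \<open>x\<close>. So it
  passes to other charts and another map as soon as every nearby point of the new data has the
  coordinates of some point of the old data. Restricted, enlarged and transported charts are all
  instances.\<close>

lemma hol_at_transfer:
  assumes "hol_at c d f x" "chart_dim c' = chart_dim c" "chart_dim d' = chart_dim d" "\<eta> > 0"
    and "\<And>j. j < chart_dim c \<Longrightarrow> chart_map c' x' j = chart_map c x j"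
    and "\<And>i. i < chart_dim d \<Longrightarrow> chart_map d' (f' x') i = chart_map d (f x) i"
    and "\<And>y. y \<in> chart_dom c' \<Longrightarrow> f' y \<in> chart_dom d' \<Longrightarrow>
          (\<forall>j<chart_dim c. cmod (chart_map c' y j - chart_map c' x' j) < \<eta>) \<Longrightarrow>
          \<exists>z\<in>chart_dom c. f z \<in> chart_dom d \<and> (\<forall>j<chart_dim c. chart_map c' y j = chart_map c z j) \<and>
             (\<forall>i<chart_dim d. chart_map d' (f' y) i = chart_map d (f z) i)"
  shows "hol_at c' d' f' x'"
  unfolding hol_at_def
proof (intro allI impI)
  fix i assume i: "i < chart_dim d'"
  with assms(1,3) obtain a where a: "\<And>e. e > 0 \<Longrightarrow> \<exists>\<delta>>0. diff_bound c d f x i a e \<delta>"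
    unfolding hol_at_def by metis
  show "\<exists>a. \<forall>e>0. \<exists>\<delta>>0. diff_bound c' d' f' x' i a e \<delta>"
  proof (intro exI[of _ a] allI impI)
    fix e :: real assume "e > 0"
    from a[OF this] obtain \<delta> where \<delta>: "\<delta> > 0" "diff_bound c d f x i a e \<delta>" by blast
    show "\<exists>\<delta>>0. diff_bound c' d' f' x' i a e \<delta>"
      unfolding diff_bound_def
    proof (intro exI[of _ "min \<delta> \<eta>"] conjI ballI impI)
      fix y assume y: "y \<in> chart_dom c'" "f' y \<in> chart_dom d'"
        "\<forall>j<chart_dim c'. cmod (chart_map c' y j - chart_map c' x' j) < min \<delta> \<eta>"
      then obtain z where z: "z \<in> chart_dom c" "f z \<in> chart_dom d"
        "\<And>j. j < chart_dim c \<Longrightarrow> chart_map c' y j = chart_map c z j"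
        "\<And>i. i < chart_dim d \<Longrightarrow> chart_map d' (f' y) i = chart_map d (f z) i"
        using assms(2) assms(7)[of y] by auto
      have "\<forall>j<chart_dim c. cmod (chart_map c z j - chart_map c x j) < \<delta>"
        using y(3) z(3) assms(2,5) by auto
      with \<delta>(2) z(1,2)
      show "cmod (chart_map d' (f' y) i - chart_map d' (f' x') i
                - (\<Sum>j<chart_dim c'. a j * (chart_map c' y j - chart_map c' x' j)))
          \<le> e * (\<Sum>j<chart_dim c'. cmod (chart_map c' y j - chart_map c' x' j))"
        using i z(3,4) assms(2,3,5,6) by (simp add: diff_bound_def)
    qed (use \<delta>(1) assms(4) in auto)
  qed
qed

lemma hol_at_cong:
  assumes "\<And>y. y \<in> chart_dom c \<Longrightarrow> f y = g y" "x \<in> chart_dom c"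
  shows "hol_at c d f x \<longleftrightarrow> hol_at c d g x"
  using assms unfolding hol_at_def diff_bound_def by simp

text \<open>The error budget of the chain rule: \<open>e1\<close> and \<open>e2\<close> are the
  tolerances for the inner and the outer map, \<open>B\<close> and \<open>A\<close> bound their
  derivatives, and \<open>n\<close> is the dimension in the middle.\<close>

lemma sum_eps_bound:
  fixes e :: real
  assumes "e > 0"
  shows "\<exists>e1>0. \<exists>e2>0. e2 * (real n * (e1 + B)) + A * e1 \<le> e"
proof -
  define e1 where "e1 = min 1 (e / (2 * (1 + \<bar>A\<bar>)))"
  define e2 where "e2 = e / (2 * (1 + real n * (1 + \<bar>B\<bar>)))"
  have e1: "e1 > 0" "e1 \<le> 1" "e1 \<le> e / (2 * (1 + \<bar>A\<bar>))" using assms by (auto simp: e1_def)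
  have p: "1 + real n * (1 + \<bar>B\<bar>) > 0" by (simp add: add_pos_nonneg)
  have e2: "e2 > 0" using assms p by (auto simp: e2_def)
  have "A * e1 \<le> (1 + \<bar>A\<bar>) * e1" using e1 by (intro mult_right_mono) auto
  also have "\<dots> \<le> (1 + \<bar>A\<bar>) * (e / (2 * (1 + \<bar>A\<bar>)))" using e1(3) by (intro mult_left_mono) auto
  also have "\<dots> = e / 2" by (simp add: field_simps)
  finally have 1: "A * e1 \<le> e / 2" .
  have "real n * (e1 + B) \<le> 1 + real n * (1 + \<bar>B\<bar>)"
    using e1(2) mult_left_mono[of "e1 + B" "1 + \<bar>B\<bar>" "real n"] abs_ge_self[of B] by linarith
  then have "e2 * (real n * (e1 + B)) \<le> e2 * (1 + real n * (1 + \<bar>B\<bar>))" using e2 by (intro mult_left_mono) auto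
  also have "\<dots> = e / 2" using p by (simp add: e2_def field_simps)
  finally show ?thesis using 1 e1(1) e2 by (intro exI[of _ e1] exI[of _ e2]) auto
qed

text \<open>The chain rule. The error splits into \<open>e2\<close> times the increment of
  \<open>f\<close> and the outer derivative applied to the error \<open>e1\<close> of
  \<open>f\<close>. The assumption on \<eta> is there because \<open>hol_at\<close> tests only
  points whose image lies in the target chart, so it says nothing about \<open>y\<close> with
  \<open>f y\<close> outside \<open>chart_dom d\<close>.\<close>

lemma hol_at_comp:
  assumes f: "hol_at c d f x" and g: "hol_at d k g (f x)"
    and \<eta>: "\<eta> > 0" "\<And>y. y \<in> chart_dom c \<Longrightarrow>
          (\<forall>j<chart_dim c. cmod (chart_map c y j - chart_map c x j) < \<eta>) \<Longrightarrow> f y \<in> chart_dom d"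
  shows "hol_at c k (\<lambda>y. g (f y)) x"
  unfolding hol_at_def
proof (intro allI impI)
  fix l assume "l < chart_dim k"
  with g obtain a where a: "\<And>e. e > 0 \<Longrightarrow> \<exists>\<delta>>0. diff_bound d k g (f x) l a e \<delta>"
    unfolding hol_at_def by metis
  from f obtain b where b: "\<And>i e. i < chart_dim d \<Longrightarrow> e > 0 \<Longrightarrow> \<exists>\<delta>>0. diff_bound c d f x i (b i) e \<delta>"
    unfolding hol_at_def by metis
  define m where "m = chart_dim c"
  define n where "n = chart_dim d"
  define h where "h y j = chart_map c y j - chart_map c x j" for y j
  define \<Delta> where "\<Delta> y i = chart_map d (f y) i - chart_map d (f x) i" for y i
  define N where "N y = (\<Sum>j<m. cmod (h y j))" for y
  define B where "B = (\<Sum>i<n. \<Sum>j<m. cmod (b i j))"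
  define A where "A = (\<Sum>i<n. cmod (a i))"
  show "\<exists>a. \<forall>e>0. \<exists>\<delta>>0. diff_bound c k (\<lambda>y. g (f y)) x l a e \<delta>"
  proof (intro exI[of _ "\<lambda>j. \<Sum>i<n. a i * b i j"] allI impI)
    fix e :: real assume "e > 0"
    from sum_eps_bound[OF this] obtain e1 e2 where e12: "e1 > 0" "e2 > 0" "e2 * (real n * (e1 + B)) + A * e1 \<le> e"
      by blast
    from a[OF e12(2)] obtain \<delta>2 where \<delta>2: "\<delta>2 > 0" "\<And>y. y\<in>chart_dom c \<Longrightarrow> f y \<in> chart_dom d \<Longrightarrow> 
        g (f y) \<in> chart_dom k \<Longrightarrow> (\<forall>i<n. cmod (\<Delta> y i) < \<delta>2) \<Longrightarrow>
        cmod (chart_map k (g (f y)) l - chart_map k (g (f x)) l - (\<Sum>i<n. a i * \<Delta> y i))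
          \<le> e2 * (\<Sum>i<n. cmod (\<Delta> y i))"
      unfolding \<Delta>_def n_def diff_bound_def by blast
    have "\<exists>\<delta>>0. \<forall>i<n. (\<forall>y\<in>chart_dom c.
        f y \<in> chart_dom d \<longrightarrow> (\<forall>j<m. cmod (h y j) < \<delta>) \<longrightarrow>
        cmod (\<Delta> y i - (\<Sum>j<m. b i j * h y j)) \<le> e1 * N y)"
    proof (rule uniform_delta)
      fix i assume "i < n"
      with b[OF _ e12(1)] show "\<exists>\<delta>>0. \<forall>y\<in>chart_dom c.
        f y \<in> chart_dom d \<longrightarrow> (\<forall>j<m. cmod (h y j) < \<delta>) \<longrightarrow>
        cmod (\<Delta> y i - (\<Sum>j<m. b i j * h y j)) \<le> e1 * N y"
        by (simp add: n_def m_def h_def \<Delta>_def N_def diff_bound_def)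
    qed fastforce
    then obtain \<delta>1 where \<delta>1: "\<delta>1 > 0" "\<And>i y. i < n \<Longrightarrow> y \<in> chart_dom c \<Longrightarrow>
        f y \<in> chart_dom d \<Longrightarrow> (\<forall>j<m. cmod (h y j) < \<delta>1) \<Longrightarrow>
        cmod (\<Delta> y i - (\<Sum>j<m. b i j * h y j)) \<le> e1 * N y"
      by blast
    \<comment> \<open>Chosen so that coordinate increments below \<open>\<delta>2 / q\<close> force
      every \<open>\<Delta> y i\<close> below \<open>\<delta>2\<close>: each is at most
      \<open>(e1 + B) * N y\<close>, and \<open>N y\<close> is at most \<open>m\<close> times the
      increment bound. The final 1 makes the inequality strict.\<close>
    define q where "q = (real m + 1) * (e1 + B) + 1"
    have B0: "B \<ge> 0" unfolding B_def by (intro sum_nonneg) auto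
    have q: "q > 0" using e12(1) B0 by (auto simp: q_def intro: add_nonneg_pos)
    define \<delta> where "\<delta> = min \<eta> (min \<delta>1 (\<delta>2 / q))"
    have \<delta>: "\<delta> > 0" using \<eta>(1) \<delta>1(1) \<delta>2(1) q by (auto simp: \<delta>_def)
    show "\<exists>\<delta>>0. diff_bound c k (\<lambda>y. g (f y)) x l (\<lambda>j. \<Sum>i<n. a i * b i j) e \<delta>"
      unfolding diff_bound_def
    proof (intro exI[of _ \<delta>] conjI ballI impI \<delta>)
      fix y assume y: "y \<in> chart_dom c" "g (f y) \<in> chart_dom k"
        "\<forall>j<chart_dim c. cmod (chart_map c y j - chart_map c x j) < \<delta>"
      have hy: "cmod (h y j) < \<delta>" if "j < m" for j using y(3) that by (simp add: h_def m_def)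
      have fy: "f y \<in> chart_dom d" using y \<eta>(2)[of y] by (auto simp: \<delta>_def)
      have N0: "N y \<ge> 0" unfolding N_def by (intro sum_nonneg) auto
      have 1: "cmod (\<Delta> y i - (\<Sum>j<m. b i j * h y j)) \<le> e1 * N y" if "i < n" for i
        using that y fy hy by (intro \<delta>1(2)) (auto simp: \<delta>_def)
      have 2: "cmod (\<Delta> y i) \<le> (e1 + B) * N y" if "i < n" for i
      proof -
        have "cmod (\<Sum>j<m. b i j * h y j) \<le> (\<Sum>j<m. B * cmod (h y j))"
        proof (rule sum_norm_le)
          fix j assume j: "j \<in> {..<m}"
          have "cmod (b i j) \<le> (\<Sum>j<m. cmod (b i j))" using j by (intro member_le_sum) auto
          also have "\<dots> \<le> B" unfolding B_def using that
            by (intro member_le_sum[of i "{..<n}" "\<lambda>i. \<Sum>j<m. cmod (b i j)"]) (auto intro: sum_nonneg)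
          finally show "norm (b i j * h y j) \<le> B * cmod (h y j)"
            by (simp add: norm_mult mult_right_mono)
        qed
        also have "\<dots> = B * N y" by (simp add: N_def sum_distrib_left)
        finally show ?thesis
          using 1[OF that] norm_triangle_ineq[of "\<Delta> y i - (\<Sum>j<m. b i j * h y j)" "\<Sum>j<m. b i j * h y j"]
          by (simp add: algebra_simps)
      qed
      have "N y \<le> real m * \<delta>" unfolding N_def
        using sum_mono[of "{..<m}" "\<lambda>j. cmod (h y j)" "\<lambda>_. \<delta>"] hy by force
      also have "\<dots> \<le> (real m + 1) * \<delta>" using \<delta> by (simp add: algebra_simps)
      finally have "(e1 + B) * N y \<le> (e1 + B) * ((real m + 1) * \<delta>)" using e12(1) B0 by (intro mult_left_mono) auto
      also have "\<dots> = ((real m + 1) * (e1 + B)) * \<delta>" by (simp add: algebra_simps)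
      also have "\<dots> < q * \<delta>" using \<delta> by (simp add: q_def algebra_simps)
      also have "\<dots> \<le> q * (\<delta>2 / q)" using q by (intro mult_left_mono) (auto simp: \<delta>_def)
      also have "\<dots> = \<delta>2" using q by simp
      finally have "\<forall>i<n. cmod (\<Delta> y i) < \<delta>2" using 2 by force
      from \<delta>2(2)[OF y(1) fy y(2) this]
      have "cmod (chart_map k (g (f y)) l - chart_map k (g (f x)) l - (\<Sum>i<n. a i * \<Delta> y i))
          \<le> e2 * (\<Sum>i<n. cmod (\<Delta> y i))" .
      also have "\<dots> \<le> e2 * (real n * ((e1 + B) * N y))"
        using e12(2) sum_mono[of "{..<n}" "\<lambda>i. cmod (\<Delta> y i)" "\<lambda>_. (e1 + B) * N y"] 2
        by (intro mult_left_mono) auto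
      finally have 3: "cmod (chart_map k (g (f y)) l - chart_map k (g (f x)) l - (\<Sum>i<n. a i * \<Delta> y i))
          \<le> e2 * (real n * ((e1 + B) * N y))" .
      have eq: "(\<Sum>j<m. (\<Sum>i<n. a i * b i j) * h y j) = (\<Sum>i<n. a i * (\<Sum>j<m. b i j * h y j))"
        by (simp add: sum_distrib_left sum_distrib_right mult.assoc) (rule sum.swap)
      have "cmod ((\<Sum>i<n. a i * \<Delta> y i) - (\<Sum>j<m. (\<Sum>i<n. a i * b i j) * h y j))
          = cmod (\<Sum>i<n. a i * (\<Delta> y i - (\<Sum>j<m. b i j * h y j)))"
        unfolding eq by (simp add: sum_subtractf right_diff_distrib)
      also have "\<dots> \<le> (\<Sum>i<n. cmod (a i) * (e1 * N y))"
        by (intro sum_norm_le) (use 1 in \<open>auto simp: norm_mult intro!: mult_left_mono\<close>)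
      also have "\<dots> = A * (e1 * N y)" by (simp add: A_def sum_distrib_right)
      finally have 4: "cmod ((\<Sum>i<n. a i * \<Delta> y i) - (\<Sum>j<m. (\<Sum>i<n. a i * b i j) * h y j)) \<le> A * (e1 * N y)" .
      have "cmod (chart_map k (g (f y)) l - chart_map k (g (f x)) l
                - (\<Sum>j<m. (\<Sum>i<n. a i * b i j) * h y j))
          \<le> e2 * (real n * ((e1 + B) * N y)) + A * (e1 * N y)"
        using norm_triangle_mono[OF 3 4] by (simp only: diff_add_cancel add_diff_eq)
      also have "\<dots> = (e2 * (real n * (e1 + B)) + A * e1) * N y" by (simp add: algebra_simps)
      also have "\<dots> \<le> e * N y" using e12(3) N0 by (intro mult_right_mono)
      finally show "cmod (chart_map k (g (f y)) l - chart_map k (g (f x)) l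
                - (\<Sum>j<chart_dim c. (\<Sum>i<n. a i * b i j) * (chart_map c y j - chart_map c x j)))
          \<le> e * (\<Sum>j<chart_dim c. cmod (chart_map c y j - chart_map c x j))"
        by (simp add: N_def h_def m_def)
    qed
  qed
qed

section \<open>Holomorphic maps and manifolds\<close>

text \<open>Continuity of \<open>f\<close> supplies the neighbourhood that
  \<open>hol_at_comp\<close> asks for.\<close>

lemma hol_at_comp_chart:
  assumes "chart_on X c" "chart_on Y d" "continuous_map X Y f" "x \<in> chart_dom c" "f x \<in> chart_dom d"
    and "hol_at c d f x" "hol_at d k g (f x)"
  shows "hol_at c k (\<lambda>y. g (f y)) x"
proof -
  have 1: "openin X {y \<in> topspace X. f y \<in> chart_dom d}"
    using assms(2,3) unfolding chart_on_def continuous_map_def by blast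
  have 2: "x \<in> {y \<in> topspace X. f y \<in> chart_dom d}"
    using assms(4,5) chart_dom_subset[OF assms(1)] by auto
  obtain \<eta> where "\<eta> > 0" "\<And>y. y \<in> chart_dom c \<Longrightarrow>
      (\<forall>j<chart_dim c. cmod (chart_map c y j - chart_map c x j) < \<eta>) \<Longrightarrow> y \<in> {y \<in> topspace X. f y \<in> chart_dom d}"
    by (rule chart_nbhd[OF assms(1) 1 assms(4) 2]) blast
  then show ?thesis by (intro hol_at_comp[OF assms(6,7)]) auto
qed

lemma atlas_chart_on: "complex_manifold M \<Longrightarrow> c \<in> atlas M \<Longrightarrow> chart_on (mtop M) c"
  by (simp add: complex_manifold_def)

lemma manifold_chart_at:
  assumes "complex_manifold M" "x \<in> points M"
  obtains c where "c \<in> atlas M" "x \<in> chart_dom c"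
proof -
  have "x \<in> (\<Union>c\<in>atlas M. chart_dom c)" using assms unfolding complex_manifold_def by blast
  then show thesis using that by blast
qed

lemma holomorphic_chart_on: "holomorphic_chart M c \<Longrightarrow> chart_on (mtop M) c"
  by (simp add: holomorphic_chart_def)

lemma atlas_holomorphic_chart: "complex_manifold M \<Longrightarrow> c \<in> atlas M \<Longrightarrow> holomorphic_chart M c"
  by (simp add: holomorphic_chart_def complex_manifold_def)

lemma holomorphic_chart_change:
  assumes "complex_manifold M" "holomorphic_chart M c" "d \<in> atlas M" "x \<in> chart_dom c" "x \<in> chart_dom d"
  shows "hol_at c d (\<lambda>x. x) x" "hol_at d c (\<lambda>x. x) x"
proof -
  have i: "inj_on (chart_map c) (chart_dom c)" "inj_on (chart_map d) (chart_dom d)"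
    using assms atlas_chart_on holomorphic_chart_on chart_inj_on by blast+
  have "compatible_charts c d" using assms(2,3) by (simp add: holomorphic_chart_def)
  then show "hol_at c d (\<lambda>x. x) x" "hol_at d c (\<lambda>x. x) x"
    using assms(4,5) unfolding compatible_charts_def holomorphic_in_charts_iff[OF i(1)]
      holomorphic_in_charts_iff[OF i(2)] by auto
qed

lemma holomorphic_maps_iff:
  assumes "complex_manifold M"
  shows "f \<in> holomorphic_maps M N \<longleftrightarrow>
     f \<in> points M \<rightarrow>\<^sub>E points N \<and> continuous_map (mtop M) (mtop N) f \<and>
     (\<forall>c\<in>atlas M. \<forall>d\<in>atlas N. \<forall>x\<in>chart_dom c. f x \<in> chart_dom d \<longrightarrow> hol_at c d f x)"
  unfolding holomorphic_maps_def
  by (simp add: holomorphic_in_charts_iff[OF chart_inj_on[OF atlas_chart_on[OF assms]]])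

text \<open>The definition tests only charts of the two atlases, while the slice charts of a
  submanifold need not belong to an atlas. The chain rule leads from \<open>c\<close> through an
  atlas chart at \<open>x\<close> and one at \<open>f x\<close> to \<open>d\<close>.\<close>

lemma holomorphic_mapsD:
  assumes "complex_manifold M" "complex_manifold N" "f \<in> holomorphic_maps M N"
    and "holomorphic_chart M c" "holomorphic_chart N d" "x \<in> chart_dom c" "f x \<in> chart_dom d"
  shows "hol_at c d f x"
proof -
  have co: "chart_on (mtop M) c" "chart_on (mtop N) d" using assms holomorphic_chart_on by auto
  have x: "x \<in> points M" "f x \<in> points N" using assms(6,7) co chart_dom_subset by blast+
  obtain c' where c': "c' \<in> atlas M" "x \<in> chart_dom c'" using manifold_chart_at[OF assms(1) x(1)] .
  obtain d' where d': "d' \<in> atlas N" "f x \<in> chart_dom d'" using manifold_chart_at[OF assms(2) x(2)] .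
  note co' = atlas_chart_on[OF assms(1) c'(1)] atlas_chart_on[OF assms(2) d'(1)]
  have f: "continuous_map (mtop M) (mtop N) f" "hol_at c' d' f x"
    using assms(3) c' d' unfolding holomorphic_maps_iff[OF assms(1)] by auto
  have "hol_at c d' f x"
    by (rule hol_at_comp_chart[OF co(1) co'(1) continuous_map_id[unfolded id_def] assms(6) c'(2) _ f(2)])
       (rule holomorphic_chart_change[OF assms(1,4) c'(1) assms(6) c'(2)])
  then show ?thesis
    by (rule hol_at_comp_chart[OF co(1) co'(2) f(1) assms(6) d'(2)])
       (rule holomorphic_chart_change[OF assms(2,5) d'(1) assms(7) d'(2)])
qed

text \<open>One pair of charts at each point is enough, because the chain rule changes charts on
  both sides.\<close>

lemma holomorphic_mapsI:
  assumes "complex_manifold M" "complex_manifold N"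
    and f: "f \<in> points M \<rightarrow>\<^sub>E points N" "continuous_map (mtop M) (mtop N) f"
    and loc: "\<And>x. x \<in> points M \<Longrightarrow> \<exists>c d. holomorphic_chart M c \<and> holomorphic_chart N d \<and>
               x \<in> chart_dom c \<and> f x \<in> chart_dom d \<and> hol_at c d f x"
  shows "f \<in> holomorphic_maps M N"
  unfolding holomorphic_maps_iff[OF assms(1)]
proof (intro conjI f ballI impI)
  fix c' d' x assume c': "c' \<in> atlas M" "x \<in> chart_dom c'" and d': "d' \<in> atlas N" "f x \<in> chart_dom d'"
  note co' = atlas_chart_on[OF assms(1) c'(1)] atlas_chart_on[OF assms(2) d'(1)]
  have x: "x \<in> points M" using c'(2) co' chart_dom_subset by blast
  from loc[OF this] obtain c d where
    c: "holomorphic_chart M c" "x \<in> chart_dom c" and d: "holomorphic_chart N d" "f x \<in> chart_dom d" and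
    h: "hol_at c d f x" by blast
  have "hol_at c' d f x"
    by (rule hol_at_comp_chart[OF co'(1) holomorphic_chart_on[OF c(1)] continuous_map_id[unfolded id_def] c'(2) c(2) _ h])
       (rule holomorphic_chart_change[OF assms(1) c(1) c'(1) c(2) c'(2)])
  then show "hol_at c' d' f x"
    by (rule hol_at_comp_chart[OF co'(1) holomorphic_chart_on[OF d(1)] f(2) c'(2) d(2)])
       (rule holomorphic_chart_change[OF assms(2) d(1) d'(1) d(2) d'(2)])
qed

lemma holomorphic_maps_compose:
  assumes "complex_manifold M" "complex_manifold N" "complex_manifold P"
    and f: "f \<in> holomorphic_maps M N" and g: "g \<in> holomorphic_maps N P"
  shows "compose (points M) g f \<in> holomorphic_maps M P"
proof (rule holomorphic_mapsI[OF assms(1,3)])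
  have cf: "f \<in> points M \<rightarrow>\<^sub>E points N" "continuous_map (mtop M) (mtop N) f"
    and cg: "g \<in> points N \<rightarrow>\<^sub>E points P" "continuous_map (mtop N) (mtop P) g"
    using f g by (auto simp: holomorphic_maps_def)
  show "compose (points M) g f \<in> points M \<rightarrow>\<^sub>E points P"
    using cf cg by (auto simp: compose_def)
  have "continuous_map (mtop M) (mtop P) (g \<circ> f)" using cf cg continuous_map_compose by blast
  then show "continuous_map (mtop M) (mtop P) (compose (points M) g f)"
    by (rule continuous_map_eq) (auto simp: compose_def)
  fix x assume x: "x \<in> points M"
  then have fx: "f x \<in> points N" "g (f x) \<in> points P" using cf cg by auto
  obtain c where c: "c \<in> atlas M" "x \<in> chart_dom c" using manifold_chart_at[OF assms(1) x] .
  obtain d where d: "d \<in> atlas N" "f x \<in> chart_dom d" using manifold_chart_at[OF assms(2) fx(1)] .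
  obtain k where k: "k \<in> atlas P" "g (f x) \<in> chart_dom k" using manifold_chart_at[OF assms(3) fx(2)] .
  have "hol_at c d f x" "hol_at d k g (f x)"
    using f g c d k unfolding holomorphic_maps_iff[OF assms(1)] holomorphic_maps_iff[OF assms(2)] by auto
  then have "hol_at c k (\<lambda>y. g (f y)) x"
    using hol_at_comp_chart[OF atlas_chart_on[OF assms(1) c(1)] atlas_chart_on[OF assms(2) d(1)] cf(2) c(2) d(2)]
    by blast
  moreover have "compose (points M) g f y = g (f y)" if "y \<in> chart_dom c" for y
    using that chart_dom_subset[OF atlas_chart_on[OF assms(1) c(1)]] by (auto simp: compose_def)
  ultimately have "hol_at c k (compose (points M) g f) x" "compose (points M) g f x = g (f x)"
    using hol_at_cong[of c "compose (points M) g f"] c(2) by auto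
  then show "\<exists>c d. holomorphic_chart M c \<and> holomorphic_chart P d \<and> x \<in> chart_dom c \<and>
      compose (points M) g f x \<in> chart_dom d \<and> hol_at c d (compose (points M) g f) x"
    using c k atlas_holomorphic_chart assms by metis
qed

section \<open>Open submanifolds\<close>

definition restrict_chart :: "'a chart \<Rightarrow> 'a set \<Rightarrow> 'a chart" where
  "restrict_chart c U = \<lparr>chart_dim = chart_dim c, chart_dom = chart_dom c \<inter> U, chart_map = chart_map c\<rparr>"

lemma restrict_chart_simps [simp]:
  "chart_dim (restrict_chart c U) = chart_dim c"
  "chart_dom (restrict_chart c U) = chart_dom c \<inter> U"
  "chart_map (restrict_chart c U) = chart_map c"
  by (simp_all add: restrict_chart_def)

lemma chart_on_restrict:
  assumes "chart_on X c" "openin X U"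
  shows "chart_on (subtopology X U) (restrict_chart c U)"
  unfolding chart_on_def restrict_chart_simps
proof (intro conjI)
  show "openin (subtopology X U) (chart_dom c \<inter> U)"
    using assms unfolding chart_on_def by (auto simp: openin_subtopology)
  show "openin (complex_space (chart_dim c)) (chart_map c ` (chart_dom c \<inter> U))"
    using chart_open_image[OF assms] .
  have h: "homeomorphic_map (subtopology X (chart_dom c))
       (subtopology (complex_space (chart_dim c)) (chart_map c ` chart_dom c)) (chart_map c)"
    using assms(1) unfolding chart_on_def by blast
  have "homeomorphic_map (subtopology (subtopology X (chart_dom c)) U)
       (subtopology (subtopology (complex_space (chart_dim c)) (chart_map c ` chart_dom c))
          (chart_map c ` (chart_dom c \<inter> U))) (chart_map c)"
    by (rule homeomorphic_map_subtopologies[OF h])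
       (use assms chart_dom_subset[OF assms(1)] chart_map_zero[OF assms(1)] in \<open>auto simp: topspace_complex_space\<close>)
  moreover have "chart_map c ` chart_dom c \<inter> chart_map c ` (chart_dom c \<inter> U) = chart_map c ` (chart_dom c \<inter> U)"
    by auto
  ultimately show "homeomorphic_map (subtopology (subtopology X U) (chart_dom c \<inter> U))
     (subtopology (complex_space (chart_dim c)) (chart_map c ` (chart_dom c \<inter> U))) (chart_map c)"
    by (simp add: subtopology_subtopology Int_commute Int_left_commute)
qed

lemma hol_at_restrict:
  "hol_at c d f x \<Longrightarrow> hol_at (restrict_chart c U) (restrict_chart d V) f x"
  by (rule hol_at_transfer[where \<eta> = 1 and f = f and c = c and x = x]) auto

text \<open>A converse of \<open>hol_at_restrict\<close> at interior points: since \<open>U\<close>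
  is open, all chart points with coordinates close to those of \<open>x\<close> already lie in
  \<open>U\<close>, so testing there loses nothing.\<close>

lemma hol_at_unrestrict:
  assumes "hol_at (restrict_chart c U) d f x" "chart_on X c" "openin X U" "x \<in> chart_dom c" "x \<in> U"
  shows "hol_at c d f x"
proof -
  obtain \<eta> where "\<eta> > 0" "\<And>y. y \<in> chart_dom c \<Longrightarrow>
      (\<forall>j<chart_dim c. cmod (chart_map c y j - chart_map c x j) < \<eta>) \<Longrightarrow> y \<in> U"
    by (rule chart_nbhd[OF assms(2-5)]) blast
  then show ?thesis by (intro hol_at_transfer[OF assms(1)]) auto
qed

definition restrict_manifold :: "'a cmanifold \<Rightarrow> 'a set \<Rightarrow> 'a cmanifold" where
  "restrict_manifold M U = \<lparr>mtop = subtopology (mtop M) U, atlas = (\<lambda>c. restrict_chart c U) ` atlas M\<rparr>"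

lemma restrict_manifold_simps [simp]:
  "mtop (restrict_manifold M U) = subtopology (mtop M) U"
  "atlas (restrict_manifold M U) = (\<lambda>c. restrict_chart c U) ` atlas M"
  by (simp_all add: restrict_manifold_def)

text \<open>An equality of records, since the chart domains lie in \<open>points M\<close> anyway.
  It lets \<open>holomorphic_maps_inclusion\<close> also provide inclusions into \<open>M\<close>
  itself and the identity of \<open>M\<close>.\<close>

lemma restrict_manifold_points: "complex_manifold M \<Longrightarrow> restrict_manifold M (points M) = M"
proof -
  assume M: "complex_manifold M"
  have "restrict_chart c (points M) = c" if "c \<in> atlas M" for c
    using chart_dom_subset[OF atlas_chart_on[OF M that]] by (simp add: restrict_chart_def Int_absorb2)
  then show ?thesis by (simp add: restrict_manifold_def)
qed

lemma complex_manifold_restrict: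
  assumes M: "complex_manifold M" and U: "openin (mtop M) U"
  shows "complex_manifold (restrict_manifold M U)"
  unfolding complex_manifold_def restrict_manifold_simps
proof (intro conjI ballI)
  show "Hausdorff_space (subtopology (mtop M) U)" "second_countable (subtopology (mtop M) U)"
    using M by (auto simp: complex_manifold_def Hausdorff_space_subtopology second_countable_subtopology)
  show co: "chart_on (subtopology (mtop M) U) c" if "c \<in> (\<lambda>c. restrict_chart c U) ` atlas M" for c
    using that chart_on_restrict[OF atlas_chart_on[OF M] U] by auto
  show "(\<Union>c\<in>(\<lambda>c. restrict_chart c U) ` atlas M. chart_dom c) = topspace (subtopology (mtop M) U)"
    using M by (auto simp: complex_manifold_def)
  fix c d assume cd: "c \<in> (\<lambda>c. restrict_chart c U) ` atlas M" "d \<in> (\<lambda>c. restrict_chart c U) ` atlas M"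
  then obtain c' d' where c': "c = restrict_chart c' U" "c' \<in> atlas M" and d': "d = restrict_chart d' U" "d' \<in> atlas M"
    by auto
  show "compatible_charts c d"
    unfolding compatible_charts_def holomorphic_in_charts_iff[OF chart_inj_on[OF co[OF cd(1)]]]
      holomorphic_in_charts_iff[OF chart_inj_on[OF co[OF cd(2)]]]
    using holomorphic_chart_change[OF M atlas_holomorphic_chart[OF M c'(2)] d'(2)]
    by (auto simp: c'(1) d'(1) intro!: hol_at_restrict)
qed

lemma holomorphic_maps_inclusion:
  assumes M: "complex_manifold M" and U: "openin (mtop M) U" and V: "openin (mtop M) V" and "U \<subseteq> V"
  shows "(\<lambda>x\<in>U. x) \<in> holomorphic_maps (restrict_manifold M U) (restrict_manifold M V)"
  unfolding holomorphic_maps_iff[OF complex_manifold_restrict[OF M U]]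
proof (intro conjI ballI impI)
  have sub: "U \<subseteq> points M" "V \<subseteq> points M" using U V openin_subset by auto
  show "(\<lambda>x\<in>U. x) \<in> points (restrict_manifold M U) \<rightarrow>\<^sub>E points (restrict_manifold M V)"
    using sub assms(4) by (auto simp: PiE_iff extensional_def)
  have "continuous_map (subtopology (mtop M) U) (subtopology (mtop M) V) (\<lambda>x. x)"
    using assms(4) by (auto simp: continuous_map_in_subtopology continuous_map_from_subtopology)
  then show "continuous_map (mtop (restrict_manifold M U)) (mtop (restrict_manifold M V)) (\<lambda>x\<in>U. x)"
    unfolding restrict_manifold_simps by (rule continuous_map_eq) auto
  fix c d x assume c: "c \<in> atlas (restrict_manifold M U)" "x \<in> chart_dom c"
    and d: "d \<in> atlas (restrict_manifold M V)" "(\<lambda>x\<in>U. x) x \<in> chart_dom d"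
  then obtain c' d' where c': "c = restrict_chart c' U" "c' \<in> atlas M" and d': "d = restrict_chart d' V" "d' \<in> atlas M"
    by auto
  have "hol_at c d (\<lambda>x. x) x"
    unfolding c'(1) d'(1) using c d
    by (intro hol_at_restrict holomorphic_chart_change[OF M atlas_holomorphic_chart[OF M c'(2)] d'(2)])
       (auto simp: c' d')
  moreover have "hol_at c d (\<lambda>x\<in>U. x) x \<longleftrightarrow> hol_at c d (\<lambda>x. x) x"
    using c(2) by (intro hol_at_cong) (auto simp: c')
  ultimately show "hol_at c d (\<lambda>x\<in>U. x) x" by simp
qed

lemma holomorphic_maps_id:
  assumes "complex_manifold M"
  shows "(\<lambda>x\<in>points M. x) \<in> holomorphic_maps M M"
  using holomorphic_maps_inclusion[OF assms, of "points M" "points M"] by (simp add: restrict_manifold_points assms)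

section \<open>Transport of structure along an injection\<close>

definition transport_chart :: "('a \<Rightarrow> 'b) \<Rightarrow> ('b \<Rightarrow> 'a) \<Rightarrow> 'a chart \<Rightarrow> 'b chart" where
  "transport_chart e e' c =
     \<lparr>chart_dim = chart_dim c, chart_dom = e ` chart_dom c, chart_map = (\<lambda>y. chart_map c (e' y))\<rparr>"

lemma transport_chart_simps [simp]:
  "chart_dim (transport_chart e e' c) = chart_dim c"
  "chart_dom (transport_chart e e' c) = e ` chart_dom c"
  "chart_map (transport_chart e e' c) = (\<lambda>y. chart_map c (e' y))"
  by (simp_all add: transport_chart_def)

lemma chart_on_transport:
  assumes c: "chart_on X c" and h: "homeomorphic_maps X Y e e'"
  shows "chart_on Y (transport_chart e e' c)"
  unfolding chart_on_def transport_chart_simps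
proof (intro conjI)
  have inv: "e' (e x) = x" if "x \<in> chart_dom c" for x
    using that h chart_dom_subset[OF c] by (auto simp: homeomorphic_maps_def)
  have im: "(\<lambda>y. chart_map c (e' y)) ` e ` chart_dom c = chart_map c ` chart_dom c"
    by (auto simp: image_image inv)
  have he: "homeomorphic_map X Y e" "homeomorphic_map Y X e'"
    using h homeomorphic_maps_map by auto
  show "openin Y (e ` chart_dom c)"
    using c he(1) homeomorphic_imp_open_map unfolding chart_on_def open_map_def by blast
  then have sub: "e ` chart_dom c \<subseteq> topspace Y" using openin_subset by auto
  show "openin (complex_space (chart_dim c)) ((\<lambda>y. chart_map c (e' y)) ` e ` chart_dom c)"
    using c unfolding im chart_on_def by blast
  have 1: "homeomorphic_map (subtopology Y (e ` chart_dom c)) (subtopology X (chart_dom c)) e'"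
    by (rule homeomorphic_map_subtopologies[OF he(2)])
       (use sub chart_dom_subset[OF c] inv in \<open>force simp: image_iff\<close>)
  have 2: "homeomorphic_map (subtopology X (chart_dom c))
       (subtopology (complex_space (chart_dim c)) (chart_map c ` chart_dom c)) (chart_map c)"
    using c unfolding chart_on_def by blast
  show "homeomorphic_map (subtopology Y (e ` chart_dom c))
     (subtopology (complex_space (chart_dim c)) ((\<lambda>y. chart_map c (e' y)) ` e ` chart_dom c))
     (\<lambda>y. chart_map c (e' y))"
    unfolding im using homeomorphic_map_compose[OF 1 2] by (simp add: o_def)
qed

text \<open>The injection \<open>e\<close> is an arbitrary map of sets; topology and charts are
  defined through its inverse, so that \<open>e\<close> becomes biholomorphic by construction. Later
  \<open>e\<close> takes real values.\<close>

definition transport_manifold :: "('a \<Rightarrow> 'b) \<Rightarrow> 'a cmanifold \<Rightarrow> 'b cmanifold" where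
  "transport_manifold e M =
     \<lparr>mtop = pullback_topology (e ` points M) (inv_into (points M) e) (mtop M),
      atlas = transport_chart e (inv_into (points M) e) ` atlas M\<rparr>"

lemma transport_manifold:
  fixes e :: "'a \<Rightarrow> 'b"
  assumes M: "complex_manifold M" and e: "inj_on e (points M)"
  defines "e' \<equiv> inv_into (points M) e" and "N \<equiv> transport_manifold e M"
  shows "complex_manifold N" "restrict e (points M) \<in> holomorphic_maps M N"
    "restrict e' (points N) \<in> holomorphic_maps N M" "points N = e ` points M"
proof -
  have inv: "e' (e x) = x" if "x \<in> points M" for x using that e by (simp add: e'_def)
  have mN: "mtop N = pullback_topology (e ` points M) e' (mtop M)"
    and aN: "atlas N = transport_chart e e' ` atlas M"
    by (simp_all add: N_def transport_manifold_def e'_def)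
  show pN: "points N = e ` points M" by (auto simp: mN topspace_pullback_topology inv)
  have "continuous_map (mtop N) (mtop M) (id \<circ> e')"
    unfolding mN by (rule continuous_map_pullback[OF continuous_map_id])
  then have ce': "continuous_map (mtop N) (mtop M) e'" by simp
  have ce: "continuous_map (mtop M) (mtop N) e"
    unfolding mN
  proof (rule continuous_map_pullback')
    show "continuous_map (mtop M) (mtop M) (e' \<circ> e)"
      by (rule continuous_map_eq[OF continuous_map_id]) (simp add: inv)
  qed auto
  have h: "homeomorphic_maps (mtop M) (mtop N) e e'"
    using ce ce' by (auto simp: homeomorphic_maps_def pN inv)
  have hs: "mtop M homeomorphic_space mtop N" using h homeomorphic_space_def by blast
  have dom: "chart_dom c \<subseteq> points M" if "c \<in> atlas M" for c
    using chart_dom_subset[OF atlas_chart_on[OF M that]] .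
  have co: "chart_on (mtop N) (transport_chart e e' c)" if "c \<in> atlas M" for c
    using chart_on_transport[OF atlas_chart_on[OF M that] h] .
  \<comment> \<open>In coordinates both \<open>e\<close> and \<open>e'\<close> are the identity, so
    all three claims are changes of charts of \<open>M\<close> read through
    \<open>hol_at_transfer\<close>.\<close>
  have hol: "hol_at (transport_chart e e' c) (transport_chart e e' d) (\<lambda>x. x) x"
    "hol_at c' (transport_chart e e' d) e (e' x)"
    "hol_at (transport_chart e e' c) c' e' x"
    if cx: "c \<in> atlas M" "d \<in> atlas M" "c' \<in> atlas M" "x \<in> e ` chart_dom c" "x \<in> e ` chart_dom d" "e' x \<in> chart_dom c'"
    for c d c' x
  proof -
    obtain y where y: "y \<in> chart_dom c" "y \<in> chart_dom d" "x = e y" "y \<in> points M"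
      using cx(4,5) dom[OF cx(1)] dom[OF cx(2)] e by (auto dest: inj_onD)
    have h0: "hol_at c d (\<lambda>x. x) y"
      by (rule holomorphic_chart_change[OF M atlas_holomorphic_chart[OF M cx(1)] cx(2) y(1,2)])
    have pre: "e' z \<in> chart_dom d" if "z \<in> e ` chart_dom d" "d \<in> atlas M" for z d
      using that inv dom[OF that(2)] by auto
    have yc': "y \<in> chart_dom c'" using cx(6) y inv by simp
    show "hol_at (transport_chart e e' c) (transport_chart e e' d) (\<lambda>x. x) x"
    proof (rule hol_at_transfer[OF h0, where \<eta> = 1])
      fix z assume "z \<in> chart_dom (transport_chart e e' c)" "z \<in> chart_dom (transport_chart e e' d)"
      then have "e' z \<in> chart_dom c" "e' z \<in> chart_dom d" using pre cx(1,2) by auto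
      then show "\<exists>w\<in>chart_dom c. w \<in> chart_dom d \<and>
          (\<forall>j<chart_dim c. chart_map (transport_chart e e' c) z j = chart_map c w j) \<and>
          (\<forall>i<chart_dim d. chart_map (transport_chart e e' d) z i = chart_map d w i)"
        by auto
    qed (use y inv in auto)
    have h1: "hol_at c' d (\<lambda>x. x) y"
      by (rule holomorphic_chart_change[OF M atlas_holomorphic_chart[OF M cx(3)] cx(2) yc' y(2)])
    show "hol_at c' (transport_chart e e' d) e (e' x)"
    proof (rule hol_at_transfer[OF h1, where \<eta> = 1])
      fix z assume z: "z \<in> chart_dom c'" "e z \<in> chart_dom (transport_chart e e' d)"
      then have "e' (e z) \<in> chart_dom d" "e' (e z) = z" using pre cx(2) inv dom[OF cx(3)] by auto
      then show "\<exists>w\<in>chart_dom c'. w \<in> chart_dom d \<and>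
          (\<forall>j<chart_dim c'. chart_map c' z j = chart_map c' w j) \<and>
          (\<forall>i<chart_dim d. chart_map (transport_chart e e' d) (e z) i = chart_map d w i)"
        using z(1) by auto
    qed (use y inv in auto)
    have h2: "hol_at c c' (\<lambda>x. x) y"
      by (rule holomorphic_chart_change[OF M atlas_holomorphic_chart[OF M cx(1)] cx(3) y(1) yc'])
    show "hol_at (transport_chart e e' c) c' e' x"
    proof (rule hol_at_transfer[OF h2, where \<eta> = 1])
      fix z assume z: "z \<in> chart_dom (transport_chart e e' c)" "e' z \<in> chart_dom c'"
      then have "e' z \<in> chart_dom c" using pre cx(1) by auto
      then show "\<exists>w\<in>chart_dom c. w \<in> chart_dom c' \<and>
          (\<forall>j<chart_dim c. chart_map (transport_chart e e' c) z j = chart_map c w j) \<and>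
          (\<forall>i<chart_dim c'. chart_map c' (e' z) i = chart_map c' w i)"
        using z(2) by auto
    qed (use y inv in auto)
  qed
  show N: "complex_manifold N"
    unfolding complex_manifold_def
  proof (intro conjI ballI)
    show "Hausdorff_space (mtop N)" "second_countable (mtop N)"
      using hs M homeomorphic_Hausdorff_space homeomorphic_space_second_countability
      by (auto simp: complex_manifold_def)
    show "\<And>c. c \<in> atlas N \<Longrightarrow> chart_on (mtop N) c" using co by (auto simp: aN)
    show "(\<Union>c\<in>atlas N. chart_dom c) = points N"
    proof -
      have "(\<Union>c\<in>atlas N. chart_dom c) = e ` (\<Union>c\<in>atlas M. chart_dom c)" by (auto simp: aN)
      also have "(\<Union>c\<in>atlas M. chart_dom c) = points M" using M unfolding complex_manifold_def by blast
      finally show ?thesis by (simp add: pN)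
    qed
    fix c d assume "c \<in> atlas N" "d \<in> atlas N"
    then obtain c' d' where c: "c = transport_chart e e' c'" "c' \<in> atlas M"
      and d: "d = transport_chart e e' d'" "d' \<in> atlas M" by (auto simp: aN)
    have i: "inj_on (chart_map c) (chart_dom c)" "inj_on (chart_map d) (chart_dom d)"
      using co c d chart_inj_on by blast+
    have "e' x \<in> chart_dom c'" if "x \<in> e ` chart_dom c'" for x
      using that inv dom[OF c(2)] by auto
    then show "compatible_charts c d"
      unfolding compatible_charts_def holomorphic_in_charts_iff[OF i(1)] holomorphic_in_charts_iff[OF i(2)]
      using hol(1) c d by (metis transport_chart_simps(2))
  qed
  show "restrict e (points M) \<in> holomorphic_maps M N"
    unfolding holomorphic_maps_iff[OF M]
  proof (intro conjI ballI impI)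
    show "restrict e (points M) \<in> points M \<rightarrow>\<^sub>E points N" by (auto simp: pN)
    show "continuous_map (mtop M) (mtop N) (restrict e (points M))"
      by (rule continuous_map_eq[OF ce]) auto
    fix c d x assume c: "c \<in> atlas M" "x \<in> chart_dom c" and "d \<in> atlas N" "restrict e (points M) x \<in> chart_dom d"
    then obtain d' where d: "d = transport_chart e e' d'" "d' \<in> atlas M" "e x \<in> e ` chart_dom d'"
      using dom[OF c(1)] by (auto simp: aN)
    have xc: "e' (e x) = x" using inv c dom[OF c(1)] by auto
    have "hol_at c d e x" using hol(2)[of c d' c "e x"] d c xc by simp
    then show "hol_at c d (restrict e (points M)) x"
      using dom[OF c(1)] c(2) hol_at_cong[of c "restrict e (points M)" e] by (auto simp: subset_iff)
  qed
  show "restrict e' (points N) \<in> holomorphic_maps N M"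
    unfolding holomorphic_maps_iff[OF N]
  proof (intro conjI ballI impI)
    show "restrict e' (points N) \<in> points N \<rightarrow>\<^sub>E points M" by (auto simp: pN inv)
    show "continuous_map (mtop N) (mtop M) (restrict e' (points N))"
      by (rule continuous_map_eq[OF ce']) auto
    fix c d x assume c0: "c \<in> atlas N" "x \<in> chart_dom c" and d: "d \<in> atlas M" "restrict e' (points N) x \<in> chart_dom d"
    then obtain c' where c: "c = transport_chart e e' c'" "c' \<in> atlas M" "x \<in> e ` chart_dom c'"
      by (auto simp: aN)
    have sub: "chart_dom c \<subseteq> points N" using chart_dom_subset[OF atlas_chart_on[OF N c0(1)]] .
    have "hol_at c d e' x" using hol(3)[of c' c' d x] d c c0 sub by auto
    then show "hol_at c d (restrict e' (points N)) x"
      using sub c0(2) hol_at_cong[of c "restrict e' (points N)" e'] by (auto simp: subset_iff)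
  qed
qed

section \<open>Stein manifolds\<close>

text \<open>Makes an open part of the plane a chart, padded by zeros as
  \<open>complex_space 1\<close> requires. Holomorphic functions thus fall under the calculus of
  \<open>hol_at\<close> as maps into \<open>plane_chart UNIV\<close>, and complex lines in a
  manifold as maps out of \<open>plane_chart A\<close>.\<close>

definition plane_chart :: "complex set \<Rightarrow> complex chart" where
  "plane_chart A = \<lparr>chart_dim = 1, chart_dom = A, chart_map = (\<lambda>w i. if i = 0 then w else 0)\<rparr>"

lemma plane_chart_simps [simp]:
  "chart_dim (plane_chart A) = 1" "chart_dom (plane_chart A) = A" "chart_map (plane_chart A) w 0 = w"
  by (simp_all add: plane_chart_def)

lemma holomorphic_functions_iff:
  assumes "complex_manifold M"
  shows "f \<in> holomorphic_functions M \<longleftrightarrow>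
           (\<forall>c\<in>atlas M. \<forall>x\<in>chart_dom c. hol_at c (plane_chart UNIV) f x)"
proof -
  have "holomorphic_in (chart_dim c) (chart_map c ` chart_dom c) (\<lambda>z. f (chart_inv c z)) \<longleftrightarrow>
        holomorphic_in_charts c (plane_chart UNIV) f" for c
    by (simp add: holomorphic_in_charts_def)
  then show ?thesis
    by (simp add: holomorphic_functions_def holomorphic_in_charts_iff[OF chart_inj_on[OF atlas_chart_on[OF assms]]])
qed

lemma hol_at_bound:
  assumes "hol_at c d f x" "e > 0" "i < chart_dim d"
  obtains \<delta> where "\<delta> > 0"
    "\<And>y. y \<in> chart_dom c \<Longrightarrow> f y \<in> chart_dom d \<Longrightarrow>
       (\<forall>j<chart_dim c. cmod (chart_map c y j - chart_map c x j) < \<delta>) \<Longrightarrow>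
       cmod (chart_map d (f y) i - chart_map d (f x) i) < e"
proof -
  define n where "n = chart_dim c"
  from assms(1,3) obtain a where "\<And>e. e > 0 \<Longrightarrow> \<exists>\<delta>>0. diff_bound c d f x i a e \<delta>"
    unfolding hol_at_def by metis
  from this[of 1] obtain \<delta> where \<delta>: "\<delta> > 0" "diff_bound c d f x i a 1 \<delta>" by auto
  define A where "A = (\<Sum>j<n. cmod (a j))"
  have A: "A \<ge> 0" unfolding A_def by (intro sum_nonneg) auto
  \<comment> \<open>Strictly larger than \<open>real n + A\<close>: with increments of at most
    \<open>e / q\<close>, the linear part contributes at most \<open>A * (e / q)\<close> and the
    error term, taken with tolerance 1, at most \<open>n * (e / q)\<close>.\<close>
  define q where "q = (A + 1) * (real n + 1)"
  have q: "q > 0" using A by (auto simp: q_def)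
  show thesis
  proof (rule that[of "min \<delta> (e / q)"])
    show "0 < min \<delta> (e / q)" using \<delta> q assms(2) by auto
    fix y assume y: "y \<in> chart_dom c" "f y \<in> chart_dom d"
      "\<forall>j<chart_dim c. cmod (chart_map c y j - chart_map c x j) < min \<delta> (e / q)"
    define h where "h j = chart_map c y j - chart_map c x j" for j
    have h: "cmod (h j) \<le> e / q" if "j < n" for j using y(3) that by (auto simp: h_def n_def less_imp_le)
    have 1: "cmod (chart_map d (f y) i - chart_map d (f x) i - (\<Sum>j<n. a j * h j)) \<le> (\<Sum>j<n. cmod (h j))"
      using \<delta>(2) y unfolding diff_bound_def h_def n_def by auto
    have 2: "(\<Sum>j<n. cmod (h j)) \<le> real n * (e / q)"
      using sum_mono[of "{..<n}" "\<lambda>j. cmod (h j)" "\<lambda>_. e / q"] h by simp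
    have "cmod (\<Sum>j<n. a j * h j) \<le> (\<Sum>j<n. cmod (a j) * (e / q))"
      using h by (intro sum_norm_le) (simp add: norm_mult mult_left_mono del: times_divide_eq_right)
    also have "\<dots> = A * (e / q)" unfolding A_def by (simp only: sum_distrib_right)
    finally have "cmod (chart_map d (f y) i - chart_map d (f x) i) \<le> real n * (e / q) + A * (e / q)"
      using 1 2 norm_triangle_ineq2[of "chart_map d (f y) i - chart_map d (f x) i" "\<Sum>j<n. a j * h j"] by linarith
    also have "\<dots> = (real n + A) * (e / q)" by (simp add: algebra_simps)
    also have "\<dots> < q * (e / q)"
    proof (rule mult_strict_right_mono)
      have "q = A * real n + A + real n + 1" by (simp add: q_def algebra_simps)
      then show "real n + A < q" using mult_nonneg_nonneg[OF A, of "real n"] by simp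
    qed (use q assms(2) in auto)
    also have "\<dots> = e" using q by simp
    finally show "cmod (chart_map d (f y) i - chart_map d (f x) i) < e" .
  qed
qed

text \<open>Continuity is not part of the definition of \<open>holomorphic_functions\<close>; it
  follows from differentiability in every chart.\<close>

lemma holomorphic_function_continuous:
  assumes M: "complex_manifold M" and f: "f \<in> holomorphic_functions M"
  shows "continuous_map (mtop M) euclidean f"
  unfolding continuous_map_def
proof (intro conjI allI impI)
  fix U :: "complex set" assume "openin euclidean U"
  then have U: "open U" by simp
  show "openin (mtop M) {x \<in> points M. f x \<in> U}"
  proof (subst openin_subopen, intro ballI)
    fix x assume x: "x \<in> {x \<in> points M. f x \<in> U}"
    obtain c where c: "c \<in> atlas M" "x \<in> chart_dom c" using manifold_chart_at[OF M] x by blast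
    note co = atlas_chart_on[OF M c(1)]
    obtain e where e: "e > 0" "ball (f x) e \<subseteq> U" using U x open_contains_ball by blast
    have h: "hol_at c (plane_chart UNIV) f x" using f c unfolding holomorphic_functions_iff[OF M] by blast
    obtain \<delta> where \<delta>: "\<delta> > 0" "\<And>y. y \<in> chart_dom c \<Longrightarrow>
       (\<forall>j<chart_dim c. cmod (chart_map c y j - chart_map c x j) < \<delta>) \<Longrightarrow> cmod (f y - f x) < e"
      by (rule hol_at_bound[OF h e(1), of 0]) auto
    have "x \<in> chart_polydisc c x \<delta>" using c \<delta>(1) by (simp add: chart_polydisc_def)
    moreover have "chart_polydisc c x \<delta> \<subseteq> {x \<in> points M. f x \<in> U}"
    proof
      fix y assume y: "y \<in> chart_polydisc c x \<delta>"
      then have "y \<in> points M" using chart_dom_subset[OF co] by (auto simp: chart_polydisc_def)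
      moreover have "cmod (f y - f x) < e" using y \<delta>(2) by (auto simp: chart_polydisc_def)
      then have "f y \<in> ball (f x) e" by (simp add: dist_norm norm_minus_commute)
      ultimately show "y \<in> {x \<in> points M. f x \<in> U}" using e(2) by auto
    qed
    ultimately show "\<exists>T. openin (mtop M) T \<and> x \<in> T \<and> T \<subseteq> {x \<in> points M. f x \<in> U}"
      using openin_chart_polydisc[OF co] by blast
  qed
qed auto

text \<open>The derivative is 0. Such functions separate points in different open and closed parts
  of a manifold and keep a hull inside the parts that the compact set meets.\<close>

lemma locally_constant_holomorphic:
  assumes M: "complex_manifold M" and "\<And>i. openin (mtop M) {x \<in> points M. k x = i}"
  shows "(\<lambda>x. h (k x)) \<in> holomorphic_functions M"
  unfolding holomorphic_functions_iff[OF M]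
proof (intro ballI)
  fix c x assume c: "c \<in> atlas M" "x \<in> chart_dom c"
  note co = atlas_chart_on[OF M c(1)]
  have "x \<in> {y \<in> points M. k y = k x}" using c chart_dom_subset[OF co] by auto
  then obtain \<delta> where \<delta>: "\<delta> > 0" "\<And>y. y \<in> chart_dom c \<Longrightarrow>
      (\<forall>j<chart_dim c. cmod (chart_map c y j - chart_map c x j) < \<delta>) \<Longrightarrow> k y = k x"
    by (rule chart_nbhd[OF co assms(2) c(2)]) blast
  have "diff_bound c (plane_chart UNIV) (\<lambda>x. h (k x)) x 0 (\<lambda>_. 0) e \<delta>" if "e > 0" for e
    unfolding diff_bound_def using \<delta>(2) that by (simp add: sum_nonneg)
  then show "hol_at c (plane_chart UNIV) (\<lambda>x. h (k x)) x"
    unfolding hol_at_def using \<delta>(1) by auto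
qed

lemma constant_holomorphic: "complex_manifold M \<Longrightarrow> (\<lambda>_. a) \<in> holomorphic_functions M"
  by (rule locally_constant_holomorphic[where k = "\<lambda>_. ()" and h = "\<lambda>_. a"]) auto

text \<open>An intersection of preimages of closed discs, over a family that is nonempty because of
  the constants. To prove a hull compact it is therefore enough to enclose it in a compact
  set.\<close>

lemma closedin_holomorphic_hull:
  assumes M: "complex_manifold M"
  shows "closedin (mtop M) (holomorphic_hull M K)"
proof -
  have "holomorphic_hull M K =
    (\<Inter>f\<in>holomorphic_functions M. {p \<in> points M. f p \<in> cball 0 (SUP q\<in>K. cmod (f q))})"
    using constant_holomorphic[OF M] by (auto simp: holomorphic_hull_def)
  moreover have "closedin (mtop M) {p \<in> points M. f p \<in> cball 0 r}" if "f \<in> holomorphic_functions M" for f r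
    using closedin_continuous_map_preimage[OF holomorphic_function_continuous[OF M that], of "cball 0 r"] by simp
  ultimately show ?thesis using constant_holomorphic[OF M] by (auto intro!: closedin_INT)
qed

lemma compact_holomorphic_bdd:
  assumes M: "complex_manifold M" and f: "f \<in> holomorphic_functions M" and K: "compactin (mtop M) K"
  shows "compact (f ` K)" "bdd_above ((\<lambda>q. cmod (f q)) ` K)"
proof -
  show c: "compact (f ` K)"
    using image_compactin[OF K holomorphic_function_continuous[OF M f]] by simp
  then obtain B where "\<forall>y\<in>f ` K. cmod y \<le> B" using compact_imp_bounded bounded_iff by metis
  then show "bdd_above ((\<lambda>q. cmod (f q)) ` K)" by (auto intro!: bdd_aboveI2)
qed

lemma stein_if_local_retracts:
  fixes X :: "'a cmanifold" and S :: "'i \<Rightarrow> 'b cmanifold"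
  assumes X: "complex_manifold X"
    and op: "\<And>i. openin (mtop X) {x \<in> points X. rnk x = i}"
    and st: "\<And>x. x \<in> points X \<Longrightarrow> stein (S (rnk x))"
    and cF: "\<And>x. x \<in> points X \<Longrightarrow>
              continuous_map (subtopology (mtop X) {y \<in> points X. rnk y = rnk x}) (mtop (S (rnk x))) F"
    and cr: "\<And>x. x \<in> points X \<Longrightarrow> continuous_map (mtop (S (rnk x))) (mtop X) (r (rnk x))"
    and rF: "\<And>x. x \<in> points X \<Longrightarrow> r (rnk x) (F x) = x"
    and hol: "\<And>x g. x \<in> points X \<Longrightarrow> g \<in> holomorphic_functions (S (rnk x)) \<Longrightarrow>
               (\<lambda>y. if rnk y = rnk x then g (F y) else 0) \<in> holomorphic_functions X"
  shows "stein X"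
  unfolding stein_def
proof (intro conjI X)
  define Y where "Y i = {x \<in> points X. rnk x = i}" for i
  have FY: "F x \<in> points (S (rnk x))" if "x \<in> points X" for x
    using cF[OF that] that by (auto simp: continuous_map_def)
  show "holomorphically_separable X"
    unfolding holomorphically_separable_def
  proof (intro ballI impI)
    fix p q assume pq: "p \<in> points X" "q \<in> points X" "p \<noteq> q"
    show "\<exists>f\<in>holomorphic_functions X. f p \<noteq> f q"
    proof (cases "rnk p = rnk q")
      case True
      then have "F p \<noteq> F q" using rF pq by metis
      then obtain g where g: "g \<in> holomorphic_functions (S (rnk p))" "g (F p) \<noteq> g (F q)"
        using st[OF pq(1)] FY pq True unfolding stein_def holomorphically_separable_def by metis
      show ?thesis using hol[OF pq(1) g(1)] g(2) True by (intro bexI) auto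
    next
      case False
      have "(\<lambda>x. if rnk x = rnk p then 0 else 1) \<in> holomorphic_functions X"
        using locally_constant_holomorphic[OF X op, where h = "\<lambda>i. if i = rnk p then 0 else 1"] .
      then show ?thesis using False by (intro bexI) auto
    qed
  qed
  show "holomorphically_convex X"
    unfolding holomorphically_convex_def
  proof (intro allI impI, elim conjE)
    fix K assume K: "compactin (mtop X) K" "K \<noteq> {}"
    have KX: "K \<subseteq> points X" using K(1) compactin_subset_topspace by blast
    have "\<exists>\<F>. finite \<F> \<and> \<F> \<subseteq> range Y \<and> K \<subseteq> \<Union>\<F>"
      using K(1) op KX unfolding compactin_def Y_def by (elim conjE allE[of _ "range Y"]) (auto simp: Y_def)
    then obtain J where J: "finite J" "K \<subseteq> (\<Union>i\<in>J. Y i)"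
      by (metis finite_subset_image)
    have "rnk ` K \<subseteq> J" using J(2) by (auto simp: Y_def)
    then have fin: "finite (rnk ` K)" using J(1) finite_subset by blast
    have clY: "closedin (mtop X) (Y i)" for i
    proof -
      have "points X - Y i = (\<Union>j\<in>-{i}. Y j)" by (auto simp: Y_def)
      moreover have "openin (mtop X) (\<Union>j\<in>-{i}. Y j)" using op by (auto simp: Y_def)
      ultimately show ?thesis by (auto simp: closedin_def Y_def)
    qed
    define Q where "Q i = r i ` holomorphic_hull (S i) (F ` (K \<inter> Y i))" for i
    have FK: "compactin (mtop (S i)) (F ` (K \<inter> Y i))" if "i \<in> rnk ` K" for i
    proof -
      obtain x where x: "x \<in> K" "i = rnk x" using \<open>i \<in> rnk ` K\<close> by auto
      have "compactin (mtop X) (K \<inter> Y i)" using closed_Int_compactin[OF clY K(1)] by (simp add: Int_commute)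
      then have "compactin (subtopology (mtop X) (Y i)) (K \<inter> Y i)" by (simp add: compactin_subtopology)
      then show ?thesis using image_compactin cF[of x] x KX unfolding Y_def by blast
    qed
    have cQ: "compactin (mtop X) (Q i)" if "i \<in> rnk ` K" for i
    proof -
      obtain x where x: "x \<in> K" "i = rnk x" using \<open>i \<in> rnk ` K\<close> by auto
      have "F ` (K \<inter> Y i) \<noteq> {}" using x KX by (auto simp: Y_def)
      then have "compactin (mtop (S i)) (holomorphic_hull (S i) (F ` (K \<inter> Y i)))"
        using st[of x] x KX FK[OF that] unfolding stein_def holomorphically_convex_def by blast
      then show ?thesis unfolding Q_def using image_compactin cr[of x] x KX by blast
    qed
    have "holomorphic_hull X K \<subseteq> (\<Union>i\<in>rnk ` K. Q i)"
    proof
      fix p assume p: "p \<in> holomorphic_hull X K"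
      then have pX: "p \<in> points X" by (simp add: holomorphic_hull_def)
      have pl: "cmod (f p) \<le> (SUP q\<in>K. cmod (f q))" if "f \<in> holomorphic_functions X" for f
        using p that by (auto simp: holomorphic_hull_def)
      \<comment> \<open>The function that is 1 exactly on the parts missed by \<open>K\<close>
        vanishes on \<open>K\<close>, hence also on its hull.\<close>
      have rk: "rnk p \<in> rnk ` K"
      proof (rule ccontr)
        assume np: "rnk p \<notin> rnk ` K"
        have "(\<lambda>x. if rnk x \<in> rnk ` K then 0 else 1) \<in> holomorphic_functions X"
          using locally_constant_holomorphic[OF X op, where h = "\<lambda>i. if i \<in> rnk ` K then 0 else 1"] .
        from pl[OF this] have "1 \<le> (SUP q\<in>K. cmod (if rnk q \<in> rnk ` K then 0 else 1))" using np by simp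
        also have "\<dots> \<le> 0" using K(2) by (intro cSUP_least) auto
        finally show False by simp
      qed
      have S: "complex_manifold (S (rnk p))" using st[OF pX] by (simp add: stein_def)
      have "F p \<in> holomorphic_hull (S (rnk p)) (F ` (K \<inter> Y (rnk p)))"
        unfolding holomorphic_hull_def
      proof (intro CollectI conjI ballI FY pX)
        fix g assume g: "g \<in> holomorphic_functions (S (rnk p))"
        let ?s = "SUP q\<in>F ` (K \<inter> Y (rnk p)). cmod (g q)"
        note bdd = compact_holomorphic_bdd(2)[OF S g FK[OF rk]]
        \<comment> \<open>The point \<open>q0\<close> shows that the supremum is nonnegative; this
          is what bounds the extended function at points of \<open>K\<close> in other parts, where
          its value is 0.\<close>
        obtain q0 where q0: "q0 \<in> K \<inter> Y (rnk p)" using rk KX by (force simp: Y_def)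
        have "0 \<le> cmod (g (F q0))" by simp
        also have "\<dots> \<le> ?s" using q0 bdd by (intro cSUP_upper) auto
        finally have s0: "0 \<le> ?s" .
        have "cmod (g (F p)) \<le> (SUP q\<in>K. cmod (if rnk q = rnk p then g (F q) else 0))"
          using pl[OF hol[OF pX g]] by simp
        also have "\<dots> \<le> ?s"
        proof (rule cSUP_least[OF K(2)])
          fix q assume q: "q \<in> K"
          show "cmod (if rnk q = rnk p then g (F q) else 0) \<le> ?s"
            using q KX s0 bdd by (auto simp: Y_def intro!: cSUP_upper)
        qed
        finally show "cmod (g (F p)) \<le> ?s" .
      qed
      then show "p \<in> (\<Union>i\<in>rnk ` K. Q i)" using rk rF[OF pX] unfolding Q_def by (intro UN_I[OF rk]) force
    qed
    moreover have "compactin (mtop X) (\<Union>i\<in>rnk ` K. Q i)"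
      using fin cQ by (intro compactin_Union) auto
    ultimately show "compactin (mtop X) (holomorphic_hull X K)"
      using closed_compactin closedin_holomorphic_hull[OF X] by blast
  qed
qed

lemma holomorphic_function_compose:
  assumes M: "complex_manifold M" and N: "complex_manifold N"
    and f: "f \<in> holomorphic_maps M N" and g: "g \<in> holomorphic_functions N"
  shows "(\<lambda>x. g (f x)) \<in> holomorphic_functions M"
  unfolding holomorphic_functions_iff[OF M]
proof (intro ballI)
  fix c x assume c: "c \<in> atlas M" "x \<in> chart_dom c"
  have cf: "continuous_map (mtop M) (mtop N) f" using f by (simp add: holomorphic_maps_def)
  have "f x \<in> points N" using cf c chart_dom_subset[OF atlas_chart_on[OF M c(1)]]
    by (auto simp: continuous_map_def)
  then obtain d where d: "d \<in> atlas N" "f x \<in> chart_dom d" using manifold_chart_at[OF N] by blast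
  have "hol_at c d f x" "hol_at d (plane_chart UNIV) g (f x)"
    using f g c d unfolding holomorphic_functions_iff[OF N] holomorphic_maps_iff[OF M] by blast+
  then show "hol_at c (plane_chart UNIV) (\<lambda>x. g (f x)) x"
    by (rule hol_at_comp_chart[OF atlas_chart_on[OF M c(1)] atlas_chart_on[OF N d(1)] cf c(2) d(2)])
qed

text \<open>The case of a single part. It serves to pass between a manifold and its copy with real
  points, in both directions.\<close>

lemma stein_retract:
  assumes X: "complex_manifold X" and S: "stein S"
    and i: "i \<in> holomorphic_maps X S" and r: "r \<in> holomorphic_maps S X"
    and ri: "\<And>x. x \<in> points X \<Longrightarrow> r (i x) = x"
  shows "stein X"
proof (rule stein_if_local_retracts[OF X, where rnk = "\<lambda>_. ()" and S = "\<lambda>_. S" and F = i and r = "\<lambda>_. r"])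
  have "complex_manifold S" using S by (simp add: stein_def)
  then show "(\<lambda>y. if () = () then g (i y) else 0) \<in> holomorphic_functions X"
    if "g \<in> holomorphic_functions S" for g
    using holomorphic_function_compose[OF X _ i that] by simp
qed (use S i r ri in \<open>auto simp: holomorphic_maps_def\<close>)

text \<open>Says that the polydisc of radius \<delta> about the coordinates of \<open>x\<close> lies
  entirely in the image of the chart, so that \<open>chart_polydisc c x \<delta>\<close> is a
  genuine polydisc.\<close>

definition full_polydisc :: "'a chart \<Rightarrow> 'a \<Rightarrow> real \<Rightarrow> bool" where
  "full_polydisc c x \<delta> \<longleftrightarrow> x \<in> chart_dom c \<and> \<delta> > 0 \<and>
     (\<forall>w. (\<forall>i\<ge>chart_dim c. w i = 0) \<longrightarrow> (\<forall>j<chart_dim c. cmod (w j - chart_map c x j) < \<delta>) \<longrightarrow>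
        (\<exists>y\<in>chart_dom c. chart_map c y = w))"

lemma full_polydisc_within:
  assumes "chart_on X c" "openin X V" "x \<in> chart_dom c" "x \<in> V"
  obtains \<delta> where "full_polydisc c x \<delta>" "chart_polydisc c x \<delta> \<subseteq> V" "x \<in> chart_polydisc c x \<delta>"
proof (rule chart_nbhd[OF assms])
  fix \<delta> assume \<delta>: "0 < \<delta>"
    "\<And>y. y \<in> chart_dom c \<Longrightarrow> (\<forall>j<chart_dim c. cmod (chart_map c y j - chart_map c x j) < \<delta>) \<Longrightarrow> y \<in> V"
    "\<And>w. \<forall>i\<ge>chart_dim c. w i = 0 \<Longrightarrow> \<forall>j<chart_dim c. cmod (w j - chart_map c x j) < \<delta> \<Longrightarrow>
        \<exists>y\<in>chart_dom c \<inter> V. chart_map c y = w"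
  show thesis
  proof (rule that[of \<delta>])
    show "full_polydisc c x \<delta>"
      unfolding full_polydisc_def using \<delta>(1) assms(3) \<delta>(3) by blast
  qed (use \<delta>(1,2) assms(3) in \<open>auto simp: chart_polydisc_def\<close>)
qed

text \<open>Tychonoff: a product of closed discs, with the factor \<open>{0}\<close> in each
  coordinate from \<open>n\<close> on.\<close>

lemma compact_closed_polydisc: "compactin (complex_space n) {w. (\<forall>i\<ge>n. w i = 0) \<and> (\<forall>j<n. cmod (w j - z j) \<le> r)}"
proof -
  have "{w. (\<forall>i\<ge>n. w i = 0) \<and> (\<forall>j<n. cmod (w j - z j) \<le> r)} =
      Pi\<^sub>E UNIV (\<lambda>i. if i < n then cball (z i) r else {0})" (is "?A = ?B")
  proof (intro equalityI subsetI)
    fix w assume "w \<in> ?A"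
    then show "w \<in> ?B" by (simp add: PiE_iff dist_norm norm_minus_commute)
  next
    fix w assume "w \<in> ?B"
    then have w: "w i \<in> (if i < n then cball (z i) r else {0})" for i by (auto simp: PiE_iff)
    have "w i = 0" if "i \<ge> n" for i using w[of i] that by auto
    moreover have "cmod (w i - z i) \<le> r" if "i < n" for i
      using w[of i] that by (simp add: dist_norm norm_minus_commute)
    ultimately show "w \<in> ?A" by blast
  qed
  moreover have "compactin (product_topology (\<lambda>_. euclidean) UNIV) ?B"
    by (simp add: compactin_PiE)
  ultimately show ?thesis unfolding complex_space_def by (auto simp: compactin_subtopology)
qed

text \<open>Since \<open>s < \<delta>\<close>, the closed polydisc of radius \<open>s\<close> is
  filled by chart points, so it is compact in coordinates and the chart, a homeomorphism, carries
  this back.\<close>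

lemma compactin_closed_chart_polydisc:
  assumes co: "chart_on X c" and full: "full_polydisc c x \<delta>" and "s < \<delta>"
  shows "compactin X {y \<in> chart_dom c. \<forall>j<chart_dim c. cmod (chart_map c y j - chart_map c x j) \<le> s}"
    (is "compactin X ?Q")
proof -
  have im: "chart_map c ` ?Q = {w. (\<forall>i\<ge>chart_dim c. w i = 0) \<and> (\<forall>j<chart_dim c. cmod (w j - chart_map c x j) \<le> s)}"
    (is "_ = ?R")
  proof
    show "chart_map c ` ?Q \<subseteq> ?R" using chart_map_zero[OF co] by auto
    show "?R \<subseteq> chart_map c ` ?Q"
    proof
      fix w assume w: "w \<in> ?R"
      then have "\<forall>i\<ge>chart_dim c. w i = 0" "\<forall>j<chart_dim c. cmod (w j - chart_map c x j) < \<delta>"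
        using assms(3) by (auto intro: le_less_trans)
      then obtain y where "y \<in> chart_dom c" "chart_map c y = w"
        using full unfolding full_polydisc_def by blast
      then show "w \<in> chart_map c ` ?Q" using w by auto
    qed
  qed
  have "compactin (complex_space (chart_dim c)) (chart_map c ` ?Q)" unfolding im by (rule compact_closed_polydisc)
  then have "compactin (subtopology (complex_space (chart_dim c)) (chart_map c ` chart_dom c)) (chart_map c ` ?Q)"
    by (auto simp: compactin_subtopology)
  moreover have "homeomorphic_map (subtopology X (chart_dom c))
     (subtopology (complex_space (chart_dim c)) (chart_map c ` chart_dom c)) (chart_map c)"
    using co by (simp add: chart_on_def)
  moreover have "?Q \<subseteq> topspace (subtopology X (chart_dom c))"
    using chart_dom_subset[OF co] by auto
  ultimately have "compactin (subtopology X (chart_dom c)) ?Q"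
    using homeomorphic_map_compactness by blast
  then show ?thesis by (simp add: compactin_subtopology)
qed

text \<open>Needed for the continuity of composition in the compact-open topology.\<close>

lemma locally_compact_manifold:
  assumes M: "complex_manifold M"
  shows "locally_compact_space (mtop M)"
  unfolding locally_compact_space_def
proof
  fix x assume x: "x \<in> points M"
  obtain c where c: "c \<in> atlas M" "x \<in> chart_dom c" using manifold_chart_at[OF M x] .
  note co = atlas_chart_on[OF M c(1)]
  obtain \<delta> where \<delta>: "full_polydisc c x \<delta>" using full_polydisc_within[OF co openin_topspace c(2) x] by blast
  then have "\<delta> > 0" by (simp add: full_polydisc_def)
  have "compactin (mtop M) {y \<in> chart_dom c. \<forall>j<chart_dim c. cmod (chart_map c y j - chart_map c x j) \<le> \<delta> / 2}"
    using \<open>\<delta> > 0\<close> by (intro compactin_closed_chart_polydisc[OF co \<delta>]) auto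
  moreover have "x \<in> chart_polydisc c x (\<delta> / 2)" using c(2) \<open>\<delta> > 0\<close> by (simp add: chart_polydisc_def)
  moreover have "chart_polydisc c x (\<delta> / 2) \<subseteq>
      {y \<in> chart_dom c. \<forall>j<chart_dim c. cmod (chart_map c y j - chart_map c x j) \<le> \<delta> / 2}"
    by (auto simp: chart_polydisc_def)
  ultimately show "\<exists>U K. openin (mtop M) U \<and> compactin (mtop M) K \<and> x \<in> U \<and> U \<subseteq> K"
    using openin_chart_polydisc[OF co] by blast
qed

text \<open>The coordinates are holomorphic functions. They separate points, and measured from the
  centre they show that the hull of a compact \<open>K\<close> stays in a closed polydisc of smaller
  radius.\<close>

lemma stein_polydisc:
  assumes M: "complex_manifold M" and c: "c \<in> atlas M" and full: "full_polydisc c x \<delta>"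
  shows "stein (restrict_manifold M (chart_polydisc c x \<delta>))"
proof -
  define B where "B = chart_polydisc c x \<delta>"
  define n where "n = chart_dim c"
  note co = atlas_chart_on[OF M c]
  have B: "openin (mtop M) B" unfolding B_def by (rule openin_chart_polydisc[OF co])
  have Bc: "B \<subseteq> chart_dom c" by (auto simp: B_def chart_polydisc_def)
  have BM: "points M \<inter> B = B" using B openin_subset by blast
  define N where "N = restrict_manifold M B"
  have N: "complex_manifold N" unfolding N_def by (rule complex_manifold_restrict[OF M B])
  have pN: "points N = B" by (simp add: N_def BM)
  have coord: "(\<lambda>y. chart_map c y j - a) \<in> holomorphic_functions N" if jn: "j < n" for j a
    unfolding holomorphic_functions_iff[OF N]
  proof (intro ballI)
    fix d y assume d: "d \<in> atlas N" "y \<in> chart_dom d"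
    then obtain d' where d': "d' \<in> atlas M" "d = restrict_chart d' B" by (auto simp: N_def)
    have "hol_at d' c (\<lambda>x. x) y"
      using d d' Bc by (intro holomorphic_chart_change[OF M atlas_holomorphic_chart[OF M d'(1)] c]) auto
    then obtain b where b: "\<And>e. e > 0 \<Longrightarrow> \<exists>\<delta>>0. diff_bound d' c (\<lambda>x. x) y j b e \<delta>"
      using jn unfolding hol_at_def n_def by metis
    have "diff_bound d (plane_chart UNIV) (\<lambda>y. chart_map c y j - a) y 0 b e \<eta>"
      if "diff_bound d' c (\<lambda>x. x) y j b e \<eta>" for e \<eta>
      using that Bc by (auto simp: diff_bound_def d'(2) subset_iff)
    then have "\<forall>e>0. \<exists>\<delta>>0. diff_bound d (plane_chart UNIV) (\<lambda>y. chart_map c y j - a) y 0 b e \<delta>"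
      using b by meson
    then show "hol_at d (plane_chart UNIV) (\<lambda>y. chart_map c y j - a) y"
      unfolding hol_at_def by auto
  qed
  have "stein N"
    unfolding stein_def
  proof (intro conjI N)
    show "holomorphically_separable N"
      unfolding holomorphically_separable_def pN
    proof (intro ballI impI)
      fix p q assume pq: "p \<in> B" "q \<in> B" "p \<noteq> q"
      then have "chart_map c p \<noteq> chart_map c q" using Bc chart_inj_on[OF co] by (auto dest: inj_onD)
      then obtain j where j: "chart_map c p j \<noteq> chart_map c q j" by auto
      then have "j < n" using pq Bc chart_map_zero[OF co] unfolding n_def by (metis not_le subsetD)
      from coord[OF this, of 0] show "\<exists>f\<in>holomorphic_functions N. f p \<noteq> f q"
        using j by (intro bexI) auto
    qed
    show "holomorphically_convex N"
      unfolding holomorphically_convex_def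
    proof (intro allI impI, elim conjE)
      fix K assume K: "compactin (mtop N) K" "K \<noteq> {}"
      have KB: "K \<subseteq> B" using K(1) compactin_subset_topspace pN by blast
      have "\<exists>r<\<delta>. \<forall>y\<in>K. cmod (chart_map c y j - chart_map c x j) \<le> r" if j: "j < n" for j
      proof -
        let ?f = "\<lambda>y. chart_map c y j - chart_map c x j"
        have "compact (cmod ` ?f ` K)"
          using compact_holomorphic_bdd(1)[OF N coord[OF j] K(1)]
          by (intro compact_continuous_image continuous_on_norm_id)
        then obtain s where s: "s \<in> cmod ` ?f ` K" "\<And>t. t \<in> cmod ` ?f ` K \<Longrightarrow> t \<le> s"
          using compact_attains_sup[of "cmod ` ?f ` K"] K(2) by auto
        have "s < \<delta>" using s(1) KB j by (auto simp: B_def chart_polydisc_def n_def)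
        then show ?thesis using s(2) by blast
      qed
      then obtain r where r: "\<And>j. j < n \<Longrightarrow> r j < \<delta>"
        "\<And>j y. j < n \<Longrightarrow> y \<in> K \<Longrightarrow> cmod (chart_map c y j - chart_map c x j) \<le> r j" by metis
      \<comment> \<open>Inserting 0 covers dimension 0 and is harmless because
        \<open>0 < \<delta>\<close>.\<close>
      define s where "s = Max (insert 0 (r ` {..<n}))"
      have s: "s < \<delta>" "\<And>j. j < n \<Longrightarrow> r j \<le> s" unfolding s_def using r(1) full
        by (auto simp: full_polydisc_def intro: Max_ge)
      define Q where "Q = {y \<in> chart_dom c. \<forall>j<n. cmod (chart_map c y j - chart_map c x j) \<le> s}"
      have QB: "Q \<subseteq> B" using s(1) by (auto simp: Q_def B_def chart_polydisc_def n_def)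
      have "compactin (mtop M) Q" unfolding Q_def n_def by (rule compactin_closed_chart_polydisc[OF co full s(1)])
      then have "compactin (mtop N) Q" using QB by (simp add: compactin_subtopology N_def)
      moreover have "holomorphic_hull N K \<subseteq> Q"
      proof
        fix p assume p: "p \<in> holomorphic_hull N K"
        then have "p \<in> B" by (simp add: holomorphic_hull_def pN)
        moreover have "cmod (chart_map c p j - chart_map c x j) \<le> s" if j: "j < n" for j
        proof -
          have "\<forall>f\<in>holomorphic_functions N. cmod (f p) \<le> (SUP q\<in>K. cmod (f q))"
            using p by (simp add: holomorphic_hull_def)
          from bspec[OF this coord[OF j]]
          have "cmod (chart_map c p j - chart_map c x j) \<le> (SUP q\<in>K. cmod (chart_map c q j - chart_map c x j))" .
          also have "\<dots> \<le> s"
          proof (rule cSUP_least[OF K(2)])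
            fix q assume "q \<in> K"
            then show "cmod (chart_map c q j - chart_map c x j) \<le> s" using r(2)[OF j] s(2)[OF j] by fastforce
          qed
          finally show ?thesis .
        qed
        ultimately show "p \<in> Q" using Bc by (auto simp: Q_def)
      qed
      ultimately show "compactin (mtop N) (holomorphic_hull N K)"
        using closed_compactin closedin_holomorphic_hull[OF N] by blast
    qed
  qed
  then show ?thesis by (simp add: N_def B_def)
qed

section \<open>The identity theorem\<close>

text \<open>Turns \<open>hol_at\<close> along a complex line into an ordinary complex derivative, so
  that the one-variable theorem on analytic continuation applies. The image must stay in the chart
  \<open>d\<close>, since other points are not tested.\<close>

lemma hol_at_plane_differentiable:
  assumes "hol_at (plane_chart A) d g s" "i < chart_dim d" "open A" "s \<in> A" "\<And>t. t \<in> A \<Longrightarrow> g t \<in> chart_dom d"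
  shows "(\<lambda>t. chart_map d (g t) i) field_differentiable at s"
proof -
  from assms(1,2) obtain a where a: "\<And>e. e > 0 \<Longrightarrow> \<exists>\<delta>>0. diff_bound (plane_chart A) d g s i a e \<delta>"
    unfolding hol_at_def by metis
  obtain \<epsilon> where \<epsilon>: "\<epsilon> > 0" "ball s \<epsilon> \<subseteq> A" using assms(3,4) open_contains_ball by blast
  have "((\<lambda>t. chart_map d (g t) i) has_field_derivative a 0) (at s)"
    unfolding has_field_derivative_def has_derivative_at_alt
  proof (intro conjI allI impI)
    show "bounded_linear ((*) (a 0))" by (rule bounded_linear_mult_right)
    fix e :: real assume "e > 0"
    then obtain \<delta> where \<delta>: "\<delta> > 0" "diff_bound (plane_chart A) d g s i a e \<delta>" using a by blast
    show "\<exists>\<delta>>0. \<forall>t. cmod (t - s) < \<delta> \<longrightarrow>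
        cmod (chart_map d (g t) i - chart_map d (g s) i - a 0 * (t - s)) \<le> e * cmod (t - s)"
    proof (intro exI[of _ "min \<delta> \<epsilon>"] conjI allI impI)
      fix t assume t: "cmod (t - s) < min \<delta> \<epsilon>"
      then have "t \<in> ball s \<epsilon>" by (simp add: dist_norm norm_minus_commute)
      then have "t \<in> A" using \<epsilon>(2) by blast
      then show "cmod (chart_map d (g t) i - chart_map d (g s) i - a 0 * (t - s)) \<le> e * cmod (t - s)"
        using \<delta>(2) t assms(5) by (auto simp: diff_bound_def)
    qed (use \<delta> \<epsilon> in auto)
  qed
  then show ?thesis unfolding field_differentiable_def by blast
qed

text \<open>Reduced to one variable by restricting to the complex line through \<open>x0\<close> and \<open>y\<close>.\<close>

lemma polydisc_identity:
  fixes M :: "'a cmanifold" and S T :: "'b cmanifold"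
  assumes M: "complex_manifold M" and c: "c \<in> atlas M" and full: "full_polydisc c x \<delta>"
    and TS: "closed_submanifold T S"
    and f: "f \<in> holomorphic_maps (restrict_manifold M (chart_polydisc c x \<delta>)) S"
    and U: "openin (mtop M) U" "x0 \<in> U" "U \<subseteq> chart_polydisc c x \<delta>" "f ` U \<subseteq> points T"
    and y: "y \<in> chart_polydisc c x \<delta>"
  shows "f y \<in> points T"
proof -
  define B where "B = chart_polydisc c x \<delta>"
  define n where "n = chart_dim c"
  define N where "N = restrict_manifold M B"
  define cB where "cB = restrict_chart c B"
  note co = atlas_chart_on[OF M c]
  have S: "complex_manifold S" using TS by (simp add: closed_submanifold_def)
  have B: "openin (mtop M) B" unfolding B_def by (rule openin_chart_polydisc[OF co])
  have Bc: "B \<subseteq> chart_dom c" by (auto simp: B_def chart_polydisc_def)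
  have N: "complex_manifold N" unfolding N_def by (rule complex_manifold_restrict[OF M B])
  have cBN: "cB \<in> atlas N" using c by (auto simp: N_def cB_def)
  have f': "f \<in> holomorphic_maps N S" using f by (simp add: N_def B_def)
  then have cf: "continuous_map (subtopology (mtop M) B) (mtop S) f" by (simp add: holomorphic_maps_def N_def)
  define u where "u = chart_map c x0"
  define v where "v = chart_map c y"
  have xyB: "x0 \<in> B" "y \<in> B" using U y by (auto simp: B_def)
  then have xyc: "x0 \<in> chart_dom c" "y \<in> chart_dom c" using Bc by auto
  define l where "l t i = u i + t * (v i - u i)" for t i
  \<comment> \<open>The parameters at which the line is inside the polydisc. As the preimage of a
    polydisc under an affine map, \<open>W\<close> is open and convex, hence connected.\<close>
  define W where "W = {t. \<forall>j<n. cmod (l t j - chart_map c x j) < \<delta>}"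
  have "W = (\<Inter>j\<in>{..<n}. (\<lambda>t. l t j) -` ball (chart_map c x j) \<delta>)"
    by (auto simp: W_def dist_norm norm_minus_commute)
  moreover have "open ((\<lambda>t. l t j) -` ball (chart_map c x j) \<delta>)" for j
    unfolding l_def by (intro open_vimage open_ball continuous_intros)
  ultimately have oW: "open W" by (auto intro: open_INT)
  have "convex W"
    unfolding convex_def
  proof (intro ballI allI impI)
    fix s t :: complex and a b :: real
    assume st: "s \<in> W" "t \<in> W" and ab: "0 \<le> a" "0 \<le> b" "a + b = 1"
    have "cmod (l (a *\<^sub>R s + b *\<^sub>R t) j - chart_map c x j) < \<delta>" if "j < n" for j
    proof -
      have b: "b = 1 - a" using ab by simp
      have "l (a *\<^sub>R s + b *\<^sub>R t) j - chart_map c x j =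
          a *\<^sub>R (l s j - chart_map c x j) + b *\<^sub>R (l t j - chart_map c x j)"
        unfolding b by (simp add: l_def scaleR_conv_of_real algebra_simps)
      then have "cmod (l (a *\<^sub>R s + b *\<^sub>R t) j - chart_map c x j) \<le>
          a * cmod (l s j - chart_map c x j) + b * cmod (l t j - chart_map c x j)"
        using norm_triangle_ineq[of "a *\<^sub>R (l s j - chart_map c x j)" "b *\<^sub>R (l t j - chart_map c x j)"] ab
        by (simp only: norm_scaleR abs_of_nonneg)
      also have "\<dots> < \<delta>" using st that ab by (intro convex_bound_lt) (auto simp: W_def)
      finally show ?thesis .
    qed
    then show "a *\<^sub>R s + b *\<^sub>R t \<in> W" by (simp add: W_def)
  qed
  then have conW: "connected W" by (rule convex_connected)
  \<comment> \<open>The line lifted to the manifold; fullness of the polydisc ensures that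
    \<open>l t\<close> is the coordinate vector of a point for every \<open>t\<close> in
    \<open>W\<close>.\<close>
  define L where "L t = inv_into (chart_dom c) (chart_map c) (l t)" for t
  have L: "L t \<in> chart_dom c" "chart_map c (L t) = l t" "L t \<in> B" if "t \<in> W" for t
  proof -
    have "\<forall>i\<ge>chart_dim c. l t i = 0"
      using chart_map_zero[OF co] xyc by (simp add: l_def u_def v_def)
    moreover have "\<forall>j<chart_dim c. cmod (l t j - chart_map c x j) < \<delta>" using that by (simp add: W_def n_def)
    ultimately have "\<exists>z\<in>chart_dom c. chart_map c z = l t" using full by (simp add: full_polydisc_def)
    then have "l t \<in> chart_map c ` chart_dom c" by (metis imageI)
    then show 1: "L t \<in> chart_dom c" "chart_map c (L t) = l t"
      unfolding L_def by (auto intro: inv_into_into f_inv_into_f)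
    then show "L t \<in> B" using that by (simp add: B_def chart_polydisc_def W_def n_def)
  qed
  have W01: "0 \<in> W" "1 \<in> W" using xyB by (auto simp: W_def B_def chart_polydisc_def l_def u_def v_def n_def)
  have "l 0 = u" "l 1 = v" by (auto simp: l_def)
  then have L01: "L 0 = x0" "L 1 = y"
    using xyc chart_inj_on[OF co] by (simp_all add: L_def u_def v_def inv_into_f_f)
  have Lnbhd: "\<exists>\<epsilon>>0. \<forall>s\<in>ball t \<epsilon>. s \<in> W \<and> L s \<in> V" if t: "t \<in> W" "openin (mtop M) V" "L t \<in> V" for t V
  proof -
    obtain \<eta> where \<eta>: "\<eta> > 0" "\<And>z. z \<in> chart_dom c \<Longrightarrow>
       (\<forall>j<chart_dim c. cmod (chart_map c z j - chart_map c (L t) j) < \<eta>) \<Longrightarrow> z \<in> V"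
      by (rule chart_nbhd[OF co t(2) L(1)[OF t(1)] t(3)]) blast
    obtain \<epsilon> where \<epsilon>: "\<epsilon> > 0" "ball t \<epsilon> \<subseteq> W" using oW t(1) open_contains_ball by blast
    \<comment> \<open>A bound on the speed of the line in each coordinate; the leading 1 keeps it
      positive even for a constant line.\<close>
    define q where "q = 1 + (\<Sum>j<n. cmod (v j - u j))"
    have q: "q > 0" unfolding q_def by (intro add_pos_nonneg sum_nonneg) auto
    have qj: "cmod (v j - u j) \<le> q" if "j < n" for j
      using member_le_sum[of j "{..<n}" "\<lambda>j. cmod (v j - u j)"] that by (simp add: q_def)
    have "s \<in> W \<and> L s \<in> V" if s: "s \<in> ball t (min \<epsilon> (\<eta> / q))" for s
    proof -
      have sW: "s \<in> W" using s \<epsilon>(2) by auto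
      have "cmod (chart_map c (L s) j - chart_map c (L t) j) < \<eta>" if "j < n" for j
      proof -
        have "chart_map c (L s) j - chart_map c (L t) j = (s - t) * (v j - u j)"
          using L(2)[OF sW] L(2)[OF t(1)] by (simp add: l_def algebra_simps)
        then have "cmod (chart_map c (L s) j - chart_map c (L t) j) \<le> cmod (s - t) * q"
          using qj[OF that] by (simp add: norm_mult mult_left_mono)
        also have "\<dots> < \<eta>" using s q by (simp add: dist_norm norm_minus_commute pos_less_divide_eq)
        finally show ?thesis .
      qed
      then show ?thesis using \<eta>(2) L(1)[OF sW] sW by (simp add: n_def)
    qed
    then show ?thesis using \<epsilon>(1) \<eta>(1) q by (intro exI[of _ "min \<epsilon> (\<eta> / q)"]) auto
  qed
  define G where "G t = f (L t)" for t
  have Gnbhd: "\<exists>\<epsilon>>0. \<forall>s\<in>ball t \<epsilon>. s \<in> W \<and> G s \<in> V" if "t \<in> W" "openin (mtop S) V" "G t \<in> V" for t V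
  proof -
    have "openin (subtopology (mtop M) B) {z \<in> topspace (subtopology (mtop M) B). f z \<in> V}"
      using cf that(2) unfolding continuous_map_def by blast
    then have "openin (mtop M) {z \<in> topspace (subtopology (mtop M) B). f z \<in> V}"
      using B openin_trans_full by blast
    moreover have "L t \<in> {z \<in> topspace (subtopology (mtop M) B). f z \<in> V}"
      using that L[OF that(1)] openin_subset[OF B] by (auto simp: G_def)
    ultimately show ?thesis using Lnbhd[OF that(1)] by (fastforce simp: G_def)
  qed
  have Lhol: "hol_at (plane_chart A) cB L t" if "t \<in> A" "A \<subseteq> W" for t A
    unfolding hol_at_def
  proof (intro allI impI)
    fix i assume "i < chart_dim cB"
    have "diff_bound (plane_chart A) cB L t i (\<lambda>_. v i - u i) e 1" if "e > 0" for e
      unfolding diff_bound_def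
      using L(2) \<open>t \<in> A\<close> \<open>A \<subseteq> W\<close> \<open>e > 0\<close> by (auto simp: cB_def l_def algebra_simps subset_iff)
    then show "\<exists>a. \<forall>e>0. \<exists>\<delta>>0. diff_bound (plane_chart A) cB L t i a e \<delta>"
      by (intro exI[of _ "\<lambda>_. v i - u i"] allI impI exI[of _ 1]) auto
  qed
  \<comment> \<open>The interior of the set of parameters that are mapped into \<open>T\<close>.
    Openness of \<open>V\<close> comes from the definition; the substance is that
    \<open>W - V\<close> is open as well, for then connectedness carries \<open>0 \<in> V\<close>
    over to \<open>1 \<in> V\<close>.\<close>
  define V where "V = {t. \<exists>\<epsilon>>0. \<forall>s\<in>ball t \<epsilon>. s \<in> W \<and> G s \<in> points T}"
  have V: "t \<in> W" "G t \<in> points T" if "t \<in> V" for t using that by (auto simp: V_def)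
  have oV: "open V"
    unfolding open_contains_ball
  proof
    fix t assume "t \<in> V"
    then obtain \<epsilon> where \<epsilon>: "\<epsilon> > 0" "\<forall>s\<in>ball t \<epsilon>. s \<in> W \<and> G s \<in> points T" by (auto simp: V_def)
    have "s \<in> V" if s: "s \<in> ball t \<epsilon>" for s
    proof -
      obtain \<eta> where "\<eta> > 0" "ball s \<eta> \<subseteq> ball t \<epsilon>" using s open_ball open_contains_ball by blast
      then show ?thesis using \<epsilon>(2) unfolding V_def by blast
    qed
    then show "\<exists>\<epsilon>>0. ball t \<epsilon> \<subseteq> V" using \<epsilon>(1) by blast
  qed
  have V0: "0 \<in> V"
    using Lnbhd[OF W01(1) U(1)] U(2,4) L01 unfolding V_def G_def by blast
  have "open (W - V)"
    unfolding open_contains_ball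
  proof
    fix t assume t: "t \<in> W - V"
    show "\<exists>\<epsilon>>0. ball t \<epsilon> \<subseteq> W - V"
    proof (cases "G t \<in> points T")
      case False
      have "G t \<in> points S" using cf L[of t] t openin_subset[OF B] by (auto simp: continuous_map_def G_def)
      moreover have "openin (mtop S) (points S - points T)" using TS by (auto simp: closed_submanifold_def)
      ultimately obtain \<epsilon> where "\<epsilon> > 0" "\<forall>s\<in>ball t \<epsilon>. s \<in> W \<and> G s \<in> points S - points T"
        using Gnbhd[of t "points S - points T"] t False by auto
      then show ?thesis using V(2) by (intro exI[of _ \<epsilon>]) auto
    next
      case True
      then obtain d k where d: "G t \<in> chart_dom d" "holomorphic_chart S d" "k \<le> chart_dim d"
        "chart_map d ` (chart_dom d \<inter> points T) = chart_map d ` chart_dom d \<inter> topspace (complex_space k)"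
        using TS unfolding closed_submanifold_def by blast
      note cd = holomorphic_chart_on[OF d(2)]
      obtain \<epsilon> where \<epsilon>: "\<epsilon> > 0" "\<And>s. s \<in> ball t \<epsilon> \<Longrightarrow> s \<in> W \<and> G s \<in> chart_dom d"
        using Gnbhd[of t "chart_dom d"] t d(1) cd unfolding chart_on_def by blast
      \<comment> \<open>If the ball met \<open>V\<close>, the coordinates from \<open>k\<close> on
        in the slice chart would vanish on an open part of the ball, so on all of it by analytic
        continuation. Then the whole ball would go into \<open>T\<close> and \<open>t\<close> would
        be in \<open>V\<close>.\<close>
      have "ball t \<epsilon> \<inter> V = {}"
      proof (rule ccontr)
        assume ne: "ball t \<epsilon> \<inter> V \<noteq> {}"
        have hol: "(\<lambda>s. chart_map d (G s) i) holomorphic_on ball t \<epsilon>" if i: "i < chart_dim d" for i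
          unfolding holomorphic_on_def
        proof
          fix s assume s: "s \<in> ball t \<epsilon>"
          have sub: "ball t \<epsilon> \<subseteq> W" using \<epsilon>(2) by blast
          have Ls: "L s \<in> chart_dom cB" using L[of s] sub s by (auto simp: cB_def)
          have "hol_at cB d f (L s)"
            using \<epsilon>(2)[OF s] Ls
            by (intro holomorphic_mapsD[OF N S f' atlas_holomorphic_chart[OF N cBN] d(2)]) (auto simp: G_def)
          then have "hol_at (plane_chart (ball t \<epsilon>)) d (\<lambda>s. f (L s)) s"
            using L sub by (intro hol_at_comp[OF Lhol[OF s sub], where \<eta> = 1]) (auto simp: cB_def)
          then have "(\<lambda>s. chart_map d (G s) i) field_differentiable at s"
            unfolding G_def using \<epsilon>(2) s i by (intro hol_at_plane_differentiable[of "ball t \<epsilon>"]) (auto simp: G_def)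
          then show "(\<lambda>s. chart_map d (G s) i) field_differentiable at s within ball t \<epsilon>"
            by (rule field_differentiable_at_within)
        qed
        have zero: "chart_map d (G s) i = 0" if s: "s \<in> ball t \<epsilon>" and i: "k \<le> i" for s i
        proof (cases "i < chart_dim d")
          case True
          have "chart_map d (G s') i = 0" if "s' \<in> ball t \<epsilon> \<inter> V" for s'
          proof -
            have "chart_map d (G s') \<in> chart_map d ` (chart_dom d \<inter> points T)" using that V(2) \<epsilon>(2) by blast
            then show ?thesis unfolding d(4) using i by (auto simp: topspace_complex_space)
          qed
          then show ?thesis
            using analytic_continuation_open[of "ball t \<epsilon> \<inter> V" "ball t \<epsilon>" "\<lambda>s. chart_map d (G s) i" "\<lambda>_. 0" s]
              hol[OF True] ne oV s by auto
        next
          case False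
          then show ?thesis using chart_map_zero[OF cd] \<epsilon>(2)[OF s] by simp
        qed
        have "G s \<in> points T" if s: "s \<in> ball t \<epsilon>" for s
        proof -
          have "chart_map d (G s) \<in> chart_map d ` (chart_dom d \<inter> points T)"
            unfolding d(4) using zero[OF s] \<epsilon>(2)[OF s] by (auto simp: topspace_complex_space)
          then show ?thesis using chart_inj_on[OF cd] \<epsilon>(2)[OF s] by (auto dest: inj_onD)
        qed
        then have "t \<in> V" unfolding V_def using \<epsilon> by blast
        then show False using t by blast
      qed
      then show ?thesis using \<epsilon> by (intro exI[of _ \<epsilon>]) auto
    qed
  qed
  then have "W - V = {}"
    using connectedD[OF conW oV] V0 W01(1) V(1) by blast
  then have "1 \<in> V" using W01(2) by blast
  then show ?thesis using V(2)[of 1] L01(2) by (simp add: G_def)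
qed

text \<open>A slice chart of \<open>S\<close> restricts to a chart of \<open>T\<close> with the
  first \<open>k\<close> coordinates, so the estimates for \<open>S\<close> contain those for
  \<open>T\<close>. This turns containment of values into factorization through
  \<open>T\<close>.\<close>

lemma holomorphic_into_submanifold:
  assumes R: "complex_manifold R" and TS: "closed_submanifold T S"
    and f: "f \<in> holomorphic_maps R S" and fT: "f ` points R \<subseteq> points T"
  shows "f \<in> holomorphic_maps R T"
proof (rule holomorphic_mapsI[OF R])
  have S: "complex_manifold S" and tT: "mtop T = subtopology (mtop S) (points T)"
    using TS by (simp_all add: closed_submanifold_def)
  show "complex_manifold T" using TS by (simp add: closed_submanifold_def)
  show "f \<in> points R \<rightarrow>\<^sub>E points T" using f fT by (auto simp: holomorphic_maps_def PiE_iff)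
  have cf: "continuous_map (mtop R) (mtop S) f" using f by (simp add: holomorphic_maps_def)
  then show "continuous_map (mtop R) (mtop T) f"
    using fT by (subst tT) (auto simp: continuous_map_in_subtopology)
  fix x assume x: "x \<in> points R"
  obtain c where c: "c \<in> atlas R" "x \<in> chart_dom c" using manifold_chart_at[OF R x] .
  have "f x \<in> points T" using fT x by blast
  then obtain d k where d: "f x \<in> chart_dom d" "holomorphic_chart S d" "k \<le> chart_dim d"
    "holomorphic_chart T \<lparr>chart_dim = k, chart_dom = chart_dom d \<inter> points T, chart_map = chart_map d\<rparr>"
    using TS unfolding closed_submanifold_def by blast
  define d' where "d' = \<lparr>chart_dim = k, chart_dom = chart_dom d \<inter> points T, chart_map = chart_map d\<rparr>"
  have h: "hol_at c d f x"
    by (rule holomorphic_mapsD[OF R S f atlas_holomorphic_chart[OF R c(1)] d(2) c(2) d(1)])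
  have db: "diff_bound c d' f x i a e \<delta>" if "diff_bound c d f x i a e \<delta>" for i a e \<delta>
    using that by (simp add: diff_bound_def d'_def)
  have "hol_at c d' f x"
    unfolding hol_at_def
  proof (intro allI impI)
    fix i assume "i < chart_dim d'"
    then have "i < chart_dim d" using d(3) by (simp add: d'_def)
    then show "\<exists>a. \<forall>e>0. \<exists>\<delta>>0. diff_bound c d' f x i a e \<delta>" using h db unfolding hol_at_def by meson
  qed
  then show "\<exists>c d. holomorphic_chart R c \<and> holomorphic_chart T d \<and>
      x \<in> chart_dom c \<and> f x \<in> chart_dom d \<and> hol_at c d f x"
    using c atlas_holomorphic_chart[OF R c(1)] d \<open>f x \<in> points T\<close>
    by (intro exI[of _ c] exI[of _ d']) (auto simp: d'_def)
qed

text \<open>If every map from a Stein manifold into \<open>X\<close> has a unique normal form \<open>(i, s)\<close>, naturally in the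
  source, then by the identity theorem the index \<open>i\<close> does not change when the inclusion of a polydisc
  is restricted to a smaller one. So \<open>i\<close> is locally constant on \<open>X\<close> and the \<open>s\<close> glue.\<close>

lemma stein_if_normal_forms:
  fixes X :: "real cmanifold" and S T :: "'i \<Rightarrow> real cmanifold"
    and \<kappa> :: "'i \<Rightarrow> real cmanifold \<Rightarrow> (real \<Rightarrow> real) \<Rightarrow> 'd"
    and \<psi> :: "real cmanifold \<Rightarrow> (real \<Rightarrow> real) \<Rightarrow> 'd"
    and \<rho> :: "real cmanifold \<Rightarrow> real cmanifold \<Rightarrow> (real \<Rightarrow> real) \<Rightarrow> 'd \<Rightarrow> 'd"
  defines "free i (R :: real cmanifold) s \<equiv> s \<in> holomorphic_maps R (S i) \<and> \<not> (points (T i) \<noteq> {} \<and> s \<in> holomorphic_maps R (T i))"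
  assumes X: "complex_manifold X"
    and S: "\<And>i. i \<in> I \<Longrightarrow> stein (S i)"
    and T: "\<And>i. i \<in> I \<Longrightarrow> closed_submanifold (T i) (S i)"
    and \<kappa>\<rho>: "\<And>i R R' s g. \<lbrakk>i \<in> I; stein R; stein R'; s \<in> holomorphic_maps R (S i); g \<in> holomorphic_maps R' R\<rbrakk>
            \<Longrightarrow> \<rho> R' R g (\<kappa> i R s) = \<kappa> i R' (compose (points R') s g)"
    and \<psi>\<rho>: "\<And>R R' f g. \<lbrakk>stein R; stein R'; f \<in> holomorphic_maps R X; g \<in> holomorphic_maps R' R\<rbrakk>
            \<Longrightarrow> \<rho> R' R g (\<psi> R f) = \<psi> R' (compose (points R') f g)"
    and ex: "\<And>R f. \<lbrakk>stein R; f \<in> holomorphic_maps R X\<rbrakk> \<Longrightarrow> \<exists>i\<in>I. \<exists>s. free i R s \<and> \<psi> R f = \<kappa> i R s"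
    and uniq: "\<And>R i j s s'. \<lbrakk>stein R; i \<in> I; j \<in> I; free i R s; free j R s'; \<kappa> i R s = \<kappa> j R s'\<rbrakk>
            \<Longrightarrow> i = j \<and> s = s'"
    and r: "\<And>i. i \<in> I \<Longrightarrow> r i \<in> holomorphic_maps (S i) X"
    and ret: "\<And>R i s f. \<lbrakk>stein R; i \<in> I; s \<in> holomorphic_maps R (S i); f \<in> holomorphic_maps R X; \<psi> R f = \<kappa> i R s\<rbrakk>
            \<Longrightarrow> compose (points R) (r i) s = f"
  shows "stein X"
proof -
  \<comment> \<open>These sets are at once a basis of \<open>X\<close> and, by
    \<open>stein_polydisc\<close>, objects on which the normal forms are available.\<close>
  define \<B> where "\<B> = {chart_polydisc c x \<delta> | c x \<delta>. c \<in> atlas X \<and> full_polydisc c x \<delta>}"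
  define N where "N B = restrict_manifold X B" for B
  define inc where "inc B = (\<lambda>x\<in>B. x)" for B :: "real set"
  have op\<B>: "openin (mtop X) B" if "B \<in> \<B>" for B
    using that openin_chart_polydisc[OF atlas_chart_on[OF X]] by (auto simp: \<B>_def)
  have sub\<B>: "B \<subseteq> points X" if "B \<in> \<B>" for B using op\<B>[OF that] openin_subset by blast
  have pN: "points (N B) = B" if "B \<in> \<B>" for B using sub\<B>[OF that] by (auto simp: N_def)
  have stN: "stein (N B)" if "B \<in> \<B>" for B
    using that stein_polydisc[OF X] by (auto simp: \<B>_def N_def)
  have mN: "complex_manifold (N B)" if "B \<in> \<B>" for B using stN[OF that] by (simp add: stein_def)
  have incN: "inc B' \<in> holomorphic_maps (N B') (N B)" if "B \<in> \<B>" "B' \<in> \<B>" "B' \<subseteq> B" for B B'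
    using holomorphic_maps_inclusion[OF X op\<B> op\<B>] that by (simp add: inc_def N_def)
  have incX: "inc B \<in> holomorphic_maps (N B) X" if "B \<in> \<B>" for B
    using holomorphic_maps_inclusion[OF X op\<B>[OF that] openin_topspace sub\<B>[OF that]]
    by (simp add: inc_def N_def restrict_manifold_points[OF X])
  have basis: "\<exists>B\<in>\<B>. x \<in> B \<and> B \<subseteq> V" if x: "openin (mtop X) V" "x \<in> V" for x V
  proof -
    have "x \<in> points X" using x openin_subset by blast
    then obtain c where c: "c \<in> atlas X" "x \<in> chart_dom c" using manifold_chart_at[OF X] by blast
    obtain \<delta> where "full_polydisc c x \<delta>" "chart_polydisc c x \<delta> \<subseteq> V" "x \<in> chart_polydisc c x \<delta>"
      using full_polydisc_within[OF atlas_chart_on[OF X c(1)] x(1) c(2) x(2)] .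
    then show ?thesis using c unfolding \<B>_def by blast
  qed
  have "\<forall>B\<in>\<B>. \<exists>i s. i \<in> I \<and> free i (N B) s \<and> \<psi> (N B) (inc B) = \<kappa> i (N B) s"
    using ex[OF stN incX] by blast
  then obtain idx F where iF: "\<And>B. B \<in> \<B> \<Longrightarrow> idx B \<in> I" "\<And>B. B \<in> \<B> \<Longrightarrow> free (idx B) (N B) (F B)"
    "\<And>B. B \<in> \<B> \<Longrightarrow> \<psi> (N B) (inc B) = \<kappa> (idx B) (N B) (F B)" by metis
  have F: "F B \<in> holomorphic_maps (N B) (S (idx B))" if "B \<in> \<B>" for B
    using iF(2)[OF that] by (simp add: free_def)
  \<comment> \<open>Restricting the normal form of \<open>inc B\<close> yields a pair for
    \<open>inc B'\<close> with the same index. Once the restricted map is known to be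
    \<open>free\<close>, \<open>uniq\<close> identifies this pair with the one chosen for
    \<open>B'\<close>.\<close>
  have restr: "idx B' = idx B \<and> (\<forall>y\<in>B'. F B' y = F B y)"
    if B: "B \<in> \<B>" "B' \<in> \<B>" "B' \<subseteq> B" for B B'
  proof (cases "B' = {}")
    case False
    let ?s = "compose B' (F B) (inc B')"
    have "compose B' (inc B) (inc B') = inc B'" using B(3) by (intro ext) (auto simp: compose_def inc_def)
    then have "\<psi> (N B') (inc B') = \<rho> (N B') (N B) (inc B') (\<psi> (N B) (inc B))"
      using \<psi>\<rho>[OF stN[OF B(1)] stN[OF B(2)] incX[OF B(1)] incN[OF B]] pN[OF B(2)] by simp
    also have "\<dots> = \<kappa> (idx B) (N B') ?s"
      using \<kappa>\<rho>[OF iF(1)[OF B(1)] stN[OF B(1)] stN[OF B(2)] F[OF B(1)] incN[OF B]] pN[OF B(2)] iF(3)[OF B(1)] by simp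
    finally have eq: "\<kappa> (idx B') (N B') (F B') = \<kappa> (idx B) (N B') ?s" using iF(3)[OF B(2)] by simp
    \<comment> \<open>If the restriction to the nonempty \<open>B'\<close> factored through the
      submanifold, the identity theorem would force all of \<open>B\<close> into it, against the
      choice of \<open>F B\<close>.\<close>
    have "free (idx B) (N B') ?s"
      unfolding free_def
    proof (intro conjI notI)
      have "complex_manifold (S (idx B))" using S[OF iF(1)[OF B(1)]] by (simp add: stein_def)
      then show "?s \<in> holomorphic_maps (N B') (S (idx B))"
        using holomorphic_maps_compose[OF mN[OF B(2)] mN[OF B(1)] _ incN[OF B] F[OF B(1)]] pN[OF B(2)] by simp
      assume h: "points (T (idx B)) \<noteq> {} \<and> ?s \<in> holomorphic_maps (N B') (T (idx B))"
      then have "?s \<in> B' \<rightarrow> points (T (idx B))" using pN[OF B(2)] by (auto simp: holomorphic_maps_def PiE_iff)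
      then have sub: "F B ` B' \<subseteq> points (T (idx B))" by (force simp: compose_def inc_def Pi_iff)
      obtain x0 where x0: "x0 \<in> B'" using False by blast
      obtain c x \<delta> where c: "B = chart_polydisc c x \<delta>" "c \<in> atlas X" "full_polydisc c x \<delta>"
        using B(1) by (auto simp: \<B>_def)
      have "F B y \<in> points (T (idx B))" if "y \<in> B" for y
        using polydisc_identity[OF X c(2,3) T[OF iF(1)[OF B(1)]], of "F B" B' x0 y]
          F[OF B(1)] op\<B>[OF B(2)] x0 B(3) sub that by (simp add: N_def c(1))
      then have "F B \<in> holomorphic_maps (N B) (T (idx B))"
        using pN[OF B(1)] by (intro holomorphic_into_submanifold[OF mN[OF B(1)] T[OF iF(1)[OF B(1)]] F[OF B(1)]]) auto
      then show False using iF(2)[OF B(1)] h by (simp add: free_def)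
    qed
    from uniq[OF stN[OF B(2)] iF(1)[OF B(2)] iF(1)[OF B(1)] iF(2)[OF B(2)] this eq]
    show ?thesis by (auto simp: compose_def inc_def)
  next
    case True
    \<comment> \<open>A full polydisc contains its centre, so this case cannot occur.\<close>
    then show ?thesis using B(2) by (auto simp: \<B>_def full_polydisc_def chart_polydisc_def)
  qed
  have "\<forall>x\<in>points X. \<exists>B. B \<in> \<B> \<and> x \<in> B" using basis[OF openin_topspace] by blast
  then obtain b where b: "\<And>x. x \<in> points X \<Longrightarrow> b x \<in> \<B>" "\<And>x. x \<in> points X \<Longrightarrow> x \<in> b x" by metis
  define rnk where "rnk x = idx (b x)" for x
  define G where "G x = F (b x) x" for x
  \<comment> \<open>Two polydiscs through \<open>x\<close> need not be nested; both are compared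
    with a third one inside their intersection.\<close>
  have loc: "rnk x = idx B \<and> G x = F B x" if B: "B \<in> \<B>" "x \<in> B" for B x
  proof -
    have x: "x \<in> points X" using sub\<B> B by blast
    obtain B' where B': "B' \<in> \<B>" "x \<in> B'" "B' \<subseteq> B \<inter> b x"
      using basis[OF openin_Int[OF op\<B>[OF B(1)] op\<B>[OF b(1)[OF x]]], of x] B(2) b(2)[OF x] by auto
    have "B' \<subseteq> B" "B' \<subseteq> b x" using B'(3) by auto
    from restr[OF B(1) B'(1) this(1)] restr[OF b(1)[OF x] B'(1) this(2)]
    show ?thesis using B'(2) by (simp add: rnk_def G_def)
  qed
  have glue: "openin (mtop X) {x \<in> points X. P x}"
    if P: "\<And>x. x \<in> points X \<Longrightarrow> P x \<Longrightarrow> \<exists>V. openin (mtop X) V \<and> x \<in> V \<and> (\<forall>y\<in>V. P y)" for P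
  proof (subst openin_subopen, intro ballI)
    fix x assume "x \<in> {x \<in> points X. P x}"
    then obtain V where "openin (mtop X) V" "x \<in> V" "\<forall>y\<in>V. P y" using P[of x] by auto
    then show "\<exists>V. openin (mtop X) V \<and> x \<in> V \<and> V \<subseteq> {x \<in> points X. P x}"
      using openin_subset[of "mtop X" V] by (intro exI[of _ V]) auto
  qed
  show ?thesis
  proof (rule stein_if_local_retracts[OF X, where rnk = rnk and F = G and r = r and S = S])
    show "openin (mtop X) {x \<in> points X. rnk x = i}" for i
      by (rule glue) (metis b loc op\<B>)
    fix x assume x: "x \<in> points X"
    note bI = iF(1)[OF b(1)[OF x], folded rnk_def]
    show "stein (S (rnk x))" using S[OF bI] .
    show "continuous_map (mtop (S (rnk x))) (mtop X) (r (rnk x))"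
      using r[OF bI] by (simp add: holomorphic_maps_def)
    have "compose (points (N (b x))) (r (rnk x)) (F (b x)) = inc (b x)"
      using ret[OF stN[OF b(1)[OF x]] bI _ incX[OF b(1)[OF x]]] F[OF b(1)[OF x]] iF(3)[OF b(1)[OF x]]
      by (simp add: rnk_def)
    then have "compose (points (N (b x))) (r (rnk x)) (F (b x)) x = inc (b x) x" by simp
    then show "r (rnk x) (G x) = x" using b[OF x] pN[OF b(1)[OF x]] by (simp add: compose_def inc_def G_def)
    have cFB: "continuous_map (subtopology (mtop X) B) (mtop (S (idx B))) (F B)" if "B \<in> \<B>" for B
      using F[OF that] by (simp add: holomorphic_maps_def N_def)
    show "continuous_map (subtopology (mtop X) {y \<in> points X. rnk y = rnk x}) (mtop (S (rnk x))) G"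
      unfolding continuous_map_def
    proof (intro conjI allI impI funcsetI)
      fix y assume "y \<in> topspace (subtopology (mtop X) {y \<in> points X. rnk y = rnk x})"
      then have y: "y \<in> points X" "rnk y = rnk x" by auto
      have "F (b y) y \<in> points (S (idx (b y)))"
        using cFB[OF b(1)[OF y(1)]] b[OF y(1)] y(1) by (auto simp: continuous_map_def)
      then show "G y \<in> points (S (rnk x))" using y(2) by (simp add: G_def rnk_def)
    next
      fix V assume V: "openin (mtop (S (rnk x))) V"
      have "openin (mtop X) {y \<in> points X. rnk y = rnk x \<and> G y \<in> V}"
      proof (rule glue)
        fix y assume y: "y \<in> points X" "rnk y = rnk x \<and> G y \<in> V"
        have ib: "idx (b y) = rnk x" using y by (simp add: rnk_def)
        have "openin (subtopology (mtop X) (b y)) {z \<in> topspace (subtopology (mtop X) (b y)). F (b y) z \<in> V}"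
          using cFB[OF b(1)[OF y(1)]] V unfolding continuous_map_def ib by blast
        then have "openin (mtop X) {z \<in> topspace (subtopology (mtop X) (b y)). F (b y) z \<in> V}"
          using op\<B>[OF b(1)[OF y(1)]] openin_trans_full by blast
        moreover have "y \<in> {z \<in> topspace (subtopology (mtop X) (b y)). F (b y) z \<in> V}"
          using y b(2)[OF y(1)] by (simp add: G_def)
        moreover have "\<forall>z\<in>{z \<in> topspace (subtopology (mtop X) (b y)). F (b y) z \<in> V}. rnk z = rnk x \<and> G z \<in> V"
          using loc[OF b(1)[OF y(1)]] ib by auto
        ultimately show "\<exists>V'. openin (mtop X) V' \<and> y \<in> V' \<and> (\<forall>z\<in>V'. rnk z = rnk x \<and> G z \<in> V)" by blast
      qed
      then show "openin (subtopology (mtop X) {y \<in> points X. rnk y = rnk x})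
         {y \<in> topspace (subtopology (mtop X) {y \<in> points X. rnk y = rnk x}). G y \<in> V}"
        unfolding openin_subtopology by (rule_tac exI, rule_tac conjI, assumption) auto
    qed
    fix g assume g: "g \<in> holomorphic_functions (S (rnk x))"
    let ?h = "\<lambda>y. if rnk y = rnk x then g (G y) else 0"
    show "?h \<in> holomorphic_functions X"
      unfolding holomorphic_functions_iff[OF X]
    proof (intro ballI)
      fix c y assume c: "c \<in> atlas X" "y \<in> chart_dom c"
      have y: "y \<in> points X" using c chart_dom_subset[OF atlas_chart_on[OF X c(1)]] by blast
      define B where "B = b y"
      have B: "B \<in> \<B>" "y \<in> B" using b y by (auto simp: B_def)
      \<comment> \<open>The function \<open>?h\<close> on a single polydisc, where the index is
        constant: either a composite with the holomorphic map \<open>F B\<close>, or 0.\<close>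
      define h where "h = (\<lambda>z. if idx B = rnk x then g (F B z) else 0)"
      have "h \<in> holomorphic_functions (N B)"
      proof (cases "idx B = rnk x")
        case True
        have "complex_manifold (S (rnk x))" using S[OF bI] by (simp add: stein_def)
        then show ?thesis
          using holomorphic_function_compose[OF mN[OF B(1)] _ F[OF B(1)]] g True unfolding h_def by simp
      next
        case False
        then show ?thesis using constant_holomorphic[OF mN[OF B(1)]] by (simp add: h_def)
      qed
      moreover have "restrict_chart c B \<in> atlas (N B)" using c by (auto simp: N_def)
      ultimately have "hol_at (restrict_chart c B) (plane_chart UNIV) h y"
        using c(2) B(2) unfolding holomorphic_functions_iff[OF mN[OF B(1)]] by auto
      moreover have "h z = ?h z" if "z \<in> chart_dom (restrict_chart c B)" for z
        using loc[OF B(1), of z] that by (auto simp: h_def)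
      ultimately have "hol_at (restrict_chart c B) (plane_chart UNIV) ?h y"
        using hol_at_cong[of "restrict_chart c B" h ?h y] c(2) B(2) by simp
      then show "hol_at c (plane_chart UNIV) ?h y"
        by (rule hol_at_unrestrict[OF _ atlas_chart_on[OF X c(1)] op\<B>[OF B(1)] c(2) B(2)])
    qed
  qed
qed

section \<open>Mapping spaces and prestacks\<close>

lemma topspace_mapping_space: "topspace (mapping_space M N) = holomorphic_maps M N"
proof -
  have "compactin (mtop M) {} \<and> openin (mtop N) {}" by simp
  then have "{f \<in> holomorphic_maps M N. f ` {} \<subseteq> {}} \<in>
      {{f \<in> holomorphic_maps M N. f ` K \<subseteq> U} | K U. compactin (mtop M) K \<and> openin (mtop N) U}" by blast
  then show ?thesis unfolding mapping_space_def topology_generated_by_topspace by auto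
qed

lemma cells_singular [simp]: "cells (singular_sset Y) n = {\<sigma>. singular_simplex n Y \<sigma>}"
  by (simp add: singular_sset_def)

lemma sop_singular [simp]:
  "sop (singular_sset Y) m n \<theta> \<sigma> = (\<lambda>t\<in>standard_simplex m. \<sigma> (affine_map m \<theta> t))"
  by (simp add: singular_sset_def)

lemma mapping_simplexD:
  "singular_simplex n (mapping_space M N) \<sigma> \<Longrightarrow> t \<in> standard_simplex n \<Longrightarrow> \<sigma> t \<in> holomorphic_maps M N"
  unfolding singular_simplex_def continuous_map_def
  by (auto simp: topspace_mapping_space)

text \<open>Local compactness, applied to the open subspace \<open>G\<close>, gives a compact
  neighbourhood of \<open>C\<close> inside \<open>G\<close>.\<close>

lemma compact_sandwich:
  assumes "locally_compact_space Y" "Hausdorff_space Y" "compactin Y C" "openin Y G" "C \<subseteq> G"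
  obtains V L where "openin Y V" "compactin Y L" "C \<subseteq> V" "V \<subseteq> L" "L \<subseteq> G"
proof -
  have H: "Hausdorff_space (subtopology Y G)" using assms(2) by (simp add: Hausdorff_space_subtopology)
  have "locally_compact_space (subtopology Y G)"
    using assms(1,2,4) by (simp add: locally_compact_space_open_subset)
  moreover have "compactin (subtopology Y G) C" using assms(3,5) by (simp add: compactin_subtopology)
  ultimately obtain V L where VL: "openin (subtopology Y G) V" "compactin (subtopology Y G) L" "C \<subseteq> V" "V \<subseteq> L"
    using locally_compact_space_compact_closed_compact[of "subtopology Y G"] H by blast
  moreover have "openin Y V" using VL(1) assms(4) openin_trans_full by blast
  ultimately show thesis using that unfolding compactin_subtopology by blast
qed

text \<open>Composition is jointly continuous for the compact-open topologies when the middle space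
  is locally compact and Hausdorff.\<close>

lemma singular_simplex_compose:
  assumes M: "complex_manifold M" and N: "complex_manifold N" and P: "complex_manifold P"
    and \<sigma>: "singular_simplex n (mapping_space M N) \<sigma>" and \<tau>: "singular_simplex n (mapping_space N P) \<tau>"
  shows "singular_simplex n (mapping_space M P) (\<lambda>t\<in>standard_simplex n. compose (points M) (\<tau> t) (\<sigma> t))"
  unfolding singular_simplex_def
proof
  define \<Delta> where "\<Delta> = subtopology (powertop_real UNIV) (standard_simplex n)"
  define \<phi> where "\<phi> = (\<lambda>t\<in>standard_simplex n. compose (points M) (\<tau> t) (\<sigma> t))"
  have top: "topspace \<Delta> = standard_simplex n" unfolding \<Delta>_def by (rule topspace_standard_simplex)
  have op: "openin \<Delta> {t \<in> standard_simplex n. \<rho> t ` K \<subseteq> U}"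
    if "singular_simplex n (mapping_space A B) \<rho>" "compactin (mtop A) K" "openin (mtop B) U"
    for A :: "'d cmanifold" and B :: "'e cmanifold" and \<rho> K U
  proof -
    have "openin (mapping_space A B) {f \<in> holomorphic_maps A B. f ` K \<subseteq> U}"
      unfolding mapping_space_def using that(2,3) by (intro topology_generated_by_Basis) blast
    then have "openin \<Delta> {t \<in> topspace \<Delta>. \<rho> t \<in> {f \<in> holomorphic_maps A B. f ` K \<subseteq> U}}"
      using that(1) unfolding singular_simplex_def \<Delta>_def continuous_map_def by blast
    also have "{t \<in> topspace \<Delta>. \<rho> t \<in> {f \<in> holomorphic_maps A B. f ` K \<subseteq> U}} = {t \<in> standard_simplex n. \<rho> t ` K \<subseteq> U}"
      using mapping_simplexD[OF that(1)] by (auto simp: top)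
    finally show ?thesis .
  qed
  have hol: "\<phi> t \<in> holomorphic_maps M P" if "t \<in> standard_simplex n" for t
    using that holomorphic_maps_compose[OF M N P mapping_simplexD[OF \<sigma> that] mapping_simplexD[OF \<tau> that]]
    by (simp add: \<phi>_def)
  have "continuous_map \<Delta> (mapping_space M P) \<phi>"
    unfolding mapping_space_def
  proof (rule continuous_on_generated_topo)
    fix W assume "W \<in> {{f \<in> holomorphic_maps M P. f ` K \<subseteq> U} | K U. compactin (mtop M) K \<and> openin (mtop P) U}"
    then obtain K U where W: "W = {f \<in> holomorphic_maps M P. f ` K \<subseteq> U}" and K: "compactin (mtop M) K"
      and U: "openin (mtop P) U" by blast
    have KM: "K \<subseteq> points M" using K compactin_subset_topspace by blast
    show "openin \<Delta> (\<phi> -` W \<inter> topspace \<Delta>)"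
    proof (subst openin_subopen, intro ballI)
      fix t assume t: "t \<in> \<phi> -` W \<inter> topspace \<Delta>"
      then have t': "t \<in> standard_simplex n" by (simp add: top)
      have tK: "\<tau> t ` \<sigma> t ` K \<subseteq> U"
        using t t' KM by (force simp: W \<phi>_def compose_def)
      have c\<sigma>: "continuous_map (mtop M) (mtop N) (\<sigma> t)" "\<sigma> t \<in> points M \<rightarrow>\<^sub>E points N"
        using mapping_simplexD[OF \<sigma> t'] by (auto simp: holomorphic_maps_def)
      have c\<tau>: "continuous_map (mtop N) (mtop P) (\<tau> t)"
        using mapping_simplexD[OF \<tau> t'] by (auto simp: holomorphic_maps_def)
      have "compactin (mtop N) (\<sigma> t ` K)" using image_compactin[OF K c\<sigma>(1)] .
      moreover have "openin (mtop N) {y \<in> points N. \<tau> t y \<in> U}" using c\<tau> U by (simp add: continuous_map_def)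
      moreover have "\<sigma> t ` K \<subseteq> {y \<in> points N. \<tau> t y \<in> U}" using tK KM c\<sigma>(2) by auto
      moreover have "Hausdorff_space (mtop N)" using N by (simp add: complex_manifold_def)
      ultimately obtain V L where VL: "openin (mtop N) V" "compactin (mtop N) L" "\<sigma> t ` K \<subseteq> V" "V \<subseteq> L"
        "L \<subseteq> {y \<in> points N. \<tau> t y \<in> U}"
        using compact_sandwich[OF locally_compact_manifold[OF N]] by blast
      \<comment> \<open>The sandwich decouples the two variables: if \<open>\<sigma> s\<close> maps
        \<open>K\<close> into \<open>V\<close> and \<open>\<tau> s\<close> maps \<open>L\<close>
        into \<open>U\<close>, the composite maps \<open>K\<close> into \<open>U\<close> because
        \<open>V \<subseteq> L\<close>.\<close>
      define Z where "Z = {s \<in> standard_simplex n. \<sigma> s ` K \<subseteq> V} \<inter> {s \<in> standard_simplex n. \<tau> s ` L \<subseteq> U}"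
      have "openin \<Delta> Z" unfolding Z_def
        by (intro openin_Int op[OF \<sigma> K VL(1)] op[OF \<tau> VL(2) U])
      moreover have "t \<in> Z" using t' VL(3,5) by (auto simp: Z_def)
      moreover have "Z \<subseteq> \<phi> -` W \<inter> topspace \<Delta>"
      proof
        fix s assume s: "s \<in> Z"
        then have s': "s \<in> standard_simplex n" by (simp add: Z_def)
        have "\<tau> s (\<sigma> s x) \<in> U" if "x \<in> K" for x
          using s VL(4) that unfolding Z_def by blast
        then have "\<phi> s ` K \<subseteq> U" using KM s' by (auto simp: \<phi>_def compose_def)
        then show "s \<in> \<phi> -` W \<inter> topspace \<Delta>" using hol[OF s'] s' by (simp add: W top)
      qed
      ultimately show "\<exists>Z. openin \<Delta> Z \<and> t \<in> Z \<and> Z \<subseteq> \<phi> -` W \<inter> topspace \<Delta>" by blast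
    qed
  next
    show "\<phi> ` topspace \<Delta> \<subseteq>
      \<Union>{{f \<in> holomorphic_maps M P. f ` K \<subseteq> U} | K U. compactin (mtop M) K \<and> openin (mtop P) U}"
      using hol topspace_mapping_space[of M P, unfolded mapping_space_def topology_generated_by_topspace]
      by (auto simp: top)
  qed
  then show "continuous_map (subtopology (powertop_real UNIV) (standard_simplex n)) (mapping_space M P)
     (\<lambda>t\<in>standard_simplex n. compose (points M) (\<tau> t) (\<sigma> t))" by (simp add: \<Delta>_def \<phi>_def)
qed auto

lemma singular_simplex_const: "y \<in> topspace Y \<Longrightarrow> singular_simplex n Y (\<lambda>t\<in>standard_simplex n. y)"
  unfolding singular_simplex_def
  by (auto intro: continuous_map_eq[of _ _ "\<lambda>_. y"])

section \<open>Affine maps of simplices and the singular simplicial set\<close>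

lemma affine_map_in_simplex:
  assumes \<theta>: "\<theta> \<in> Delta_maps m n" and t: "t \<in> standard_simplex m"
  shows "affine_map m \<theta> t \<in> standard_simplex n"
proof -
  have t0: "0 \<le> t i" for i using t by (auto simp: standard_simplex_def)
  have t1: "(\<Sum>i\<le>m. t i) = 1" using t by (auto simp: standard_simplex_def)
  have \<theta>n: "\<theta> i \<le> n" if "i \<le> m" for i using \<theta> that by (auto simp: Delta_maps_def PiE_iff)
  have "0 \<le> affine_map m \<theta> t j" for j unfolding affine_map_def using t0 by (intro sum_nonneg) auto
  moreover have "affine_map m \<theta> t j \<le> 1" for j
  proof -
    have "affine_map m \<theta> t j \<le> (\<Sum>i\<le>m. t i)" unfolding affine_map_def
      using t0 by (intro sum_mono2) auto
    then show ?thesis by (simp add: t1)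
  qed
  moreover have "affine_map m \<theta> t j = 0" if "j > n" for j
  proof -
    have "{i. i \<le> m \<and> \<theta> i = j} = {}" using \<theta>n that by fastforce
    then show ?thesis unfolding affine_map_def by (simp only: sum.empty)
  qed
  moreover have "(\<Sum>j\<le>n. affine_map m \<theta> t j) = 1"
  proof -
    have "(\<Sum>j\<le>n. affine_map m \<theta> t j) = (\<Sum>j\<in>{..n}. sum t {i \<in> {..m}. \<theta> i = j})"
      by (simp add: affine_map_def)
    also have "\<dots> = sum t {..m}" by (rule sum.group) (use \<theta>n in auto)
    finally show ?thesis by (simp add: t1)
  qed
  ultimately show ?thesis by (simp add: standard_simplex_def)
qed

text \<open>Each side collects the weights of the vertices sent to \<open>j\<close>. The left side
  collects them first by the value of \<eta>, which lies in \<open>{..m}\<close>, so no weight is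
  lost.\<close>

lemma affine_map_comp:
  assumes \<eta>: "\<eta> \<in> Delta_maps l m"
  shows "affine_map m \<theta> (affine_map l \<eta> t) = affine_map l (compose {..l} \<theta> \<eta>) t"
proof
  fix j
  have "affine_map m \<theta> (affine_map l \<eta> t) j =
      (\<Sum>i\<in>{i. i \<le> m \<and> \<theta> i = j}. sum t {k \<in> {k. k \<le> l \<and> \<theta> (\<eta> k) = j}. \<eta> k = i})"
    unfolding affine_map_def by (intro sum.cong) auto
  also have "\<dots> = sum t {k. k \<le> l \<and> \<theta> (\<eta> k) = j}"
    by (rule sum.group) (use \<eta> in \<open>auto simp: Delta_maps_def PiE_iff\<close>)
  also have "{k. k \<le> l \<and> \<theta> (\<eta> k) = j} = {k. k \<le> l \<and> compose {..l} \<theta> \<eta> k = j}"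
    by (auto simp: compose_def)
  finally show "affine_map m \<theta> (affine_map l \<eta> t) j = affine_map l (compose {..l} \<theta> \<eta>) t j"
    by (simp add: affine_map_def)
qed

lemma affine_map_id:
  assumes "t \<in> standard_simplex n"
  shows "affine_map n (\<lambda>i\<in>{..n}. i) t = t"
proof
  fix j
  have "{i. i \<le> n \<and> (\<lambda>i\<in>{..n}. i) i = j} = (if j \<le> n then {j} else {})" by auto
  then show "affine_map n (\<lambda>i\<in>{..n}. i) t j = t j"
    using assms by (auto simp: affine_map_def standard_simplex_def)
qed

lemma continuous_map_affine:
  assumes "\<theta> \<in> Delta_maps m n"
  shows "continuous_map (subtopology (powertop_real UNIV) (standard_simplex m))
           (subtopology (powertop_real UNIV) (standard_simplex n)) (affine_map m \<theta>)"
  unfolding continuous_map_in_subtopology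
proof
  show "continuous_map (subtopology (powertop_real UNIV) (standard_simplex m)) (powertop_real UNIV) (affine_map m \<theta>)"
    unfolding continuous_map_componentwise_UNIV affine_map_def
    by (intro allI continuous_map_sum continuous_map_from_subtopology continuous_map_product_projection) auto
qed (use affine_map_in_simplex[OF assms] in auto)

lemma Delta_maps_comp:
  assumes "\<eta> \<in> Delta_maps l m" "\<theta> \<in> Delta_maps m n"
  shows "compose {..l} \<theta> \<eta> \<in> Delta_maps l n"
  using assms by (fastforce simp: Delta_maps_def compose_def PiE_iff mono_on_def)

lemma simplicial_set_singular: "simplicial_set (singular_sset Y)"
  unfolding simplicial_set_def
proof (intro conjI allI ballI)
  fix m n \<theta> \<sigma> assume \<theta>: "\<theta> \<in> Delta_maps m n" and \<sigma>: "\<sigma> \<in> cells (singular_sset Y) n"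
  have "continuous_map (subtopology (powertop_real UNIV) (standard_simplex m)) Y (\<sigma> \<circ> affine_map m \<theta>)"
    using \<sigma> continuous_map_compose[OF continuous_map_affine[OF \<theta>]] by (auto simp: singular_simplex_def)
  then show "sop (singular_sset Y) m n \<theta> \<sigma> \<in> cells (singular_sset Y) m"
    by (auto simp: singular_simplex_def intro: continuous_map_eq)
next
  fix n \<sigma> assume "\<sigma> \<in> cells (singular_sset Y) n"
  then show "sop (singular_sset Y) n n (\<lambda>i\<in>{..n}. i) \<sigma> = \<sigma>"
    by (auto simp: affine_map_id singular_simplex_def extensional_def)
next
  fix l m n \<eta> \<theta> \<sigma>
  assume "\<eta> \<in> Delta_maps l m" "\<theta> \<in> Delta_maps m n" "\<sigma> \<in> cells (singular_sset Y) n"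
  then show "sop (singular_sset Y) l m \<eta> (sop (singular_sset Y) m n \<theta> \<sigma>)
      = sop (singular_sset Y) l n (compose {..l} \<theta> \<eta>) \<sigma>"
    by (auto simp: affine_map_in_simplex affine_map_comp)
qed

lemma prestack_of_simps [simp]:
  "val (prestack_of X) S = sO S X" "pull (prestack_of X) T S n \<sigma> x = sO_comp T n x \<sigma>"
  by (simp_all add: prestack_of_def)

lemma SteinsD: "S \<in> Steins \<Longrightarrow> complex_manifold S"
  by (simp add: Steins_def stein_def)

text \<open>Closure under the action is the joint continuity of composition. The identity law holds
  as an equality of functions because simplices and their values are extensional.\<close>

lemma is_prestack_of:
  assumes X: "complex_manifold X"
  shows "is_prestack (prestack_of X)"
  unfolding is_prestack_def prestack_of_simps
proof (intro conjI ballI allI)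
  show "simplicial_set (sO S X)" for S :: "real cmanifold" by (rule simplicial_set_singular)
next
  fix T S n \<sigma> x assume TS: "T \<in> Steins" "S \<in> Steins" and \<sigma>: "\<sigma> \<in> cells (sO T S) n" and x: "x \<in> cells (sO S X) n"
  show "sO_comp T n x \<sigma> \<in> cells (sO T X) n"
    using singular_simplex_compose[OF SteinsD[OF TS(1)] SteinsD[OF TS(2)] X] \<sigma> x by (simp add: sO_comp_def)
  fix m \<theta> assume "\<theta> \<in> Delta_maps m n"
  then show "sop (sO T X) m n \<theta> (sO_comp T n x \<sigma>) = sO_comp T m (sop (sO S X) m n \<theta> x) (sop (sO T S) m n \<theta> \<sigma>)"
    by (auto simp: sO_comp_def affine_map_in_simplex)
next
  fix S :: "real cmanifold" and n x assume x: "x \<in> cells (sO S X) n"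
  show "sO_comp S n x (sO_id S n) = x"
  proof
    fix t show "sO_comp S n x (sO_id S n) t = x t"
    proof (cases "t \<in> standard_simplex n")
      case True
      then have "x t \<in> extensional (points S)"
        using x mapping_simplexD[of n S X x t] by (auto simp: holomorphic_maps_def PiE_iff)
      then show ?thesis using True by (auto simp: sO_comp_def sO_id_def compose_def extensional_def)
    next
      case False
      then show ?thesis using x by (auto simp: sO_comp_def singular_simplex_def extensional_def)
    qed
  qed
next
  fix R S :: "real cmanifold" and n \<sigma> \<tau> x assume \<sigma>: "\<sigma> \<in> cells (sO R S) n"
  have "\<sigma> t \<in> points R \<rightarrow> points S" if "t \<in> standard_simplex n" for t
    using \<sigma> mapping_simplexD[of n R S \<sigma> t] that by (auto simp: holomorphic_maps_def)
  then show "sO_comp R n (sO_comp S n x \<tau>) \<sigma> = sO_comp R n x (sO_comp R n \<tau> \<sigma>)"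
    by (fastforce simp: sO_comp_def compose_def Pi_iff)
qed

section \<open>Functoriality in the target manifold\<close>

definition postcompose :: "('y \<Rightarrow> 'z) \<Rightarrow> ('y map_simplex, 'z map_simplex) prestack_map" where
  "postcompose g S n x = (\<lambda>t\<in>standard_simplex n. compose (points S) g (x t))"

lemma prestack_hom_postcompose:
  assumes M: "complex_manifold M" and N: "complex_manifold N" and g: "g \<in> holomorphic_maps M N"
  shows "prestack_hom (prestack_of M) (prestack_of N) (postcompose g)"
  unfolding prestack_hom_def prestack_of_simps
proof (intro conjI ballI allI is_prestack_of M N)
  fix S n x assume S: "S \<in> Steins" and x: "x \<in> cells (sO S M) n"
  \<comment> \<open>Viewed as a constant simplex, \<open>g\<close> makes postcomposition a case of
    \<open>singular_simplex_compose\<close>.\<close>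
  have c: "singular_simplex n (mapping_space M N) (\<lambda>t\<in>standard_simplex n. g)"
    using g by (intro singular_simplex_const) (simp add: topspace_mapping_space)
  have eq: "postcompose g S n x =
      (\<lambda>t\<in>standard_simplex n. compose (points S) ((\<lambda>t\<in>standard_simplex n. g) t) (x t))"
    by (auto simp: postcompose_def)
  show "postcompose g S n x \<in> cells (sO S N) n"
    unfolding eq using singular_simplex_compose[OF SteinsD[OF S] M N _ c] x by simp
  show "postcompose g S m (sop (sO S M) m n \<theta> x) = sop (sO S N) m n \<theta> (postcompose g S n x)"
    if "\<theta> \<in> Delta_maps m n" for m \<theta>
    using that by (auto simp: postcompose_def affine_map_in_simplex)
  fix T \<sigma> assume \<sigma>: "\<sigma> \<in> cells (sO T S) n"
  have "\<sigma> t \<in> points T \<rightarrow> points S" if "t \<in> standard_simplex n" for t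
    using \<sigma> mapping_simplexD[of n T S \<sigma> t] that by (auto simp: holomorphic_maps_def)
  then show "postcompose g T n (sO_comp T n x \<sigma>) = sO_comp T n (postcompose g S n x) \<sigma>"
    by (fastforce simp: sO_comp_def postcompose_def compose_def Pi_iff)
qed

lemma prestack_hom_comp:
  assumes "prestack_hom A B f" "prestack_hom B C g"
  shows "prestack_hom A C (comp_map g f)"
  using assms unfolding prestack_hom_def comp_map_def by simp

lemma postcompose_inverse:
  assumes "\<And>x. x \<in> points M \<Longrightarrow> h (g x) = x"
  shows "agree_on (prestack_of M) (comp_map (postcompose h) (postcompose g)) inclusion"
  unfolding agree_on_def comp_map_def prestack_of_simps
proof (intro ballI allI)
  fix S n x assume x: "x \<in> cells (sO S M) n"
  show "postcompose h S n (postcompose g S n x) = x"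
  proof
    fix t show "postcompose h S n (postcompose g S n x) t = x t"
    proof (cases "t \<in> standard_simplex n")
      case True
      then have "x t \<in> points S \<rightarrow>\<^sub>E points M"
        using x mapping_simplexD[of n S M x t] by (auto simp: holomorphic_maps_def)
      then show ?thesis using True assms
        by (auto simp: postcompose_def compose_def PiE_iff extensional_def fun_eq_iff)
    next
      case False
      then show ?thesis using x by (auto simp: postcompose_def singular_simplex_def extensional_def)
    qed
  qed
qed

text \<open>In a Hausdorff space a point is determined by the members of a base that contain it. For
  a countable base this embeds the points in the sets of natural numbers, of which there are as many
  as reals.\<close>

lemma manifold_inj_real:
  assumes "complex_manifold M"
  obtains e :: "'a \<Rightarrow> real" where "inj_on e (points (M :: 'a cmanifold))"
proof -
  from assms obtain \<U> where \<U>: "countable \<U>"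
    "\<And>U x. openin (mtop M) U \<Longrightarrow> x \<in> U \<Longrightarrow> \<exists>V\<in>\<U>. x \<in> V \<and> V \<subseteq> U"
    unfolding complex_manifold_def second_countable_def by metis
  obtain h :: "nat set \<Rightarrow> real" where h: "inj h"
    using nat_sets_eqpoll_reals unfolding eqpoll_def bij_betw_def by blast
  define k where "k x = to_nat_on \<U> ` {V \<in> \<U>. x \<in> V}" for x
  have "inj_on k (points M)"
  proof (rule inj_onI, rule ccontr)
    fix x y assume xy: "x \<in> points M" "y \<in> points M" "k x = k y" "x \<noteq> y"
    then obtain U where U: "openin (mtop M) U" "x \<in> U" "y \<notin> U"
      using assms unfolding complex_manifold_def Hausdorff_space_def by (metis disjnt_iff)
    obtain V where V: "V \<in> \<U>" "x \<in> V" "V \<subseteq> U" using \<U>(2)[OF U(1,2)] by blast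
    have "to_nat_on \<U> V \<in> k y" using V xy(3) unfolding k_def by blast
    then obtain V' where V': "V' \<in> \<U>" "y \<in> V'" "to_nat_on \<U> V = to_nat_on \<U> V'" by (auto simp: k_def)
    then have "V = V'" using V(1) \<U>(1) by (simp add: to_nat_on_inj)
    then show False using V V' U by blast
  qed
  then have "inj_on (h \<circ> k) (points M)" using h by (auto intro: comp_inj_on inj_on_subset)
  then show thesis using that by blast
qed

text \<open>The objects of \<open>Steins\<close> have real points, so a manifold with points of
  another type enters the category through an isomorphic copy.\<close>

lemma real_copy:
  fixes M :: "'a cmanifold"
  assumes M: "complex_manifold M"
  obtains N :: "real cmanifold" and e e' where "complex_manifold N" "e \<in> holomorphic_maps M N"
    "e' \<in> holomorphic_maps N M" "\<And>x. x \<in> points M \<Longrightarrow> e' (e x) = x" "\<And>y. y \<in> points N \<Longrightarrow> e (e' y) = y"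
proof -
  obtain k :: "'a \<Rightarrow> real" where k: "inj_on k (points M)" using manifold_inj_real[OF M] .
  note t = transport_manifold[OF M k]
  show thesis
    by (rule that[OF t(1-3)]) (use k t(4) in \<open>auto simp: inv_into_f_f\<close>)
qed

lemma is_prestack_times:
  assumes A: "is_prestack A" and K: "simplicial_set K"
  shows "is_prestack (times_sset A K)"
proof -
  have 1: "simplicial_set (val (times_sset A K) S)" if "S \<in> Steins" for S
  proof -
    have "simplicial_set (val A S)" using A that by (simp add: is_prestack_def)
    then show ?thesis using K by (auto simp: simplicial_set_def times_sset_def)
  qed
  show ?thesis
    unfolding is_prestack_def
  proof (intro conjI ballI allI 1)
    fix T S n \<sigma> x assume "T \<in> Steins" "S \<in> Steins" "\<sigma> \<in> cells (sO T S) n" "x \<in> cells (val (times_sset A K) S) n"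
    then show "pull (times_sset A K) T S n \<sigma> x \<in> cells (val (times_sset A K) T) n"
      "\<And>m \<theta>. \<theta> \<in> Delta_maps m n \<Longrightarrow> sop (val (times_sset A K) T) m n \<theta> (pull (times_sset A K) T S n \<sigma> x)
        = pull (times_sset A K) T S m (sop (sO T S) m n \<theta> \<sigma>) (sop (val (times_sset A K) S) m n \<theta> x)"
      using A unfolding is_prestack_def by (auto simp: times_sset_def)
  qed (use A in \<open>auto simp: is_prestack_def times_sset_def\<close>)
qed

lemma simplicial_set_simplex: "simplicial_set (simplex_sset n)"
proof -
  have "compose {..m} x (\<lambda>i\<in>{..m}. i) = x" if "x \<in> Delta_maps m n" for m x
    using that by (auto simp: Delta_maps_def PiE_iff compose_def extensional_def fun_eq_iff)
  moreover have "compose {..l} (compose {..m} x \<theta>) \<eta> = compose {..l} x (compose {..l} \<theta> \<eta>)"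
    if "\<eta> \<in> Delta_maps l m" for l m \<eta> \<theta> and x :: "nat \<Rightarrow> nat"
    using that by (auto simp: Delta_maps_def PiE_iff compose_def fun_eq_iff)
  ultimately show ?thesis
    by (simp add: simplicial_set_def simplex_sset_def Delta_maps_comp)
qed

section \<open>Stein manifolds are cofibrant\<close>

text \<open>Weaker than equality with \<open>initial_prestack\<close>: the source of a generating
  cofibration or of a cell complex may be empty while its operations differ from those of the
  initial prestack.\<close>

definition empty_prestack :: "'b prestack \<Rightarrow> bool" where
  "empty_prestack C \<longleftrightarrow> (\<forall>S\<in>Steins. \<forall>n. cells (val C S) n = {})"

lemma empty_initial_prestack: "empty_prestack initial_prestack"
  by (simp add: empty_prestack_def initial_prestack_def)

lemma is_prestack_empty: "empty_prestack C \<Longrightarrow> is_prestack C"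
  by (simp add: empty_prestack_def is_prestack_def simplicial_set_def)

lemma prestack_hom_empty: "empty_prestack C \<Longrightarrow> is_prestack B \<Longrightarrow> prestack_hom C B f"
  using is_prestack_empty by (auto simp: prestack_hom_def empty_prestack_def)

lemma agree_on_empty: "empty_prestack C \<Longrightarrow> agree_on C f g"
  by (simp add: agree_on_def empty_prestack_def)

text \<open>Places a prestack in the right summand of a sum type; for \<open>prestack_of N\<close>
  this is the summand that \<open>'u large\<close> reserves for it.\<close>

definition inr_prestack :: "'b prestack \<Rightarrow> ('a + 'b) prestack" where
  "inr_prestack A =
     \<lparr>val = (\<lambda>S. \<lparr>cells = (\<lambda>n. Inr ` cells (val A S) n),
                  sop = (\<lambda>m n \<theta> y. Inr (sop (val A S) m n \<theta> (projr y)))\<rparr>),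
      pull = (\<lambda>T S n \<sigma> y. Inr (pull A T S n \<sigma> (projr y)))\<rparr>"

lemma inr_prestack:
  assumes "is_prestack A"
  shows "is_prestack (inr_prestack A)" "prestack_hom A (inr_prestack A) (\<lambda>S n. Inr)"
    "prestack_hom (inr_prestack A) A (\<lambda>S n. projr)"
proof -
  show *: "is_prestack (inr_prestack A)"
    using assms unfolding is_prestack_def simplicial_set_def
    by (auto simp: inr_prestack_def)
  show "prestack_hom A (inr_prestack A) (\<lambda>S n. Inr)" "prestack_hom (inr_prestack A) A (\<lambda>S n. projr)"
    using assms * by (auto simp: prestack_hom_def inr_prestack_def)
qed

lemma prestack_hom_fst:
  assumes "is_prestack A" "simplicial_set K"
  shows "prestack_hom (times_sset A K) A (\<lambda>S n. fst)"
  using assms is_prestack_times[OF assms] by (auto simp: prestack_hom_def times_sset_def)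

text \<open>Nothing is glued, so the equivalence relation is the identity and the pushout is a copy
  of \<open>Q\<close>; any levelwise bijective map from \<open>Q\<close> exhibits its target as the
  pushout.\<close>

lemma pushout_square_from_empty:
  assumes P: "empty_prestack P" and B: "empty_prestack B" and k: "prestack_hom Q D k"
    and bij: "\<And>S n. S \<in> Steins \<Longrightarrow> bij_betw (k S n) (cells (val Q S) n) (cells (val D S) n)"
  shows "pushout_square P B Q D a j h k"
  unfolding pushout_square_def
proof (intro conjI ballI allI)
  have Q: "is_prestack Q" "is_prestack D" using k by (auto simp: prestack_hom_def)
  show "prestack_hom P B a" "prestack_hom P Q j" "prestack_hom B D h" "prestack_hom Q D k"
    using prestack_hom_empty P B Q k is_prestack_empty by blast+
  show "agree_on P (comp_map h a) (comp_map k j)" by (rule agree_on_empty[OF P])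
  fix S n assume S: "S \<in> Steins"
  have g: "glue P a j S n = Id" using P S by (simp add: glue_def empty_prestack_def)
  have c: "cells (val (pushout P B Q a j) S) n = (\<lambda>q. {Inr q}) ` cells (val Q S) n"
    using B S by (auto simp: pushout_def g empty_prestack_def quotient_def)
  have "bij_betw (copair h k S n \<circ> (\<lambda>q. {Inr q})) (cells (val Q S) n) (cells (val D S) n)"
    using bij[OF S, of n] by (simp add: copair_def comp_def)
  moreover have "bij_betw (\<lambda>q. {Inr q}) (cells (val Q S) n) (cells (val (pushout P B Q a j) S) n)"
    unfolding c by (rule bij_betw_imageI) (auto simp: inj_on_def)
  ultimately show "bij_betw (copair h k S n) (cells (val (pushout P B Q a j) S) n) (cells (val D S) n)"
    using bij_betw_comp_iff by blast
qed

section \<open>Transfinite compositions with one step\<close>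

lemma Delta_maps_0: "Delta_maps n 0 = {\<lambda>i\<in>{..n}. 0}"
  by (auto simp: Delta_maps_def PiE_iff extensional_def mono_on_def fun_eq_iff)

lemma two_step_well_order:
  assumes "a \<noteq> b"
  defines "r \<equiv> {(a, a), (a, b), (b, b)}"
  shows "Well_order r" "Field r = {a, b}" "under r a = {a}" "under r b = {a, b}"
    "underS r a = {}" "underS r b = {a}"
proof -
  show F: "Field r = {a, b}" by (auto simp: r_def Field_def)
  have "r - Id = {(a, b)}" using assms by auto
  moreover have "wf {(a, b)}" using assms(1) by (simp add: wf_insert)
  ultimately show "Well_order r"
    using assms by (auto simp: F well_order_on_def linear_order_on_def partial_order_on_def preorder_on_def
        refl_on_def trans_def antisym_def total_on_def)
  show "under r a = {a}" "under r b = {a, b}" "underS r a = {}" "underS r b = {a}"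
    using assms by (auto simp: under_def underS_def)
qed

text \<open>The order \<open>a < b\<close> has one successor step and no limit stage. Index sets
  live in the type of the simplices, which is why two distinct elements of that type are asked
  for.\<close>

lemma transfinite_composition_single:
  fixes C D :: "'u prestack"
  assumes W: "W C D inclusion" and CD: "prestack_hom C D inclusion" and ab: "(a :: 'u) \<noteq> b"
  shows "transfinite_composition_of W C D inclusion"
proof -
  define r where "r = {(a, a), (a, b), (b, b)}"
  note r = two_step_well_order[OF ab, folded r_def]
  define A where "A i = (if i = a then C else D)" for i
  have A: "A a = C" "A b = D" using ab by (auto simp: A_def)
  have P: "is_prestack C" "is_prestack D" using CD by (auto simp: prestack_hom_def)
  have id: "prestack_hom B B inclusion" if "is_prestack B" for B :: "'u prestack"
    using that by (simp add: prestack_hom_def is_prestack_def simplicial_set_def)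
  have hom: "prestack_hom (A i) (A j) inclusion" if "(i, j) \<in> r" for i j
    using that id P CD ab by (auto simp: r_def A_def)
  have col: "chain_colimit {a, b} r A (\<lambda>i j. inclusion) D (\<lambda>i. inclusion)"
    unfolding chain_colimit_def
  proof (intro conjI ballI allI impI)
    show "prestack_hom (A i) D inclusion" if "i \<in> {a, b}" for i
      using that hom[of i b] A by (auto simp: r_def)
    show "agree_on (A i) inclusion (comp_map inclusion inclusion)" for i
      by (simp add: agree_on_def comp_map_def)
    show "\<exists>i\<in>{a, b}. \<exists>x\<in>cells (val (A i) S) n. y = x" if "y \<in> cells (val D S) n" for S n y
      using that A by auto
    show "\<exists>l\<in>{a, b}. (i, l) \<in> r \<and> (j, l) \<in> r \<and> x = y" if "i \<in> {a, b}" "j \<in> {a, b}" "x = y" for i j and x y :: 'u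
      using that by (auto simp: r_def)
  qed
  show ?thesis
    unfolding transfinite_composition_of_def
  proof (rule exI[of _ r], rule exI[of _ A], rule exI[of _ "\<lambda>i j. inclusion"], rule exI[of _ "\<lambda>i. inclusion"],
      rule exI[of _ a], intro conjI allI ballI impI)
    show "W (A i) (A j) inclusion" if "i \<in> Field r" "j \<in> Field r" "underS r j = under r i" for i j
    proof -
      have "i = a \<and> j = b" using that ab unfolding r(2) by (auto simp: r(3-6))
      then show ?thesis using W A by simp
    qed
    show "chain_colimit (underS r j) r A (\<lambda>i j. inclusion) (A j) (\<lambda>i. inclusion)"
      if "j \<in> Field r" "underS r j \<noteq> {} \<and> (\<nexists>i. i \<in> Field r \<and> underS r j = under r i)" for j
      using that unfolding r(2) by (auto simp: r(3-6))
  qed (use r hom col A in \<open>auto simp: agree_on_def comp_map_def\<close>)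
qed

text \<open>The cell complex consists of one vertex cell attached to the empty prestack, so it is a
  copy \<open>D\<close> of \<open>N\<close>. The manifold \<open>Y\<close> need only be a retract of
  \<open>N\<close>, as cofibrations admit retracts.\<close>

lemma cofibrant_if_cell:
  fixes N :: "real cmanifold" and Y :: "'z cmanifold"
  assumes Y: "complex_manifold Y" and N: "N \<in> Steins"
    and e: "e \<in> holomorphic_maps Y N" "e' \<in> holomorphic_maps N Y" "\<And>y. y \<in> points Y \<Longrightarrow> e' (e y) = y"
    and J: "J P (times_sset (prestack_of N) (simplex_sset 0)) j" and P: "empty_prestack P"
  shows "cofibrant TYPE('u) J (prestack_of Y)"
proof -
  define D :: "'u large prestack" where "D = inr_prestack (prestack_of N)"
  define Q where "Q = times_sset (prestack_of N) (simplex_sset 0)"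
  \<comment> \<open>Forgets the factor \<Delta>^0, which has exactly one simplex in each degree, so
    \<open>k\<close> is bijective.\<close>
  define k where "k = comp_map (\<lambda>S n. Inr :: _ \<Rightarrow> 'u large) ((\<lambda>S n. fst) :: (_ \<times> (nat \<Rightarrow> nat), _) prestack_map)"
  have Nm: "complex_manifold N" using SteinsD[OF N] .
  note pN = is_prestack_of[OF Nm]
  have D: "is_prestack D" "prestack_hom (prestack_of N) D (\<lambda>S n. Inr)" "prestack_hom D (prestack_of N) (\<lambda>S n. projr)"
    unfolding D_def by (rule inr_prestack[OF pN])+
  have "prestack_hom Q D k"
    unfolding k_def Q_def
    by (rule prestack_hom_comp[OF prestack_hom_fst[OF pN simplicial_set_simplex] D(2)])
  moreover have "bij_betw (k S n) (cells (val Q S) n) (cells (val D S) n)" for S n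
    unfolding bij_betw_def
    by (auto simp: inj_on_def k_def comp_map_def Q_def D_def times_sset_def inr_prestack_def
        simplex_sset_def Delta_maps_0 image_def)
  \<comment> \<open>Maps out of an empty prestack satisfy all conditions vacuously, so
    \<open>undefined\<close> serves as the attaching map.\<close>
  ultimately have "pushout_square P (initial_prestack :: 'u large prestack) Q D undefined j inclusion k"
    by (intro pushout_square_from_empty[OF P empty_initial_prestack])
  then have "is_pushout_of J (initial_prestack :: 'u large prestack) D inclusion"
    unfolding is_pushout_of_def using J Q_def by blast
  \<comment> \<open>The two stages of the composition; the right summand provides distinct indices
    whatever \<open>'u\<close> is.\<close>
  moreover have "(Inr (\<lambda>_ _. 0) :: 'u large) \<noteq> Inr (\<lambda>_ _. 1)" by (simp add: fun_eq_iff)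
  ultimately have tr: "transfinite_composition_of (is_pushout_of J) (initial_prestack :: 'u large prestack) D inclusion"
    by (intro transfinite_composition_single prestack_hom_empty[OF empty_initial_prestack D(1)])
  have "retract_of_map (initial_prestack :: 'z map_simplex prestack) (prestack_of Y) inclusion
     (initial_prestack :: 'u large prestack) D inclusion"
    unfolding retract_of_map_def
  proof (intro exI conjI)
    show "prestack_hom (initial_prestack :: 'z map_simplex prestack) (initial_prestack :: 'u large prestack) undefined"
      "prestack_hom (initial_prestack :: 'u large prestack) (initial_prestack :: 'z map_simplex prestack) undefined"
      by (intro prestack_hom_empty empty_initial_prestack is_prestack_empty)+
    show "prestack_hom (prestack_of Y) D (comp_map (\<lambda>S n. Inr) (postcompose e))"
      by (rule prestack_hom_comp[OF prestack_hom_postcompose[OF Y Nm e(1)] D(2)])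
    show "prestack_hom D (prestack_of Y) (comp_map (postcompose e') (\<lambda>S n. projr))"
      by (rule prestack_hom_comp[OF D(3) prestack_hom_postcompose[OF Nm Y e(2)]])
    show "agree_on (prestack_of Y)
       (comp_map (comp_map (postcompose e') (\<lambda>S n. projr)) (comp_map (\<lambda>S n. Inr :: _ \<Rightarrow> 'u large) (postcompose e))) inclusion"
      using postcompose_inverse[of Y e' e] e(3) by (simp add: agree_on_def comp_map_def)
  qed (intro agree_on_empty empty_initial_prestack)+
  then show ?thesis
    unfolding cofibrant_def cofibration_def
    using tr prestack_hom_empty[OF empty_initial_prestack is_prestack_of[OF Y]] by blast
qed

lemma empty_boundary_0: "cells (boundary_sset 0) m = {}"
  by (auto simp: boundary_sset_def Delta_maps_0)

text \<open>All chart conditions are vacuous. This submanifold makes a map from an empty prestack to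
  \<open>S\<close> times \<Delta>^0 a generating intermediate cofibration.\<close>

lemma stein_inclusion_empty:
  assumes "stein S"
  shows "stein_inclusion \<lparr>mtop = subtopology (mtop S) {}, atlas = {}\<rparr> S"
proof -
  have "Hausdorff_space (subtopology (mtop S) {})" "second_countable (subtopology (mtop S) {})"
    using assms unfolding stein_def complex_manifold_def
    by (blast intro: Hausdorff_space_subtopology second_countable_subtopology)+
  then show ?thesis
    using assms by (auto simp: stein_inclusion_def closed_submanifold_def complex_manifold_def stein_def)
qed

lemma stein_imp_cofibrant:
  fixes X :: "'z cmanifold"
  assumes "stein X"
  shows "projectively_cofibrant TYPE('u) X" "intermediately_cofibrant TYPE('u) X"
proof -
  have X: "complex_manifold X" using assms by (simp add: stein_def)
  obtain N :: "real cmanifold" and e e' where N: "complex_manifold N" "e \<in> holomorphic_maps X N"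
    "e' \<in> holomorphic_maps N X" "\<And>x. x \<in> points X \<Longrightarrow> e' (e x) = x" "\<And>y. y \<in> points N \<Longrightarrow> e (e' y) = y"
    using real_copy[OF X] by blast
  \<comment> \<open>The roles of \<open>X\<close> and \<open>N\<close> are exchanged here:
    \<open>N\<close> is a retract of the Stein manifold \<open>X\<close>.\<close>
  have st: "stein N" by (rule stein_retract[OF N(1) assms N(3,2,5)])
  then have NS: "N \<in> Steins" by (simp add: Steins_def)
  show "projectively_cofibrant TYPE('u) X"
    unfolding projectively_cofibrant_def
  proof (rule cofibrant_if_cell[OF X NS N(2-4)])
    show "generating_projective (times_sset (prestack_of N) (boundary_sset 0))
       (times_sset (prestack_of N) (simplex_sset 0)) inclusion"
      unfolding generating_projective_def using NS by blast
    show "empty_prestack (times_sset (prestack_of N) (boundary_sset 0))"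
      by (simp add: empty_prestack_def times_sset_def empty_boundary_0)
  qed
  define T where "T = \<lparr>mtop = subtopology (mtop N) {}, atlas = {}\<rparr>"
  have T: "stein_inclusion T N" unfolding T_def by (rule stein_inclusion_empty[OF st])
  have pT: "points T = {}" by (simp add: T_def)
  show "intermediately_cofibrant TYPE('u) X"
    unfolding intermediately_cofibrant_def
  proof (rule cofibrant_if_cell[OF X NS N(2-4)])
    show "generating_intermediate (pushout (times_sset (prestack_of_sub T) (boundary_sset 0))
         (times_sset (prestack_of N) (boundary_sset 0)) (times_sset (prestack_of_sub T) (simplex_sset 0)) inclusion inclusion)
       (times_sset (prestack_of N) (simplex_sset 0)) (copair inclusion inclusion)"
      unfolding generating_intermediate_def using T by blast
    show "empty_prestack (pushout (times_sset (prestack_of_sub T) (boundary_sset 0))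
         (times_sset (prestack_of N) (boundary_sset 0)) (times_sset (prestack_of_sub T) (simplex_sset 0)) inclusion inclusion)"
      by (simp add: empty_prestack_def pushout_def times_sset_def empty_boundary_0 prestack_of_sub_def pT
          initial_prestack_def quotient_def)
  qed
qed

section \<open>Cell complexes in degree zero\<close>

lemma glue_sym_class:
  assumes "(x, y) \<in> glue A f g S n"
  shows "glue A f g S n `` {x} = glue A f g S n `` {y}"
proof -
  have "sym (glue A f g S n)" unfolding glue_def Let_def by (intro sym_rtrancl sym_Un_converse)
  moreover have "trans (glue A f g S n)" unfolding glue_def Let_def by (rule trans_rtrancl)
  ultimately show ?thesis using assms by (auto dest: symD transD)
qed

lemma glue_refl: "(x, x) \<in> glue A f g S n"
  by (simp add: glue_def Let_def)

lemma glue_invariant: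
  assumes "\<And>a. a \<in> cells (val A S) n \<Longrightarrow> \<phi> (Inl (f S n a)) = \<phi> (Inr (g S n a))" "(x, y) \<in> glue A f g S n"
  shows "\<phi> x = \<phi> y"
  using assms(2) unfolding glue_def Let_def
  by (induction rule: rtrancl_induct) (use assms(1) in auto)

lemma copair_class:
  assumes "\<And>a. a \<in> cells (val A S) n \<Longrightarrow> h S n (f S n a) = k S n (g S n a)"
  shows "copair h k S n (glue A f g S n `` {x}) = case_sum (h S n) (k S n) x"
proof -
  have "case_sum (h S n) (k S n) y = case_sum (h S n) (k S n) x" if "(x, y) \<in> glue A f g S n" for y
    using glue_invariant[of A S n "case_sum (h S n) (k S n)" f g, OF _ that] assms by simp
  then have "case_sum (h S n) (k S n) ` (glue A f g S n `` {x}) \<subseteq> {case_sum (h S n) (k S n) x}" by blast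
  moreover have "x \<in> glue A f g S n `` {x}" using glue_refl by fast
  ultimately have "case_sum (h S n) (k S n) ` (glue A f g S n `` {x}) = {case_sum (h S n) (k S n) x}" by blast
  then show ?thesis by (simp add: copair_def)
qed

text \<open>When \<open>j\<close> is injective, the pushout in this degree is the disjoint union of
  \<open>B\<close> and the part of \<open>Q\<close> outside the image of \<open>j\<close>.\<close>

lemma pushout_square_cells:
  assumes sq: "pushout_square P B Q D a j h k" and R: "R \<in> Steins"
    and inj: "inj_on (j R n) (cells (val P R) n)"
  shows "inj_on (h R n) (cells (val B R) n)"
    and "\<And>d. d \<in> cells (val D R) n \<Longrightarrow> d \<in> h R n ` cells (val B R) n \<or> d \<in> k R n ` cells (val Q R) n"
    and "\<And>q. q \<in> cells (val Q R) n \<Longrightarrow>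
           k R n q \<in> h R n ` cells (val B R) n \<longleftrightarrow> q \<in> j R n ` cells (val P R) n"
    and "\<And>q q'. q \<in> cells (val Q R) n \<Longrightarrow> q' \<in> cells (val Q R) n \<Longrightarrow> q \<notin> j R n ` cells (val P R) n \<Longrightarrow>
           k R n q = k R n q' \<Longrightarrow> q = q'"
proof -
  let ?P = "cells (val P R) n" and ?B = "cells (val B R) n" and ?Q = "cells (val Q R) n"
  define G where "G = glue P a j R n"
  define v where "v = case_sum (h R n) (k R n)"
  have eq: "h R n (a R n p) = k R n (j R n p)" if "p \<in> ?P" for p
    using sq R that by (simp add: pushout_square_def agree_on_def comp_map_def)
  have aB: "a R n p \<in> ?B" if "p \<in> ?P" for p
    using sq R that by (simp add: pushout_square_def prestack_hom_def)
  have bij: "bij_betw (copair h k R n) ((?B <+> ?Q) // G) (cells (val D R) n)"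
    using sq R by (simp add: pushout_square_def pushout_def G_def)
  have cop: "copair h k R n (G `` {x}) = v x" for x
    unfolding G_def v_def by (rule copair_class) (rule eq)
  \<comment> \<open>The normal form of an element of the disjoint union: an element
    \<open>j p\<close> of \<open>Q\<close> is replaced by \<open>a p\<close> in \<open>B\<close>. It
    is constant on glued elements, so equality in \<open>D\<close> implies equality of normal forms,
    and all four claims about \<open>h\<close> and \<open>k\<close> can be read off.\<close>
  define \<phi> where "\<phi> = case_sum Inl (\<lambda>q. if q \<in> j R n ` ?P then Inl (a R n (inv_into ?P (j R n) q)) else Inr q)"
  have key: "\<phi> x = \<phi> y" if xy: "x \<in> ?B <+> ?Q" "y \<in> ?B <+> ?Q" "v x = v y" for x y
  proof -
    have "G `` {x} \<in> (?B <+> ?Q) // G" "G `` {y} \<in> (?B <+> ?Q) // G" using xy by (auto intro: quotientI)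
    then have "G `` {x} = G `` {y}" using bij xy(3) cop unfolding bij_betw_def by (metis inj_onD)
    then have "(x, y) \<in> G" using glue_refl[of y P a j R n] unfolding G_def by auto
    moreover have "\<phi> (Inl (a R n p)) = \<phi> (Inr (j R n p))" if "p \<in> ?P" for p
      using that inj by (simp add: \<phi>_def)
    ultimately show ?thesis using glue_invariant[of P R n \<phi> a j x y] unfolding G_def by blast
  qed
  show "inj_on (h R n) ?B"
  proof (rule inj_onI)
    fix b b' assume "b \<in> ?B" "b' \<in> ?B" "h R n b = h R n b'"
    then show "b = b'" using key[of "Inl b" "Inl b'"] by (simp add: \<phi>_def v_def InlI)
  qed
  show "d \<in> h R n ` ?B \<or> d \<in> k R n ` ?Q" if d: "d \<in> cells (val D R) n" for d
  proof -
    have "d \<in> copair h k R n ` ((?B <+> ?Q) // G)" using bij d by (simp add: bij_betw_def)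
    then obtain c where c: "c \<in> (?B <+> ?Q) // G" "d = copair h k R n c" by blast
    from c(1) obtain x where "x \<in> ?B <+> ?Q" "c = G `` {x}" by (rule quotientE)
    then have "x \<in> ?B <+> ?Q" "d = v x" using cop c(2) by simp_all
    then show ?thesis by (auto simp: v_def)
  qed
  show "k R n q \<in> h R n ` ?B \<longleftrightarrow> q \<in> j R n ` ?P" if q: "q \<in> ?Q" for q
  proof
    assume "k R n q \<in> h R n ` ?B"
    then obtain b where "b \<in> ?B" "k R n q = h R n b" by blast
    then have "\<phi> (Inl b) = \<phi> (Inr q)" using q by (intro key) (auto simp: v_def)
    then show "q \<in> j R n ` ?P" by (auto simp: \<phi>_def split: if_splits)
  next
    assume "q \<in> j R n ` ?P"
    then obtain p where "p \<in> ?P" "q = j R n p" by blast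
    then show "k R n q \<in> h R n ` ?B" using eq[of p] aB[of p] by (intro image_eqI[of _ _ "a R n p"]) auto
  qed
  show "q = q'" if q: "q \<in> ?Q" "q' \<in> ?Q" "q \<notin> j R n ` ?P" "k R n q = k R n q'" for q q'
  proof -
    have "\<phi> (Inr q) = \<phi> (Inr q')" using q by (intro key) (auto simp: v_def)
    then show ?thesis using q(3) by (auto simp: \<phi>_def split: if_splits)
  qed
qed

text \<open>What a generating cofibration does in degree \<open>0\<close>: nothing if \<open>n > 0\<close>, and otherwise it is the
  inclusion of \<open>O(\<cdot>,T)\<close> in \<open>O(\<cdot>,S)\<close>.\<close>

definition vertex_cell ::
  "'p prestack \<Rightarrow> (real map_simplex \<times> (nat \<Rightarrow> nat)) prestack \<Rightarrow> ('p, real map_simplex \<times> (nat \<Rightarrow> nat)) prestack_map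
     \<Rightarrow> real cmanifold \<Rightarrow> real cmanifold \<Rightarrow> nat \<Rightarrow> bool" where
  "vertex_cell P Q j S T n \<longleftrightarrow> stein S \<and> closed_submanifold T S \<and>
     Q = times_sset (prestack_of S) (simplex_sset n) \<and>
     (\<forall>R\<in>Steins. inj_on (j R 0) (cells (val P R) 0) \<and>
        (n > 0 \<longrightarrow> cells (val Q R) 0 \<subseteq> j R 0 ` cells (val P R) 0) \<and>
        (n = 0 \<longrightarrow> j R 0 ` cells (val P R) 0 =
           cells (val (times_sset (prestack_of_sub T) (simplex_sset 0)) R) 0))"

definition vertex_cells :: "('p, real map_simplex \<times> (nat \<Rightarrow> nat)) map_class \<Rightarrow> bool" where
  "vertex_cells J \<longleftrightarrow> (\<forall>P Q j. J P Q j \<longrightarrow> (\<exists>S T n. vertex_cell P Q j S T n))"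

lemma boundary_vertices: "n > 0 \<Longrightarrow> cells (boundary_sset n) 0 = cells (simplex_sset n) 0"
proof -
  assume "n > 0"
  then have "{x} \<noteq> {..n}" for x by (metis atMost_iff le0 less_numeral_extra(3) order_refl singletonD)
  then show ?thesis by (auto simp: boundary_sset_def simplex_sset_def)
qed

lemma cells_times: "cells (val (times_sset A K) R) n = cells (val A R) n \<times> cells K n"
  by (simp add: times_sset_def)

lemma vertex_cells_projective: "vertex_cells generating_projective"
  unfolding vertex_cells_def
proof (intro allI impI)
  fix P Q :: "(real map_simplex \<times> (nat \<Rightarrow> nat)) prestack" and j assume "generating_projective P Q j"
  then obtain S n where S: "stein S" and P: "P = times_sset (prestack_of S) (boundary_sset n)"
    and Q: "Q = times_sset (prestack_of S) (simplex_sset n)" and j: "j = inclusion"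
    unfolding generating_projective_def Steins_def by blast
  \<comment> \<open>A projective cell is treated as an intermediate one with empty submanifold, for
    which \<open>prestack_of_sub\<close> is the initial prestack.\<close>
  define T where "T = \<lparr>mtop = subtopology (mtop S) {}, atlas = {}\<rparr>"
  have "closed_submanifold T S" using stein_inclusion_empty[OF S] by (simp add: T_def stein_inclusion_def)
  moreover have "points T = {}" by (simp add: T_def)
  ultimately show "\<exists>S T n. vertex_cell P Q j S T n"
    using S Q by (intro exI[of _ S] exI[of _ T] exI[of _ n])
      (auto simp: vertex_cell_def P j cells_times boundary_vertices empty_boundary_0 prestack_of_sub_def initial_prestack_def)
qed

text \<open>For \<open>n = 0\<close> the boundary is empty and only the copy of \<open>T\<close>
  remains of the pushout. For \<open>n > 0\<close> the boundary contains all vertices, so in degree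
  0 the pushout is already all of \<open>S\<close> times \<Delta>^n.\<close>

lemma vertex_cells_intermediate: "vertex_cells generating_intermediate"
  unfolding vertex_cells_def
proof (intro allI impI)
  fix P Q and j assume "generating_intermediate P Q j"
  then obtain T S n where TS: "stein_inclusion T S"
    and P: "P = pushout (times_sset (prestack_of_sub T) (boundary_sset n))
              (times_sset (prestack_of S) (boundary_sset n))
              (times_sset (prestack_of_sub T) (simplex_sset n)) inclusion inclusion"
    and Q: "Q = times_sset (prestack_of S) (simplex_sset n)" and j: "j = copair inclusion inclusion"
    unfolding generating_intermediate_def by blast
  define A where "A = times_sset (prestack_of_sub T) (boundary_sset n)"
  define t where "t R = cells (val (prestack_of_sub T) R) 0" for R
  define s where "s R = cells (sO R S) 0" for R
  define G where "G R = glue A inclusion inclusion R 0" for R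
  have cP: "cells (val P R) 0 =
      (s R \<times> cells (boundary_sset n) 0 <+> t R \<times> cells (simplex_sset n) 0) // G R" for R
    by (simp add: P pushout_def cells_times A_def G_def s_def t_def)
  have jc: "j R 0 (G R `` {x}) = case_sum (\<lambda>x. x) (\<lambda>x. x) x" for R x
    unfolding j G_def by (rule copair_class) simp
  have "inj_on (j R 0) (cells (val P R) 0) \<and>
           (n > 0 \<longrightarrow> cells (val Q R) 0 \<subseteq> j R 0 ` cells (val P R) 0) \<and>
           (n = 0 \<longrightarrow> j R 0 ` cells (val P R) 0 =
              cells (val (times_sset (prestack_of_sub T) (simplex_sset 0)) R) 0)" for R
  proof (cases "n = 0")
    case True
    have "G R = Id" by (simp add: G_def A_def glue_def cells_times True empty_boundary_0)
    then have P': "cells (val P R) 0 = (\<lambda>y. G R `` {Inr y}) ` (t R \<times> cells (simplex_sset n) 0)"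
      unfolding cP by (auto simp: quotient_def True empty_boundary_0)
    show ?thesis
      unfolding P' using True by (auto simp: inj_on_def jc image_image cells_times t_def)
  next
    case False
    then have b: "cells (boundary_sset n) 0 = cells (simplex_sset n) 0" by (intro boundary_vertices) simp
    \<comment> \<open>For \<open>n > 0\<close> each class has a representative over
      \<open>S\<close>, and \<open>j\<close> returns this representative; hence \<open>j\<close> is
      injective.\<close>
    have cl: "G R `` {x} = G R `` {Inl (case_sum (\<lambda>x. x) (\<lambda>x. x) x)}"
      if x: "x \<in> s R \<times> cells (boundary_sset n) 0 <+> t R \<times> cells (simplex_sset n) 0" for x
    proof (cases x)
      case (Inr y)
      with x have "y \<in> cells (val A R) 0" by (auto simp: A_def cells_times t_def b)
      then have "(Inl y, Inr y) \<in> G R" unfolding G_def glue_def Let_def by (intro r_into_rtrancl) blast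
      then show ?thesis using Inr glue_sym_class unfolding G_def by fastforce
    qed simp
    have "inj_on (j R 0) (cells (val P R) 0)"
    proof (rule inj_onI)
      fix c c' assume "c \<in> cells (val P R) 0" "c' \<in> cells (val P R) 0" and eq: "j R 0 c = j R 0 c'"
      then obtain x x' where x: "c = G R `` {x}" "x \<in> s R \<times> cells (boundary_sset n) 0 <+> t R \<times> cells (simplex_sset n) 0"
        "c' = G R `` {x'}" "x' \<in> s R \<times> cells (boundary_sset n) 0 <+> t R \<times> cells (simplex_sset n) 0"
        unfolding cP by (auto elim!: quotientE)
      then show "c = c'" using cl[OF x(2)] cl[OF x(4)] eq jc by simp
    qed
    moreover have "cells (val Q R) 0 \<subseteq> j R 0 ` cells (val P R) 0"
    proof
      fix q assume "q \<in> cells (val Q R) 0"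
      then have "Inl q \<in> s R \<times> cells (boundary_sset n) 0 <+> t R \<times> cells (simplex_sset n) 0"
        by (auto simp: Q cells_times b s_def)
      then have "G R `` {Inl q} \<in> cells (val P R) 0" unfolding cP by (rule quotientI)
      moreover have "q = j R 0 (G R `` {Inl q})" by (simp add: jc)
      ultimately show "q \<in> j R 0 ` cells (val P R) 0" by blast
    qed
    ultimately show ?thesis using False by simp
  qed
  then show "\<exists>S T n. vertex_cell P Q j S T n"
    using TS Q unfolding stein_inclusion_def vertex_cell_def by blast
qed

section \<open>Vertices of prestacks as holomorphic maps\<close>

definition vertex :: "'b \<Rightarrow> (nat \<Rightarrow> real) \<Rightarrow> 'b" where
  "vertex y = (\<lambda>t\<in>standard_simplex 0. y)"

lemma vertex_inject [simp]: "vertex y = vertex y' \<longleftrightarrow> y = y'"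
  unfolding vertex_def fun_eq_iff restrict_def standard_simplex_0 by auto

lemma cells_0: "cells (sO R S) 0 = vertex ` holomorphic_maps R S"
proof (intro equalityI subsetI)
  fix \<sigma> assume "\<sigma> \<in> cells (sO R S) 0"
  then have \<sigma>: "singular_simplex 0 (mapping_space R S) \<sigma>" by simp
  let ?p = "(\<lambda>j. if j = 0 then 1 else 0) :: nat \<Rightarrow> real"
  have "\<sigma> = vertex (\<sigma> ?p)"
    using \<sigma> by (auto simp: vertex_def singular_simplex_def standard_simplex_0 extensional_def)
  moreover have "\<sigma> ?p \<in> holomorphic_maps R S"
    by (rule mapping_simplexD[OF \<sigma>]) (simp add: standard_simplex_0)
  ultimately show "\<sigma> \<in> vertex ` holomorphic_maps R S" by blast
next
  fix \<sigma> assume "\<sigma> \<in> vertex ` holomorphic_maps R S"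
  then show "\<sigma> \<in> cells (sO R S) 0"
    by (auto simp: vertex_def topspace_mapping_space intro!: singular_simplex_const)
qed

lemma sO_comp_vertex: "sO_comp R 0 (vertex g) (vertex f) = vertex (compose (points R) g f)"
  by (auto simp: sO_comp_def vertex_def)

text \<open>The clause on \<open>points T\<close> mirrors \<open>prestack_of_sub\<close>: for an
  empty \<open>T\<close> every map counts as outside, including the map from an empty
  \<open>R\<close>, which does lie in \<open>holomorphic_maps R T\<close>.\<close>

definition outside_map :: "real cmanifold \<Rightarrow> real cmanifold \<Rightarrow> real cmanifold \<Rightarrow> (real \<Rightarrow> real) \<Rightarrow> bool" where
  "outside_map S T R s \<longleftrightarrow> s \<in> holomorphic_maps R S \<and> \<not> (points T \<noteq> {} \<and> s \<in> holomorphic_maps R T)"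

text \<open>Attachment of one vertex cell, seen in degree 0 only and without the generating
  cofibration behind it: \<open>\<kappa> R s\<close> is the vertex of \<open>D\<close> given by
  \<open>s\<close>, natural in \<open>R\<close>. It is new exactly when \<open>s\<close> is outside
  \<open>T\<close>, and new vertices determine \<open>s\<close>.\<close>

definition vertex_step ::
  "'b prestack \<Rightarrow> 'c prestack \<Rightarrow> ('b, 'c) prestack_map \<Rightarrow> real cmanifold \<Rightarrow> real cmanifold
     \<Rightarrow> (real cmanifold \<Rightarrow> (real \<Rightarrow> real) \<Rightarrow> 'c) \<Rightarrow> bool" where
  "vertex_step B D h S T \<kappa> \<longleftrightarrow> stein S \<and> closed_submanifold T S \<and>
     (\<forall>R\<in>Steins.
        (\<forall>s\<in>holomorphic_maps R S. \<kappa> R s \<in> cells (val D R) 0 \<and>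
           (\<forall>R'\<in>Steins. \<forall>g\<in>holomorphic_maps R' R.
              pull D R' R 0 (vertex g) (\<kappa> R s) = \<kappa> R' (compose (points R') s g)) \<and>
           (\<kappa> R s \<in> h R 0 ` cells (val B R) 0 \<longleftrightarrow> \<not> outside_map S T R s) \<and>
           (\<forall>s'\<in>holomorphic_maps R S. outside_map S T R s \<longrightarrow> \<kappa> R s = \<kappa> R s' \<longrightarrow> s = s')) \<and>
        (\<forall>d\<in>cells (val D R) 0. d \<in> h R 0 ` cells (val B R) 0 \<or> d \<in> \<kappa> R ` holomorphic_maps R S))"

lemma pushout_vertex_step:
  assumes J: "vertex_cells J" and po: "is_pushout_of J B D h"
  shows "\<forall>R\<in>Steins. inj_on (h R 0) (cells (val B R) 0)"
    and "(\<forall>R\<in>Steins. cells (val D R) 0 \<subseteq> h R 0 ` cells (val B R) 0) \<or> (\<exists>S T \<kappa>. vertex_step B D h S T \<kappa>)"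
proof -
  from po obtain P Q j a k where JP: "J P Q j" and sq: "pushout_square P B Q D a j h k"
    unfolding is_pushout_of_def by blast
  from J JP obtain S T n where S: "stein S" "closed_submanifold T S"
    and Q: "Q = times_sset (prestack_of S) (simplex_sset n)"
    and inj: "\<And>R. R \<in> Steins \<Longrightarrow> inj_on (j R 0) (cells (val P R) 0)"
    and pos: "\<And>R. R \<in> Steins \<Longrightarrow> n > 0 \<Longrightarrow> cells (val Q R) 0 \<subseteq> j R 0 ` cells (val P R) 0"
    and zero: "\<And>R. R \<in> Steins \<Longrightarrow> n = 0 \<Longrightarrow> j R 0 ` cells (val P R) 0 =
              cells (val (times_sset (prestack_of_sub T) (simplex_sset 0)) R) 0"
    unfolding vertex_cells_def vertex_cell_def by metis
  note pc = pushout_square_cells[OF sq _ inj]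
  show "\<forall>R\<in>Steins. inj_on (h R 0) (cells (val B R) 0)" using pc(1) by blast
  show "(\<forall>R\<in>Steins. cells (val D R) 0 \<subseteq> h R 0 ` cells (val B R) 0) \<or> (\<exists>S T \<kappa>. vertex_step B D h S T \<kappa>)"
  proof (cases "n = 0")
    case False
    have "d \<in> h R 0 ` cells (val B R) 0" if R: "R \<in> Steins" and d: "d \<in> cells (val D R) 0" for R d
      using pc(2)[OF R R d] pc(3)[OF R R] pos[OF R] False by auto
    then show ?thesis by blast
  next
    case True
    \<comment> \<open>The unique vertex of \<Delta>^0, so that degree 0 of \<open>Q\<close> consists
      of the pairs \<open>(vertex s, z)\<close>.\<close>
    define z :: "nat \<Rightarrow> nat" where "z = (\<lambda>i\<in>{..0}. 0)"
    define \<kappa> where "\<kappa> R s = k R 0 (vertex s, z)" for R s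
    have cQ: "cells (val Q R) 0 = (\<lambda>s. (vertex s, z)) ` holomorphic_maps R S" for R
      unfolding Q True cells_times prestack_of_simps cells_0
      by (auto simp: simplex_sset_def Delta_maps_0 z_def)
    have cP: "(vertex s, z) \<in> j R 0 ` cells (val P R) 0 \<longleftrightarrow> points T \<noteq> {} \<and> s \<in> holomorphic_maps R T"
      if "R \<in> Steins" for R s
    proof (cases "points T = {}")
      case True
      then show ?thesis using zero[OF that \<open>n = 0\<close>] by (simp add: cells_times prestack_of_sub_def initial_prestack_def)
    next
      case False
      then have "j R 0 ` cells (val P R) 0 = (vertex ` holomorphic_maps R T) \<times> {z}"
        unfolding zero[OF that \<open>n = 0\<close>] cells_times prestack_of_sub_def using cells_0[of R T]
        by (simp add: simplex_sset_def Delta_maps_0 z_def)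
      then show ?thesis using False by (auto simp: image_iff)
    qed
    have hom: "prestack_hom Q D k" using sq by (simp add: pushout_square_def)
    have "vertex_step B D h S T \<kappa>"
      unfolding vertex_step_def
    proof (intro conjI S ballI impI)
      fix R s assume R: "R \<in> Steins" and s: "s \<in> holomorphic_maps R S"
      have q: "(vertex s, z) \<in> cells (val Q R) 0" unfolding cQ using s by blast
      show "\<kappa> R s \<in> cells (val D R) 0" using hom R q by (simp add: prestack_hom_def \<kappa>_def)
      show "pull D R' R 0 (vertex g) (\<kappa> R s) = \<kappa> R' (compose (points R') s g)"
        if R': "R' \<in> Steins" and g: "g \<in> holomorphic_maps R' R" for R' g
      proof -
        have "vertex g \<in> cells (sO R' R) 0" unfolding cells_0 using g by blast
        then have "k R' 0 (pull Q R' R 0 (vertex g) (vertex s, z)) = pull D R' R 0 (vertex g) (k R 0 (vertex s, z))"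
          using hom R R' q unfolding prestack_hom_def by blast
        then show ?thesis by (simp add: \<kappa>_def Q times_sset_def sO_comp_vertex)
      qed
      show "\<kappa> R s \<in> h R 0 ` cells (val B R) 0 \<longleftrightarrow> \<not> outside_map S T R s"
        using pc(3)[OF R R q] cP[OF R] s by (simp add: \<kappa>_def outside_map_def)
      fix s' assume s': "s' \<in> holomorphic_maps R S" "outside_map S T R s" "\<kappa> R s = \<kappa> R s'"
      have "(vertex s', z) \<in> cells (val Q R) 0" unfolding cQ using s' by blast
      then have "(vertex s, z) = (vertex s', z)"
        using s' cP[OF R, of s] by (intro pc(4)[OF R R q]) (auto simp: \<kappa>_def outside_map_def)
      then show "s = s'" by simp
    next
      fix R d assume R: "R \<in> Steins" and "d \<in> cells (val D R) 0"
      then show "d \<in> h R 0 ` cells (val B R) 0 \<or> d \<in> \<kappa> R ` holomorphic_maps R S"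
        using pc(2)[OF R R] by (auto simp: cQ \<kappa>_def image_image)
    qed
    then show ?thesis by blast
  qed
qed

text \<open>Each vertex of \<open>D\<close> has a least stage at which it is present. This is not
  the initial stage, which is empty, nor a limit stage, since a colimit adds no elements, nor one
  where a cell with \<open>n > 0\<close> is attached. A step attaches a single cell, so the stage
  can serve as its index.\<close>

lemma cell_complex_normal_form:
  fixes C D :: "'u prestack"
  assumes J: "vertex_cells J" and tc: "transfinite_composition_of (is_pushout_of J) C D f" and C: "empty_prestack C"
  obtains I :: "'u set" and S T \<kappa> where
    "\<And>i. i \<in> I \<Longrightarrow> stein (S i)" "\<And>i. i \<in> I \<Longrightarrow> closed_submanifold (T i) (S i)"
    "\<And>i R s. i \<in> I \<Longrightarrow> R \<in> Steins \<Longrightarrow> s \<in> holomorphic_maps R (S i) \<Longrightarrow> \<kappa> i R s \<in> cells (val D R) 0"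
    "\<And>i R R' s g. i \<in> I \<Longrightarrow> R \<in> Steins \<Longrightarrow> R' \<in> Steins \<Longrightarrow> s \<in> holomorphic_maps R (S i) \<Longrightarrow>
       g \<in> holomorphic_maps R' R \<Longrightarrow> pull D R' R 0 (vertex g) (\<kappa> i R s) = \<kappa> i R' (compose (points R') s g)"
    "\<And>R d. R \<in> Steins \<Longrightarrow> d \<in> cells (val D R) 0 \<Longrightarrow> \<exists>i\<in>I. \<exists>s. outside_map (S i) (T i) R s \<and> d = \<kappa> i R s"
    "\<And>i j R s s'. i \<in> I \<Longrightarrow> j \<in> I \<Longrightarrow> R \<in> Steins \<Longrightarrow> outside_map (S i) (T i) R s \<Longrightarrow>
       outside_map (S j) (T j) R s' \<Longrightarrow> \<kappa> i R s = \<kappa> j R s' \<Longrightarrow> i = j \<and> s = s'"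
proof -
  from tc obtain r A m k b where r: "Well_order (r :: 'u rel)"
    and hom: "\<And>i j. (i, j) \<in> r \<Longrightarrow> prestack_hom (A i) (A j) (m i j)"
    and mid: "\<And>i. i \<in> Field r \<Longrightarrow> agree_on (A i) (m i i) inclusion"
    and mcomp: "\<And>i j l. (i, j) \<in> r \<Longrightarrow> (j, l) \<in> r \<Longrightarrow> agree_on (A i) (m i l) (comp_map (m j l) (m i j))"
    and succ: "\<And>i j. i \<in> Field r \<Longrightarrow> j \<in> Field r \<Longrightarrow> underS r j = under r i \<Longrightarrow> is_pushout_of J (A i) (A j) (m i j)"
    and lim: "\<And>j. j \<in> Field r \<Longrightarrow> underS r j \<noteq> {} \<Longrightarrow> (\<nexists>i. i \<in> Field r \<and> underS r j = under r i) \<Longrightarrow>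
           chain_colimit (underS r j) r A m (A j) (\<lambda>i. m i j)"
    and col: "chain_colimit (Field r) r A m D k"
    and b: "b \<in> Field r" "underS r b = {}" "C = A b"
    unfolding transfinite_composition_of_def by blast
  note wo = r[unfolded well_order_on_def linear_order_on_def partial_order_on_def preorder_on_def]
  have wf: "wf (r - Id)" using wo by blast
  have refl: "(i, i) \<in> r" if "i \<in> Field r" for i using wo that by (simp add: refl_on_def)
  have tot: "(i, j) \<in> r \<or> (j, i) \<in> r" if "i \<in> Field r" "j \<in> Field r" for i j
    using wo refl that by (cases "i = j") (auto simp: total_on_def)
  have Fr: "i \<in> Field r" "j \<in> Field r" if "(i, j) \<in> r" for i j using that by (auto simp: Field_def)
  have mcell: "m i j R 0 x \<in> cells (val (A j) R) 0" if "(i, j) \<in> r" "R \<in> Steins" "x \<in> cells (val (A i) R) 0" for i j R x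
    using hom[OF that(1)] that by (simp add: prestack_hom_def)
  have mc: "m i l R 0 x = m j l R 0 (m i j R 0 x)"
    if "(i, j) \<in> r" "(j, l) \<in> r" "R \<in> Steins" "x \<in> cells (val (A i) R) 0" for i j l R x
    using mcomp[OF that(1,2)] that(3,4) by (simp add: agree_on_def comp_map_def)
  have kc: "k i R 0 x = k j R 0 (m i j R 0 x)"
    if "(i, j) \<in> r" "R \<in> Steins" "x \<in> cells (val (A i) R) 0" for i j R x
    using col Fr[OF that(1)] that unfolding chain_colimit_def by (simp add: agree_on_def comp_map_def)
  have khom: "prestack_hom (A i) D (k i)" if "i \<in> Field r" for i
    using col that unfolding chain_colimit_def by blast
  \<comment> \<open>Transfinite induction on the target stage: at a successor a pushout of an
    injective map is injective, and at a limit two elements that become equal are equal at some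
    earlier stage.\<close>
  have minj: "\<forall>i. (i, j) \<in> r \<longrightarrow> (\<forall>R\<in>Steins. inj_on (m i j R 0) (cells (val (A i) R) 0))" for j
    using wf
  proof (induction j rule: wf_induct_rule)
    case (less j)
    show ?case
    proof (intro allI impI ballI)
      fix i R assume ij: "(i, j) \<in> r" and R: "R \<in> Steins"
      show "inj_on (m i j R 0) (cells (val (A i) R) 0)"
      proof (cases "i = j")
        case True
        then show ?thesis using mid[OF Fr(1)[OF ij]] R by (simp add: agree_on_def inj_on_def)
      next
        case False
        then have iS: "i \<in> underS r j" using ij by (simp add: underS_def)
        show ?thesis
        proof (cases "\<exists>p. p \<in> Field r \<and> underS r j = under r p")
          case True
          then obtain p where p: "p \<in> Field r" "underS r j = under r p" by blast
          have ip: "(i, p) \<in> r" using iS p(2) by (simp add: under_def)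
          have "p \<in> underS r j" using p refl by (simp add: under_def)
          then have pj: "(p, j) \<in> r" "p \<noteq> j" by (auto simp: underS_def)
          have "inj_on (m p j R 0) (cells (val (A p) R) 0)"
            using pushout_vertex_step(1)[OF J succ[OF p(1) Fr(2)[OF ij] p(2)]] R by blast
          moreover have "inj_on (m i p R 0) (cells (val (A i) R) 0)" using less pj ip R by blast
          ultimately show ?thesis
            using mc[OF ip pj(1) R] mcell[OF ip R] unfolding inj_on_def by metis
        next
          case no: False
          have cc: "chain_colimit (underS r j) r A m (A j) (\<lambda>i. m i j)"
            using lim[OF Fr(2)[OF ij]] iS no by blast
          show ?thesis
          proof (rule inj_onI)
            fix x y assume xy: "x \<in> cells (val (A i) R) 0" "y \<in> cells (val (A i) R) 0" "m i j R 0 x = m i j R 0 y"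
            then obtain l where l: "l \<in> underS r j" "(i, l) \<in> r" "m i l R 0 x = m i l R 0 y"
              using cc iS R unfolding chain_colimit_def by blast
            have "inj_on (m i l R 0) (cells (val (A i) R) 0)" using less l R by (auto simp: underS_def)
            then show "x = y" using l(3) xy by (auto dest: inj_onD)
          qed
        qed
      qed
    qed
  qed
  have kinj: "x = y" if i: "i \<in> Field r" and R: "R \<in> Steins" and x: "x \<in> cells (val (A i) R) 0"
    and y: "y \<in> cells (val (A i) R) 0" and eq: "k i R 0 x = k i R 0 y" for i R x y
  proof -
    obtain l where l: "(i, l) \<in> r" "m i l R 0 x = m i l R 0 y"
      using col i R x y eq unfolding chain_colimit_def by blast
    then show ?thesis using minj R x y by (meson inj_onD)
  qed
  \<comment> \<open>The indices are the target stages of the steps that attach a vertex cell;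
    \<open>p j\<close> below is the predecessor of such a stage \<open>j\<close>.\<close>
  define I where "I = {j \<in> Field r. \<exists>p S T \<kappa>. p \<in> Field r \<and> underS r j = under r p \<and> vertex_step (A p) (A j) (m p j) S T \<kappa>}"
  then have "\<forall>j\<in>I. \<exists>p S T \<kappa>. p \<in> Field r \<and> underS r j = under r p \<and> vertex_step (A p) (A j) (m p j) S T \<kappa>" by blast
  then obtain p S T \<kappa> where st: "\<And>j. j \<in> I \<Longrightarrow> p j \<in> Field r" "\<And>j. j \<in> I \<Longrightarrow> underS r j = under r (p j)"
    "\<And>j. j \<in> I \<Longrightarrow> vertex_step (A (p j)) (A j) (m (p j) j) (S j) (T j) (\<kappa> j)"
    by metis
  have IF: "j \<in> Field r" if "j \<in> I" for j using that by (simp add: I_def)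
  have \<kappa>c: "\<kappa> i R s \<in> cells (val (A i) R) 0" if "i \<in> I" "R \<in> Steins" "s \<in> holomorphic_maps R (S i)" for i R s
    using st(3)[OF that(1)] that unfolding vertex_step_def by blast
  \<comment> \<open>A vertex attached at stage \<open>i\<close> reaches a later stage
    \<open>j\<close> through the predecessor \<open>p j\<close>. There it is old, whereas the vertex
    of an outside map is new.\<close>
  have less_contr: False
    if ij: "i \<in> I" "j \<in> I" "(i, j) \<in> r" "i \<noteq> j" and R: "R \<in> Steins"
      and s: "outside_map (S i) (T i) R s" "outside_map (S j) (T j) R s'" and eq: "k i R 0 (\<kappa> i R s) = k j R 0 (\<kappa> j R s')"
    for i j R s s'
  proof -
    have sh: "s \<in> holomorphic_maps R (S i)" "s' \<in> holomorphic_maps R (S j)" using s by (auto simp: outside_map_def)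
    note x = \<kappa>c[OF ij(1) R sh(1)] and y = \<kappa>c[OF ij(2) R sh(2)]
    have "m i j R 0 (\<kappa> i R s) = \<kappa> j R s'"
      using kinj[OF IF[OF ij(2)] R mcell[OF ij(3) R x] y] kc[OF ij(3) R x] eq by simp
    moreover have ip: "(i, p j) \<in> r" using ij st(2)[OF ij(2)] by (auto simp: underS_def under_def)
    have "p j \<in> underS r j" using st(2)[OF ij(2)] refl[OF st(1)[OF ij(2)]] by (simp add: under_def)
    then have pj: "(p j, j) \<in> r" by (simp add: underS_def)
    ultimately have "\<kappa> j R s' = m (p j) j R 0 (m i (p j) R 0 (\<kappa> i R s))" using mc[OF ip pj R x] by simp
    then have "\<kappa> j R s' \<in> m (p j) j R 0 ` cells (val (A (p j)) R) 0" using mcell[OF ip R x] by blast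
    then show False using st(3)[OF ij(2)] R sh(2) s(2) unfolding vertex_step_def by blast
  qed
  show thesis
  proof (rule that[of I S T "\<lambda>i R s. k i R 0 (\<kappa> i R s)"])
    show "stein (S i)" "closed_submanifold (T i) (S i)" if "i \<in> I" for i
      using st(3)[OF that] by (auto simp: vertex_step_def)
    fix i R s assume i: "i \<in> I" and R: "R \<in> Steins" and s: "s \<in> holomorphic_maps R (S i)"
    note kh = khom[OF IF[OF i]]
    show "k i R 0 (\<kappa> i R s) \<in> cells (val D R) 0"
      using kh \<kappa>c[OF i R s] R by (simp add: prestack_hom_def)
    fix R' g assume R': "R' \<in> Steins" and g: "g \<in> holomorphic_maps R' R"
    have "vertex g \<in> cells (sO R' R) 0" unfolding cells_0 using g by blast
    then have "pull D R' R 0 (vertex g) (k i R 0 (\<kappa> i R s)) = k i R' 0 (pull (A i) R' R 0 (vertex g) (\<kappa> i R s))"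
      using kh \<kappa>c[OF i R s] R R' unfolding prestack_hom_def by metis
    also have "pull (A i) R' R 0 (vertex g) (\<kappa> i R s) = \<kappa> i R' (compose (points R') s g)"
      using st(3)[OF i] R R' s g unfolding vertex_step_def by blast
    finally show "pull D R' R 0 (vertex g) (k i R 0 (\<kappa> i R s)) = k i R' 0 (\<kappa> i R' (compose (points R') s g))" .
  next
    fix R d assume R: "R \<in> Steins" and d: "d \<in> cells (val D R) 0"
    \<comment> \<open>The stages at which \<open>d\<close> is present; a minimal one is where it was
      attached.\<close>
    define H where "H = {i \<in> Field r. d \<in> k i R 0 ` cells (val (A i) R) 0}"
    have "H \<noteq> {}" using col R d unfolding chain_colimit_def H_def by blast
    then obtain j where j: "j \<in> H" and min: "\<And>i. (i, j) \<in> r - Id \<Longrightarrow> i \<notin> H"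
      using wfE_min[OF wf] by (metis all_not_in_conv)
    have jF: "j \<in> Field r" using j by (simp add: H_def)
    obtain x where x: "x \<in> cells (val (A j) R) 0" "d = k j R 0 x" using j by (auto simp: H_def)
    have nim: "x \<noteq> m i j R 0 x'" if i: "i \<in> underS r j" and x': "x' \<in> cells (val (A i) R) 0" for i x'
    proof
      assume "x = m i j R 0 x'"
      moreover have ij: "(i, j) \<in> r" "i \<noteq> j" using i by (auto simp: underS_def)
      ultimately have "d = k i R 0 x'" using kc[OF ij(1) R x'] x(2) by simp
      then have "i \<in> H" using x' Fr(1)[OF ij(1)] by (auto simp: H_def)
      then show False using min[of i] ij by auto
    qed
    have ne: "underS r j \<noteq> {}"
    proof
      assume e: "underS r j = {}"
      have "j = b" using tot[OF jF b(1)] e b(2) by (auto simp: underS_def)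
      then show False using x(1) C b(3) R by (simp add: empty_prestack_def)
    qed
    have "\<exists>q. q \<in> Field r \<and> underS r j = under r q"
    proof (rule ccontr)
      assume "\<nexists>q. q \<in> Field r \<and> underS r j = under r q"
      then have "chain_colimit (underS r j) r A m (A j) (\<lambda>i. m i j)" by (rule lim[OF jF ne])
      then obtain i x' where "i \<in> underS r j" "x' \<in> cells (val (A i) R) 0" "x = m i j R 0 x'"
        using x(1) R unfolding chain_colimit_def by blast
      then show False using nim by blast
    qed
    then obtain q where q: "q \<in> Field r" "underS r j = under r q" by blast
    have qS: "q \<in> underS r j" using q refl by (simp add: under_def)
    have "\<not> (\<forall>R\<in>Steins. cells (val (A j) R) 0 \<subseteq> m q j R 0 ` cells (val (A q) R) 0)"
      using nim[OF qS] x(1) R by blast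
    then have "\<exists>S T \<kappa>. vertex_step (A q) (A j) (m q j) S T \<kappa>"
      using pushout_vertex_step(2)[OF J succ[OF q(1) jF q(2)]] by blast
    then have jI: "j \<in> I" using jF q unfolding I_def by blast
    have pS: "p j \<in> underS r j" using st(2)[OF jI] refl[OF st(1)[OF jI]] by (simp add: under_def)
    have nx: "x \<notin> m (p j) j R 0 ` cells (val (A (p j)) R) 0" using nim[OF pS] by blast
    then obtain s where s: "s \<in> holomorphic_maps R (S j)" "x = \<kappa> j R s"
      using st(3)[OF jI] R x(1) unfolding vertex_step_def by blast
    moreover have "outside_map (S j) (T j) R s"
      using st(3)[OF jI] R s nx unfolding vertex_step_def by blast
    ultimately show "\<exists>i\<in>I. \<exists>s. outside_map (S i) (T i) R s \<and> d = k i R 0 (\<kappa> i R s)"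
      using jI x(2) by blast
  next
    fix i j R s s' assume ij: "i \<in> I" "j \<in> I" and R: "R \<in> Steins"
      and s: "outside_map (S i) (T i) R s" "outside_map (S j) (T j) R s'" and eq: "k i R 0 (\<kappa> i R s) = k j R 0 (\<kappa> j R s')"
    have ij': "i = j"
    proof (rule ccontr)
      assume ne: "i \<noteq> j"
      show False
        using tot[OF IF[OF ij(1)] IF[OF ij(2)]]
      proof
        assume "(i, j) \<in> r"
        then show False by (rule less_contr[OF ij _ ne R s eq])
      next
        assume "(j, i) \<in> r"
        then show False by (rule less_contr[OF ij(2,1) _ ne[symmetric] R s(2,1) eq[symmetric]])
      qed
    qed
    have sh: "s \<in> holomorphic_maps R (S i)" "s' \<in> holomorphic_maps R (S i)" using s ij' by (auto simp: outside_map_def)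
    have "\<kappa> i R s = \<kappa> i R s'"
      using kinj[OF IF[OF ij(1)] R \<kappa>c[OF ij(1) R sh(1)] \<kappa>c[OF ij(1) R sh(2)]] eq ij' by simp
    then have "s = s'" using st(3)[OF ij(1)] R sh s(1) unfolding vertex_step_def by blast
    then show "i = j \<and> s = s'" using ij' by blast
  qed
qed

text \<open>The class \<open>J\<close> enters only through \<open>vertex_cells\<close>, so the
  projective and the intermediate case are settled together.\<close>

lemma cofibrant_imp_stein:
  fixes X :: "'z cmanifold"
  assumes X: "complex_manifold X" and J: "vertex_cells J" and cof: "cofibrant TYPE('u) J (prestack_of X)"
  shows "stein X"
proof -
  from cof obtain C D :: "'u large prestack" and f where
    tc: "transfinite_composition_of (is_pushout_of J) C D f" and
    ret: "retract_of_map (initial_prestack :: 'z map_simplex prestack) (prestack_of X) inclusion C D f"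
    unfolding cofibrant_def cofibration_def by blast
  from ret obtain p0 i0 p where p0: "prestack_hom C (initial_prestack :: 'z map_simplex prestack) p0"
    and i0: "prestack_hom (prestack_of X) D i0" and p: "prestack_hom D (prestack_of X) p"
    and pi: "agree_on (prestack_of X) (comp_map p i0) inclusion"
    unfolding retract_of_map_def by blast
  \<comment> \<open>The retraction maps \<open>C\<close> into the initial prestack, which leaves
    \<open>C\<close> no simplices.\<close>
  have C: "empty_prestack C"
    using p0 unfolding prestack_hom_def empty_prestack_def by (auto simp: initial_prestack_def)
  obtain N :: "real cmanifold" and e e' where N: "complex_manifold N" "e \<in> holomorphic_maps X N"
    "e' \<in> holomorphic_maps N X" "\<And>x. x \<in> points X \<Longrightarrow> e' (e x) = x" "\<And>y. y \<in> points N \<Longrightarrow> e (e' y) = y"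
    using real_copy[OF X] by blast
  \<comment> \<open>Composing with the isomorphism to \<open>N\<close> makes the prestack of
    \<open>N\<close> a retract of \<open>D\<close>; \<open>N\<close> is needed because
    \<open>stein_if_normal_forms\<close> works with real points.\<close>
  define i where "i = comp_map i0 (postcompose e')"
  define q where "q = comp_map (postcompose e) p"
  have he': "prestack_hom (prestack_of N) (prestack_of X) (postcompose e')"
    by (rule prestack_hom_postcompose[OF N(1) X N(3)])
  have ih: "prestack_hom (prestack_of N) D i"
    unfolding i_def by (rule prestack_hom_comp[OF he' i0])
  have qh: "prestack_hom D (prestack_of N) q"
    unfolding q_def by (rule prestack_hom_comp[OF p prestack_hom_postcompose[OF X N(1,2)]])
  have qi: "q R n (i R n x) = x" if "R \<in> Steins" "x \<in> cells (sO R N) n" for R n x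
  proof -
    have "postcompose e' R n x \<in> cells (sO R X) n"
      using he' that unfolding prestack_hom_def by simp
    then have "p R n (i0 R n (postcompose e' R n x)) = postcompose e' R n x"
      using pi that(1) unfolding agree_on_def comp_map_def by simp
    then show ?thesis
      using postcompose_inverse[of N e e'] N(5) that unfolding agree_on_def comp_map_def i_def q_def by simp
  qed
  have v: "vertex s \<in> cells (sO R M) 0" if "s \<in> holomorphic_maps R M" for R :: "real cmanifold" and M :: "real cmanifold" and s
    unfolding cells_0 using that by blast
  obtain I :: "'u large set" and S T \<kappa> where nf:
    "\<And>i. i \<in> I \<Longrightarrow> stein (S i)" "\<And>i. i \<in> I \<Longrightarrow> closed_submanifold (T i) (S i)"
    "\<And>i R s. i \<in> I \<Longrightarrow> R \<in> Steins \<Longrightarrow> s \<in> holomorphic_maps R (S i) \<Longrightarrow> \<kappa> i R s \<in> cells (val D R) 0"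
    "\<And>i R R' s g. i \<in> I \<Longrightarrow> R \<in> Steins \<Longrightarrow> R' \<in> Steins \<Longrightarrow> s \<in> holomorphic_maps R (S i) \<Longrightarrow>
       g \<in> holomorphic_maps R' R \<Longrightarrow> pull D R' R 0 (vertex g) (\<kappa> i R s) = \<kappa> i R' (compose (points R') s g)"
    "\<And>R d. R \<in> Steins \<Longrightarrow> d \<in> cells (val D R) 0 \<Longrightarrow> \<exists>i\<in>I. \<exists>s. outside_map (S i) (T i) R s \<and> d = \<kappa> i R s"
    "\<And>i j R s s'. i \<in> I \<Longrightarrow> j \<in> I \<Longrightarrow> R \<in> Steins \<Longrightarrow> outside_map (S i) (T i) R s \<Longrightarrow>
       outside_map (S j) (T j) R s' \<Longrightarrow> \<kappa> i R s = \<kappa> j R s' \<Longrightarrow> i = j \<and> s = s'"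
    using cell_complex_normal_form[OF J tc C] by blast
  have SS: "S l \<in> Steins" if "l \<in> I" for l using nf(1)[OF that] by (simp add: Steins_def)
  \<comment> \<open>The vertex given by the identity of \<open>S l\<close> is universal among the
    vertices of this cell. The projection \<open>q\<close> sends it to a holomorphic map
    \<open>h l\<close> from \<open>S l\<close> to \<open>N\<close>.\<close>
  define iota where "iota l = (\<lambda>x\<in>points (S l). x)" for l
  have iota: "iota l \<in> holomorphic_maps (S l) (S l)" if "l \<in> I" for l
    unfolding iota_def by (rule holomorphic_maps_id[OF SteinsD[OF SS[OF that]]])
  have "\<exists>h\<in>holomorphic_maps (S l) N. q (S l) 0 (\<kappa> l (S l) (iota l)) = vertex h" if "l \<in> I" for l
  proof -
    have "q (S l) 0 (\<kappa> l (S l) (iota l)) \<in> cells (sO (S l) N) 0"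
      using qh SS[OF that] nf(3)[OF that SS[OF that] iota[OF that]] unfolding prestack_hom_def by simp
    then show ?thesis unfolding cells_0 by blast
  qed
  then obtain h where h: "\<And>l. l \<in> I \<Longrightarrow> h l \<in> holomorphic_maps (S l) N"
    "\<And>l. l \<in> I \<Longrightarrow> q (S l) 0 (\<kappa> l (S l) (iota l)) = vertex (h l)" by metis
  have "stein N"
  proof (rule stein_if_normal_forms[OF N(1), where I = I and S = S and T = T and \<kappa> = \<kappa> and r = h
        and \<psi> = "\<lambda>R f. i R 0 (vertex f)" and \<rho> = "\<lambda>R' R g. pull D R' R 0 (vertex g)"], unfold outside_map_def[symmetric])
    show "pull D R' R 0 (vertex g) (\<kappa> l R s) = \<kappa> l R' (compose (points R') s g)"
      if "l \<in> I" "stein R" "stein R'" "s \<in> holomorphic_maps R (S l)" "g \<in> holomorphic_maps R' R" for l R R' s g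
      using nf(4) that by (simp add: Steins_def)
    show "pull D R' R 0 (vertex g) (i R 0 (vertex f)) = i R' 0 (vertex (compose (points R') f g))"
      if "stein R" "stein R'" "f \<in> holomorphic_maps R N" "g \<in> holomorphic_maps R' R" for R R' f g
    proof -
      have "i R' 0 (pull (prestack_of N) R' R 0 (vertex g) (vertex f)) = pull D R' R 0 (vertex g) (i R 0 (vertex f))"
        using ih v[OF that(3)] v[OF that(4)] that(1,2) unfolding prestack_hom_def Steins_def by simp
      then show ?thesis by (simp add: sO_comp_vertex)
    qed
    show "\<exists>l\<in>I. \<exists>s. outside_map (S l) (T l) R s \<and> i R 0 (vertex f) = \<kappa> l R s"
      if "stein R" "f \<in> holomorphic_maps R N" for R f
      using ih v[OF that(2)] that(1) unfolding prestack_hom_def by (intro nf(5)) (auto simp: Steins_def)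
    show "l = l' \<and> s = s'" if "stein R" "l \<in> I" "l' \<in> I" "outside_map (S l) (T l) R s"
      "outside_map (S l') (T l') R s'" "\<kappa> l R s = \<kappa> l' R s'" for R l l' s s'
      using nf(6)[OF that(2,3) _ that(4-6)] that(1) by (simp add: Steins_def)
    show "compose (points R) (h l) s = f" if R: "stein R" and l: "l \<in> I" and s: "s \<in> holomorphic_maps R (S l)"
      and f: "f \<in> holomorphic_maps R N" and eq: "i R 0 (vertex f) = \<kappa> l R s" for R l s f
    proof -
      have RS: "R \<in> Steins" using R by (simp add: Steins_def)
      have "compose (points R) (iota l) s = s"
        using s by (auto simp: holomorphic_maps_def PiE_iff compose_def iota_def extensional_def fun_eq_iff)
      \<comment> \<open>Yoneda: \<open>\<kappa> l R s\<close> is the universal vertex pulled back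
        along \<open>s\<close>, so by naturality \<open>q\<close> sends it to \<open>h l\<close>
        after \<open>s\<close>.\<close>
      then have "\<kappa> l R s = pull D R (S l) 0 (vertex s) (\<kappa> l (S l) (iota l))"
        using nf(4)[OF l SS[OF l] RS iota[OF l] s] by simp
      then have "q R 0 (\<kappa> l R s) = pull (prestack_of N) R (S l) 0 (vertex s) (q (S l) 0 (\<kappa> l (S l) (iota l)))"
        using qh nf(3)[OF l SS[OF l] iota[OF l]] v[OF s] RS SS[OF l] unfolding prestack_hom_def by simp
      also have "\<dots> = vertex (compose (points R) (h l) s)" by (simp add: h(2)[OF l] sO_comp_vertex)
      finally have "vertex f = vertex (compose (points R) (h l) s)"
        using qi[OF RS v[OF f]] eq by simp
      then show ?thesis by simp
    qed
  qed (use nf(1,2) h(1) in auto)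
  then show ?thesis by (rule stein_retract[OF X _ N(2,3,4)])
qed

theorem theorem6:
  fixes X :: "'z cmanifold"
  assumes "complex_manifold X"
  shows "(intermediately_cofibrant TYPE('u) X \<longleftrightarrow> projectively_cofibrant TYPE('u) X) \<and>
         (projectively_cofibrant TYPE('u) X \<longleftrightarrow> stein X)"
  using cofibrant_imp_stein[OF assms vertex_cells_projective] cofibrant_imp_stein[OF assms vertex_cells_intermediate]
    stein_imp_cofibrant[where X = X]
  unfolding projectively_cofibrant_def intermediately_cofibrant_def by blast

end
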